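(* Let $\sigma_{\rm b}^2>0$, $\sigma_{\rm w}^2>0$ and $P_{\max}\in(0,\infty)$ be constants and let $T(n)$ be positive integers with $T(n)=\omega(1)$ (i.e. $T(n)\to\infty$ as $n\to\infty$). Consider the slotted AWGN channel with $T(n)$ slots of $n$ symbol periods each, with noise variance $\sigma_{\rm b}^2$ at Bob and $\sigma_{\rm w}^2$ at Willie, where Alice is subject to the average power constraint $P_{\max}$ and shares a secret with Bob, as described in the context. (Achievability) Suppose that, if Alice transmits, she uses one slot $t_{\rm A}$ chosen uniformly at random from $\{1,\dots,T(n)\}$. For every $\epsilon>0$ there exist a constant $c>0$ and a sequence of coding schemes, indexed by $n$, sending $M(n)$-bit messages with $M(n)\ge c\min\{\sqrt{n\log T(n)},\,n\}$ for all sufficiently large $n$, such that Bob's decoding error probability satisfies $\mathbb{P}_{\rm e}^{({\rm b})}\to 0$ as $n\to\infty$ and, for all sufficiently large $n$, every hypothesis test used by Willie has probability of detection error $\mathbb{P}_{\rm e}^{({\rm w})}=\tfrac12(\mathbb{P}_{\rm FA}+\mathbb{P}_{\rm MD})>\tfrac12-\epsilon$. (Converse) Consider any sequence of coding schemes, indexed by $n$, in which Alice, if she transmits, sends an $M(n)$-bit message using $n$ consecutive symbol periods out of the $nT(n)$ available ones, where $M(n)=\omega(\sqrt{n\log T(n)})$ (i.e. $M(n)/\sqrt{n\log T(n)}\to\infty$). If $\mathbb{P}_{\rm e}^{({\rm b})}\to0$ as $n\to\infty$, then there is a sequence of hypothesis tests for Willie with $\mathbb{P}_{\rm FA}+\mathbb{P}_{\rm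 MD}\to0$ as $n\to\infty$.
   Context: Channel. For each $n$ there are $nT(n)$ symbol periods, divided into $T(n)$ consecutive slots of $n$ symbol periods. Bob's noise $Z^{({\rm b})}_1,\dots,Z^{({\rm b})}_{nT(n)}$ is i.i.d. $\mathcal N(0,\sigma_{\rm b}^2)$ and Willie's noise $Z^{({\rm w})}_1,\dots,Z^{({\rm w})}_{nT(n)}$ is i.i.d. $\mathcal N(0,\sigma_{\rm w}^2)$; the two noises are independent of each other and of everything Alice does. If Alice does not transmit, Bob and Willie observe $\mathbf Y_{\rm b}=(Z^{({\rm b})}_i)_i$ and $\mathbf Y_{\rm w}=(Z^{({\rm w})}_i)_i$. If she transmits a vector $\mathbf f=(f_1,\dots,f_n)\in\mathbb R^n$ using the $n$ consecutive symbol periods $\ell,\ell+1,\dots,\ell+n-1$, then $f_j$ is added to both observations at symbol period $\ell+j-1$, $j=1,\dots,n$, all other observations being pure noise. Using slot $t_{\rm A}$ means $\ell=(t_{\rm A}-1)n+1$. Coding scheme. A coding scheme with $M$-bit messages consists of a secret key $K$ (a random variable of arbitrary size, e.g. a random codebook) known to Alice and Bob and not to Willie, an encoder assigning to each message $W\in\{1,\dots,2^M\}$ and key value a codeword $\mathbf c(W,K)\in\mathbb R^n$, which is the transmitted vector, and a decoder for Bob that produces an estimate $\hat W$ from $\mathbf Y_{\rm b}$, $K$, and the location of the transmission (the location may be part of the pre-shared secret). The message $W$ is uniform on $\{1,\dots,2^M\}$, and $W$, $K$, the location of the transmission and the noises are independent. The average power constraint is $\frac1n\mathbb E\|\mathbf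 c(W,K)\|_2^2\le P_{\max}$. Bob's decoding error probability is $\mathbb{P}_{\rm e}^{({\rm b})}=\mathbb P(\hat W\ne W)$ when Alice transmits, averaged over messages, keys (codebooks), location and noise. Willie. Willie knows the whole statistical description of the scheme and channel, but not $W$, $K$, or the location of the transmission. He applies a (possibly randomized) test to $\mathbf Y_{\rm w}$ to decide between $H_0$ (Alice does not transmit) and $H_1$ (Alice transmits). $\mathbb{P}_{\rm FA}$ is the probability of rejecting $H_0$ when $H_0$ is true, and $\mathbb{P}_{\rm MD}$ is the probability of accepting $H_0$ when $H_1$ is true (with $W$, $K$, the location and the noise all random). The probability of detection error is taken with equal priors on $H_0$ and $H_1$. *)

theory Defs
  imports "HOL-Probability.Probability"
begin

text \<open>
  A vector in \<open>\<real>\<^sup>N\<close> is an extensional function on the index set \<open>{1..N}\<close>.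
\<close>

definition samples :: "nat \<Rightarrow> (nat \<Rightarrow> real) measure" where
  "samples N = (\<Pi>\<^sub>M i\<in>{1..N}. borel)"

definition awgn :: "real \<Rightarrow> nat \<Rightarrow> (nat \<Rightarrow> real) measure" where
  "awgn \<sigma> N = (\<Pi>\<^sub>M i\<in>{1..N}. density lborel (normal_density 0 \<sigma>))"

definition received :: "nat \<Rightarrow> nat \<Rightarrow> nat \<Rightarrow> (nat \<Rightarrow> real) \<Rightarrow> (nat \<Rightarrow> real) \<Rightarrow> nat \<Rightarrow> real" where
  "received n N l f z =
     (\<lambda>i\<in>{1..N}. z i + (if l \<le> i \<and> i < l + n then f (i - l + 1) else 0))"

text \<open>
  The key is the identity on the probability space \<open>key_space\<close>. Any randomness
  of the encoder or decoder is carried by the key; the last argument of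
  \<open>decode\<close> is the location of the transmission.
\<close>

record 'k coding_scheme =
  msg_bits :: nat
  key_space :: "'k measure"
  encode :: "nat \<Rightarrow> 'k \<Rightarrow> nat \<Rightarrow> real"
  decode :: "(nat \<Rightarrow> real) \<Rightarrow> 'k \<Rightarrow> nat \<Rightarrow> nat"

definition message_space :: "nat \<Rightarrow> nat measure" where
  "message_space M = uniform_count_measure {1..2 ^ M}"

text \<open>
  Integrability is required explicitly, since the Bochner integral of a
  non-integrable function is \<open>0\<close> and the power bound would then hold trivially.
\<close>

definition valid_scheme :: "nat \<Rightarrow> nat \<Rightarrow> real \<Rightarrow> 'k coding_scheme \<Rightarrow> bool" where
  "valid_scheme n N P S \<longleftrightarrow>
     prob_space (key_space S) \<and>
     (\<lambda>(w, k). encode S w k)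
       \<in> measurable (message_space (msg_bits S) \<Otimes>\<^sub>M key_space S) (samples n) \<and>
     (\<lambda>(y, k, l). decode S y k l)
       \<in> measurable (samples N \<Otimes>\<^sub>M (key_space S \<Otimes>\<^sub>M count_space UNIV)) (count_space UNIV) \<and>
     integrable (message_space (msg_bits S) \<Otimes>\<^sub>M key_space S)
       (\<lambda>(w, k). \<Sum>i = 1..n. (encode S w k i)\<^sup>2) \<and>
     1 / real n * (\<integral>(w, k). (\<Sum>i = 1..n. (encode S w k i)\<^sup>2)
       \<partial>(message_space (msg_bits S) \<Otimes>\<^sub>M key_space S)) \<le> P"

text \<open>
  Under \<open>H\<^sub>1\<close> an outcome is \<open>((w, k, l), zb, zw)\<close>: message, key, first symbol
  period of the transmission, Bob's noise and Willie's noise. Their mutual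
  independence is expressed by the product measure.
\<close>

definition transmission_space ::
    "real \<Rightarrow> real \<Rightarrow> nat \<Rightarrow> 'k coding_scheme \<Rightarrow> nat pmf
      \<Rightarrow> ((nat \<times> 'k \<times> nat) \<times> (nat \<Rightarrow> real) \<times> (nat \<Rightarrow> real)) measure" where
  "transmission_space \<sigma>b \<sigma>w N S L =
     (message_space (msg_bits S) \<Otimes>\<^sub>M (key_space S \<Otimes>\<^sub>M measure_pmf L))
       \<Otimes>\<^sub>M (awgn \<sigma>b N \<Otimes>\<^sub>M awgn \<sigma>w N)"

definition bob_error ::
    "real \<Rightarrow> real \<Rightarrow> nat \<Rightarrow> nat \<Rightarrow> 'k coding_scheme \<Rightarrow> nat pmf \<Rightarrow> real" where
  "bob_error \<sigma>b \<sigma>w n N S L =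
     \<P>(\<omega> in transmission_space \<sigma>b \<sigma>w N S L.
       case \<omega> of ((w, k, l), zb, zw) \<Rightarrow>
         decode S (received n N l (encode S w k) zb) k l \<noteq> w)"

text \<open>
  A possibly randomized test is given by the conditional probability \<open>\<phi> y\<close>
  of rejecting \<open>H\<^sub>0\<close> upon observing \<open>y\<close>.
\<close>

definition hypothesis_test :: "nat \<Rightarrow> ((nat \<Rightarrow> real) \<Rightarrow> real) \<Rightarrow> bool" where
  "hypothesis_test N \<phi> \<longleftrightarrow>
     \<phi> \<in> borel_measurable (samples N) \<and> (\<forall>y\<in>space (samples N). 0 \<le> \<phi> y \<and> \<phi> y \<le> 1)"

definition false_alarm :: "real \<Rightarrow> nat \<Rightarrow> ((nat \<Rightarrow> real) \<Rightarrow> real) \<Rightarrow> real" where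
  "false_alarm \<sigma>w N \<phi> = (\<integral>zw. \<phi> zw \<partial>awgn \<sigma>w N)"

definition missed_detection ::
    "real \<Rightarrow> real \<Rightarrow> nat \<Rightarrow> nat \<Rightarrow> 'k coding_scheme \<Rightarrow> nat pmf
      \<Rightarrow> ((nat \<Rightarrow> real) \<Rightarrow> real) \<Rightarrow> real" where
  "missed_detection \<sigma>b \<sigma>w n N S L \<phi> =
     (\<integral>\<omega>. (case \<omega> of ((w, k, l), zb, zw) \<Rightarrow>
         1 - \<phi> (received n N l (encode S w k) zw))
       \<partial>transmission_space \<sigma>b \<sigma>w N S L)"

text \<open>The first symbol period of a uniformly chosen slot.\<close>

definition slot_location :: "nat \<Rightarrow> nat \<Rightarrow> nat pmf" where
  "slot_location n T = map_pmf (\<lambda>t. (t - 1) * n + 1) (pmf_of_set {1..T})"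

end

theory Submission
  imports Defs
begin

text \<open>
  Achievability. Alice uses a random codebook of symbols \<open>\<plusminus>a\<close> with
  \<open>a\<^sup>2 = min (\<sigma>w\<^sup>2 sqrt (ln T / n)) Pmax\<close>. Averaged over the codebook, the transmission in one
  slot has \<open>\<chi>\<^sup>2\<close>-divergence \<open>cosh (a\<^sup>2 / \<sigma>w\<^sup>2) ^ n - 1 \<le> sqrt T\<close> from pure noise. Slots are
  disjoint, so the uniform mixture over the \<open>T\<close> slots divides this by \<open>T\<close>, and it vanishes. Bob
  correlates with the codewords; a union bound over pairs shows that \<open>M\<close> proportional to \<open>n a\<^sup>2\<close>
  bits get through.

  Converse. A codeword of energy \<open>E\<close> carries only \<open>O(E)\<close> bits, by a change of measure to pure
  noise. Hence \<open>M = \<omega>(sqrt (n ln T))\<close> with reliable decoding forces the energy above every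
  multiple of \<open>sqrt (n ln T)\<close> with probability tending to 1, and the power constraint then forces
  \<open>ln T \<le> n\<close> eventually. Such an energy is detected by the largest received energy over \<open>T\<close>
  windows of two adjacent slots, with Chernoff bounds for both error probabilities.
\<close>

section \<open>Shifts of Gaussian noise\<close>

text \<open>The key is the whole codebook, so Willie faces the codebook average. For a fixed message
  it factors over symbol periods into even mixtures of \<open>a\<close> and \<open>-a\<close>.
  First-order effects cancel, so a symbol contributes about
  \<open>a ^ 4 / (2 * \<sigma>w ^ 4)\<close> to the divergence instead of order
  \<open>a ^ 2\<close>. Dilution over \<open>T\<close> slots tolerates an exponent
  \<open>n * a ^ 4 / (2 * \<sigma>w ^ 4)\<close> below \<open>ln T\<close>; this gives
  \<open>a ^ 2\<close> of order \<open>sqrt (ln T / n)\<close> and a codeword energy of order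
  \<open>sqrt (n * ln T)\<close>. The cap by \<open>Pmax\<close> takes over when \<open>ln T\<close>
  is large against \<open>n\<close>, hence the minimum in the rate. The obstacle of the converse is
  that the energy of a codeword is random and bounded only in mean, while detection needs it to be
  large with high probability. The change of measure is therefore made conditionally on message, key
  and location, and it bounds the probability of low energy. The union bound over windows asks for
  Chernoff exponents of order \<open>ln T\<close>, reached with a parameter of order
  \<open>sqrt (ln T / n)\<close>. The Chernoff estimates hold only for a bounded parameter, which is
  why \<open>ln T > n\<close> has to be excluded first.\<close>

declare One_nat_def [simp del]

abbreviation gaussian :: "real \<Rightarrow> real measure" where
  "gaussian \<sigma> \<equiv> density lborel (\<lambda>x. ennreal (normal_density 0 \<sigma> x))"

lemma normal_density_shift:
  assumes "\<sigma> > 0"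
  shows "normal_density 0 \<sigma> (x - g) = normal_density 0 \<sigma> x * exp (g * x / \<sigma>\<^sup>2 - g\<^sup>2 / (2 * \<sigma>\<^sup>2))"
  using assms by (simp add: normal_density_def mult_exp_exp field_simps power2_eq_square flip: exp_add)

lemma nn_integral_normal_density:
  assumes "\<sigma> > 0"
  shows "(\<integral>\<^sup>+x. ennreal (normal_density \<mu> \<sigma> x) \<partial>lborel) = 1"
  using assms by (subst nn_integral_eq_integral) auto

text \<open>Tilting by \<open>exp (b * x)\<close> only moves the mean of the Gaussian to
  \<open>\<sigma>\<^sup>2 * b\<close>, up to a constant factor.\<close>

lemma gaussian_mgf:
  assumes "\<sigma> > 0"
  shows "(\<integral>\<^sup>+x. ennreal (exp (b * x)) \<partial>gaussian \<sigma>) = ennreal (exp (\<sigma>\<^sup>2 * b\<^sup>2 / 2))"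
proof -
  have eq: "normal_density 0 \<sigma> x * exp (b * x) = exp (\<sigma>\<^sup>2 * b\<^sup>2 / 2) * normal_density (\<sigma>\<^sup>2 * b) \<sigma> x" for x
    using assms by (simp add: normal_density_def field_simps power2_eq_square flip: exp_add)
  have "(\<integral>\<^sup>+x. ennreal (exp (b * x)) \<partial>gaussian \<sigma>)
      = (\<integral>\<^sup>+x. ennreal (exp (\<sigma>\<^sup>2 * b\<^sup>2 / 2)) * ennreal (normal_density (\<sigma>\<^sup>2 * b) \<sigma> x) \<partial>lborel)"
    by (subst nn_integral_density) (auto simp: eq simp flip: ennreal_mult)
  then show ?thesis
    using nn_integral_normal_density[OF assms] by (simp add: nn_integral_cmult)
qed

text \<open>Completing the square: the tilted density is a constant times a Gaussian density of
  variance \<open>\<sigma>\<^sup>2 / D\<close>. Both signs of \<open>\<theta>\<close> are wanted,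
  positive for the upper tail of an energy and negative for the lower tail.\<close>

lemma gaussian_exp_square:
  assumes "\<sigma> > 0" and th: "1 - 2 * \<theta> * \<sigma>\<^sup>2 > 0"
  shows "(\<integral>\<^sup>+x. ennreal (exp (\<theta> * (x + g)\<^sup>2)) \<partial>gaussian \<sigma>)
    = ennreal (exp (\<theta> * g\<^sup>2 / (1 - 2 * \<theta> * \<sigma>\<^sup>2)) / sqrt (1 - 2 * \<theta> * \<sigma>\<^sup>2))"
proof -
  define D where "D = 1 - 2 * \<theta> * \<sigma>\<^sup>2"
  have D: "D > 0" using th by (simp add: D_def)
  define c where "c = exp (\<theta> * g\<^sup>2 / D) / sqrt D"
  have c: "c \<ge> 0" using D by (simp add: c_def)
  have ex: "- (x - 0)\<^sup>2 / (2 * \<sigma>\<^sup>2) + \<theta> * (x + g)\<^sup>2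
      = \<theta> * g\<^sup>2 / D + - (x - 2 * \<theta> * \<sigma>\<^sup>2 * g / D)\<^sup>2 / (2 * (\<sigma> / sqrt D)\<^sup>2)" for x
  proof -
    have th': "\<theta> = (1 - D) / (2 * \<sigma>\<^sup>2)" using assms(1) by (simp add: D_def)
    have "(\<sigma> / sqrt D)\<^sup>2 = \<sigma>\<^sup>2 / D" using D by (simp add: power_divide)
    then show ?thesis using D assms(1) unfolding th'
      by (simp add: field_simps power2_eq_square)
  qed
  have eq: "normal_density 0 \<sigma> x * exp (\<theta> * (x + g)\<^sup>2)
      = c * normal_density (2 * \<theta> * \<sigma>\<^sup>2 * g / D) (\<sigma> / sqrt D) x" for x
  proof -
    have "normal_density 0 \<sigma> x * exp (\<theta> * (x + g)\<^sup>2)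
      = 1 / sqrt (2 * pi * \<sigma>\<^sup>2) * exp (- (x - 0)\<^sup>2 / (2 * \<sigma>\<^sup>2) + \<theta> * (x + g)\<^sup>2)"
      by (simp add: normal_density_def flip: exp_add)
    also have "\<dots> = 1 / sqrt (2 * pi * \<sigma>\<^sup>2) * (exp (\<theta> * g\<^sup>2 / D) *
        exp (- (x - 2 * \<theta> * \<sigma>\<^sup>2 * g / D)\<^sup>2 / (2 * (\<sigma> / sqrt D)\<^sup>2)))"
      by (subst ex, subst exp_add) (rule refl)
    also have "\<dots> = c * normal_density (2 * \<theta> * \<sigma>\<^sup>2 * g / D) (\<sigma> / sqrt D) x"
      using D by (simp add: normal_density_def c_def power_divide real_sqrt_divide real_sqrt_mult)
    finally show ?thesis .
  qed
  have "(\<integral>\<^sup>+x. ennreal (exp (\<theta> * (x + g)\<^sup>2)) \<partial>gaussian \<sigma>)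
      = (\<integral>\<^sup>+x. ennreal c * ennreal (normal_density (2 * \<theta> * \<sigma>\<^sup>2 * g / D) (\<sigma> / sqrt D) x) \<partial>lborel)"
    using c by (subst nn_integral_density) (auto simp: eq simp flip: ennreal_mult)
  then show ?thesis
    using nn_integral_normal_density[of "\<sigma> / sqrt D"] D assms(1)
    by (simp add: nn_integral_cmult c_def flip: D_def)
qed

lemma prob_space_gaussian: "\<sigma> > 0 \<Longrightarrow> prob_space (gaussian \<sigma>)"
  by (rule prob_space_normal_density)

lemma product_prob_space_gaussian: "\<sigma> > 0 \<Longrightarrow> product_prob_space (\<lambda>i. gaussian \<sigma>)"
  by (intro product_prob_spaceI prob_space_gaussian)

lemma prob_space_awgn: "\<sigma> > 0 \<Longrightarrow> prob_space (awgn \<sigma> N)"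
  unfolding awgn_def by (intro prob_space_PiM prob_space_gaussian)

lemma sets_awgn [measurable_cong]: "sets (awgn \<sigma> N) = sets (samples N)"
  unfolding awgn_def samples_def by (intro sets_PiM_cong) auto

lemma space_awgn: "space (awgn \<sigma> N) = space (samples N)"
  by (intro sets_eq_imp_space_eq sets_awgn)

lemma space_samples: "space (samples N) = {1..N} \<rightarrow>\<^sub>E UNIV"
  by (simp add: samples_def space_PiM)

lemma measurable_sample [measurable]:
  "i \<in> {1..N} \<Longrightarrow> (\<lambda>z. z i) \<in> borel_measurable (samples N)"
  unfolding samples_def by simp

lemma nn_integral_awgn_prod:
  assumes "\<sigma> > 0" and [measurable]: "\<And>i. i \<in> {1..N} \<Longrightarrow> f i \<in> borel_measurable borel"
  shows "(\<integral>\<^sup>+z. (\<Prod>i\<in>{1..N}. f i (z i)) \<partial>awgn \<sigma> N) = (\<Prod>i\<in>{1..N}. \<integral>\<^sup>+x. f i x \<partial>gaussian \<sigma>)"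
proof -
  interpret product_prob_space "\<lambda>i::nat. gaussian \<sigma>" by (rule product_prob_space_gaussian[OF assms(1)])
  show ?thesis unfolding awgn_def
    by (rule product_nn_integral_prod) auto
qed

lemma nn_integral_awgn_exp_sum:
  assumes "\<sigma> > 0" and [measurable]: "\<And>i. i \<in> {1..N} \<Longrightarrow> f i \<in> borel_measurable borel"
    and f: "\<And>i. i \<in> {1..N} \<Longrightarrow> (\<integral>\<^sup>+x. ennreal (exp (f i x)) \<partial>gaussian \<sigma>) = ennreal (r i)" "\<And>i. i \<in> {1..N} \<Longrightarrow> r i \<ge> 0"
  shows "(\<integral>\<^sup>+z. ennreal (exp (\<Sum>i\<in>{1..N}. f i (z i))) \<partial>awgn \<sigma> N) = ennreal (\<Prod>i\<in>{1..N}. r i)"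
proof -
  have "(\<integral>\<^sup>+z. ennreal (exp (\<Sum>i\<in>{1..N}. f i (z i))) \<partial>awgn \<sigma> N)
      = (\<integral>\<^sup>+z. (\<Prod>i\<in>{1..N}. ennreal (exp (f i (z i)))) \<partial>awgn \<sigma> N)"
    by (simp add: exp_sum prod_ennreal)
  also have "\<dots> = (\<Prod>i\<in>{1..N}. ennreal (r i))"
    by (subst nn_integral_awgn_prod) (use assms in auto)
  also have "\<dots> = ennreal (\<Prod>i\<in>{1..N}. r i)"
    using f(2) by (intro prod_ennreal) auto
  finally show ?thesis .
qed

text \<open>The Radon-Nikodym derivative of noise shifted by \<open>g\<close> with respect to
  centred noise.\<close>

definition likelihood_ratio :: "real \<Rightarrow> nat \<Rightarrow> (nat \<Rightarrow> real) \<Rightarrow> (nat \<Rightarrow> real) \<Rightarrow> real" where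
  "likelihood_ratio \<sigma> N g y = exp (\<Sum>i\<in>{1..N}. g i * y i / \<sigma>\<^sup>2 - (g i)\<^sup>2 / (2 * \<sigma>\<^sup>2))"

lemma measurable_likelihood_ratio [measurable]:
  "likelihood_ratio \<sigma> N g \<in> borel_measurable (samples N)"
  unfolding likelihood_ratio_def by measurable

lemma measurable_shift [measurable]:
  "(\<lambda>z. \<lambda>i\<in>{1..N}. z i + g i) \<in> measurable (samples N) (samples N)"
  unfolding samples_def by measurable

lemma gaussian_shift:
  assumes "\<sigma> > 0" and [measurable]: "A \<in> sets borel"
  shows "(\<integral>\<^sup>+x. ennreal (exp (g * x / \<sigma>\<^sup>2 - g\<^sup>2 / (2 * \<sigma>\<^sup>2))) * indicator A x \<partial>gaussian \<sigma>)
    = (\<integral>\<^sup>+x. indicator A (x + g) \<partial>gaussian \<sigma>)"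
proof -
  have "(\<integral>\<^sup>+x. indicator A (x + g) \<partial>gaussian \<sigma>)
      = (\<integral>\<^sup>+x. ennreal (normal_density 0 \<sigma> x) * indicator A (x + g) \<partial>lborel)"
    by (subst nn_integral_density) auto
  also have "\<dots> = (\<integral>\<^sup>+x. ennreal (normal_density 0 \<sigma> (x - g)) * indicator A x \<partial>lborel)"
    by (subst lborel_distr_plus[of "-g", symmetric], subst nn_integral_distr) (auto simp: algebra_simps)
  also have "\<dots> = (\<integral>\<^sup>+x. ennreal (exp (g * x / \<sigma>\<^sup>2 - g\<^sup>2 / (2 * \<sigma>\<^sup>2))) * indicator A x \<partial>gaussian \<sigma>)"
    by (subst nn_integral_density)
      (auto simp: normal_density_shift[OF assms(1)] ennreal_mult mult_ac)
  finally show ?thesis ..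
qed

text \<open>Both measures agree with the product of the shifted one-dimensional Gaussians on boxes,
  and boxes determine a finite product measure.\<close>

lemma density_likelihood_ratio:
  assumes "\<sigma> > 0"
  shows "density (awgn \<sigma> N) (\<lambda>y. ennreal (likelihood_ratio \<sigma> N g y))
    = distr (awgn \<sigma> N) (samples N) (\<lambda>z. \<lambda>i\<in>{1..N}. z i + g i)"
proof -
  interpret product_prob_space "\<lambda>i::nat. gaussian \<sigma>" by (rule product_prob_space_gaussian[OF assms(1)])
  let ?D = "\<lambda>i. distr (gaussian \<sigma>) borel (\<lambda>x. x + g i)"
  have pd: "prob_space (?D i)" for i
    using prob_space_gaussian[OF assms] by (rule prob_space.prob_space_distr) simp
  interpret D: product_prob_space ?D by (intro product_prob_spaceI pd)
  have st: "sets (PiM {1..N} ?D) = sets (samples N)"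
    unfolding samples_def by (intro sets_PiM_cong) auto
  have 1: "density (awgn \<sigma> N) (\<lambda>y. ennreal (likelihood_ratio \<sigma> N g y)) = PiM {1..N} ?D"
  proof (rule D.PiM_eqI)
    fix A assume "\<And>i. i \<in> {1..N} \<Longrightarrow> A i \<in> sets (?D i)"
    then have A: "A i \<in> sets borel" if "i \<in> {1..N}" for i using that by simp
    have [measurable]: "Pi\<^sub>E {1..N} A \<in> sets (samples N)"
      unfolding samples_def using A by (intro sets_PiM_I_finite) auto
    have "emeasure (density (awgn \<sigma> N) (\<lambda>y. ennreal (likelihood_ratio \<sigma> N g y))) (Pi\<^sub>E {1..N} A)
      = (\<integral>\<^sup>+y. ennreal (likelihood_ratio \<sigma> N g y) * indicator (Pi\<^sub>E {1..N} A) y \<partial>awgn \<sigma> N)"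
      by (subst emeasure_density) auto
    also have "\<dots> = (\<integral>\<^sup>+y. (\<Prod>i\<in>{1..N}. ennreal (exp (g i * y i / \<sigma>\<^sup>2 - (g i)\<^sup>2 / (2 * \<sigma>\<^sup>2))) * indicator (A i) (y i)) \<partial>awgn \<sigma> N)"
    proof (rule nn_integral_cong)
      fix y assume "y \<in> space (awgn \<sigma> N)"
      \<comment> \<open>A box in \<open>Pi\<^sub>E\<close> also asks for extensionality. Points of
        the space have it, and only therefore does the indicator factor over the
        coordinates.\<close>
      then have "y \<in> extensional {1..N}" by (auto simp: space_awgn space_samples PiE_def)
      then have "indicator (Pi\<^sub>E {1..N} A) y = (\<Prod>i\<in>{1..N}. indicator (A i) (y i) :: ennreal)"
        by (auto simp: indicator_def PiE_def Pi_def split: if_splits)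
      then show "ennreal (likelihood_ratio \<sigma> N g y) * indicator (Pi\<^sub>E {1..N} A) y =
         (\<Prod>i\<in>{1..N}. ennreal (exp (g i * y i / \<sigma>\<^sup>2 - (g i)\<^sup>2 / (2 * \<sigma>\<^sup>2))) * indicator (A i) (y i))"
        by (simp add: likelihood_ratio_def exp_sum prod.distrib prod_ennreal)
    qed
    also have "\<dots> = (\<Prod>i\<in>{1..N}. \<integral>\<^sup>+x. ennreal (exp (g i * x / \<sigma>\<^sup>2 - (g i)\<^sup>2 / (2 * \<sigma>\<^sup>2))) * indicator (A i) x \<partial>gaussian \<sigma>)"
      using A by (intro nn_integral_awgn_prod assms) auto
    also have "\<dots> = (\<Prod>i\<in>{1..N}. emeasure (?D i) (A i))"
    proof (intro prod.cong refl)
      fix i assume i: "i \<in> {1..N}"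
      note [measurable] = A[OF i]
      have "emeasure (?D i) (A i) = (\<integral>\<^sup>+x. indicator (A i) x \<partial>?D i)" by simp
      also have "\<dots> = (\<integral>\<^sup>+x. indicator (A i) (x + g i) \<partial>gaussian \<sigma>)"
        by (subst nn_integral_distr) auto
      finally show "(\<integral>\<^sup>+x. ennreal (exp (g i * x / \<sigma>\<^sup>2 - (g i)\<^sup>2 / (2 * \<sigma>\<^sup>2))) * indicator (A i) x \<partial>gaussian \<sigma>) = emeasure (?D i) (A i)"
        using gaussian_shift[OF assms A[OF i]] by simp
    qed
    finally show "emeasure (density (awgn \<sigma> N) (\<lambda>y. ennreal (likelihood_ratio \<sigma> N g y))) (Pi\<^sub>E {1..N} A)
       = (\<Prod>i\<in>{1..N}. emeasure (?D i) (A i))" .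
  qed (auto simp: sets_awgn st)
  have 2: "distr (awgn \<sigma> N) (samples N) (\<lambda>z. \<lambda>i\<in>{1..N}. z i + g i) = PiM {1..N} ?D"
  proof (rule D.PiM_eqI)
    fix A assume "\<And>i. i \<in> {1..N} \<Longrightarrow> A i \<in> sets (?D i)"
    then have A: "A i \<in> sets borel" if "i \<in> {1..N}" for i using that by simp
    have mA[measurable]: "Pi\<^sub>E {1..N} A \<in> sets (samples N)"
      unfolding samples_def using A by (intro sets_PiM_I_finite) auto
    have "emeasure (distr (awgn \<sigma> N) (samples N) (\<lambda>z. \<lambda>i\<in>{1..N}. z i + g i)) (Pi\<^sub>E {1..N} A)
      = emeasure (awgn \<sigma> N) ((\<lambda>z. \<lambda>i\<in>{1..N}. z i + g i) -` (Pi\<^sub>E {1..N} A) \<inter> space (awgn \<sigma> N))"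
      by (subst emeasure_distr) (auto simp: measurable_cong_sets[OF sets_awgn refl])
    also have "(\<lambda>z. \<lambda>i\<in>{1..N}. z i + g i) -` (Pi\<^sub>E {1..N} A) \<inter> space (awgn \<sigma> N)
       = Pi\<^sub>E {1..N} (\<lambda>i. (\<lambda>x. x + g i) -` A i)"
      by (auto simp: space_awgn space_samples PiE_def Pi_def)
    also have "emeasure (awgn \<sigma> N) \<dots> = (\<Prod>i\<in>{1..N}. emeasure (gaussian \<sigma>) ((\<lambda>x. x + g i) -` A i))"
      unfolding awgn_def
    proof (rule emeasure_PiM)
      fix i assume i: "i \<in> {1..N}"
      show "(\<lambda>x. x + g i) -` A i \<in> sets (gaussian \<sigma>)"
        using measurable_sets[OF _ A[OF i], of "\<lambda>x. x + g i" borel] by simp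
    qed simp
    also have "\<dots> = (\<Prod>i\<in>{1..N}. emeasure (?D i) (A i))"
      using A by (intro prod.cong refl) (subst emeasure_distr, auto)
    finally show "emeasure (distr (awgn \<sigma> N) (samples N) (\<lambda>z. \<lambda>i\<in>{1..N}. z i + g i)) (Pi\<^sub>E {1..N} A)
       = (\<Prod>i\<in>{1..N}. emeasure (?D i) (A i))" .
  qed (auto simp: sets_awgn st)
  show ?thesis using 1 2 by simp
qed

lemma nn_integral_awgn_shift:
  assumes "\<sigma> > 0" and [measurable]: "h \<in> borel_measurable (samples N)"
  shows "(\<integral>\<^sup>+z. h (\<lambda>i\<in>{1..N}. z i + g i) \<partial>awgn \<sigma> N)
    = (\<integral>\<^sup>+y. ennreal (likelihood_ratio \<sigma> N g y) * h y \<partial>awgn \<sigma> N)"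
proof -
  have "(\<integral>\<^sup>+y. ennreal (likelihood_ratio \<sigma> N g y) * h y \<partial>awgn \<sigma> N)
     = (\<integral>\<^sup>+y. h y \<partial>density (awgn \<sigma> N) (\<lambda>y. ennreal (likelihood_ratio \<sigma> N g y)))"
    by (subst nn_integral_density) auto
  also have "\<dots> = (\<integral>\<^sup>+z. h (\<lambda>i\<in>{1..N}. z i + g i) \<partial>awgn \<sigma> N)"
    by (subst density_likelihood_ratio[OF assms(1)], subst nn_integral_distr) (auto simp: measurable_cong_sets[OF sets_awgn refl])
  finally show ?thesis ..
qed

text \<open>The square is the exponential of a linear form times
  \<open>exp (- energy / \<sigma>\<^sup>2)\<close>, and the linear form has exponential moment
  \<open>exp (2 * energy / \<sigma>\<^sup>2)\<close>. This is one plus the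
  \<open>\<chi>\<^sup>2\<close>-divergence; only the energy of the shift enters, not its
  position.\<close>

lemma nn_integral_likelihood_ratio_square:
  assumes "\<sigma> > 0"
  shows "(\<integral>\<^sup>+y. ennreal ((likelihood_ratio \<sigma> N g y)\<^sup>2) \<partial>awgn \<sigma> N)
    = ennreal (exp ((\<Sum>i\<in>{1..N}. (g i)\<^sup>2) / \<sigma>\<^sup>2))"
proof -
  have sq: "(likelihood_ratio \<sigma> N g y)\<^sup>2
      = exp (\<Sum>i\<in>{1..N}. (2 * g i / \<sigma>\<^sup>2) * y i) * exp (- (\<Sum>i\<in>{1..N}. (g i)\<^sup>2) / \<sigma>\<^sup>2)" for y
  proof -
    have "(likelihood_ratio \<sigma> N g y)\<^sup>2 = exp (2 * (\<Sum>i\<in>{1..N}. g i * y i / \<sigma>\<^sup>2 - (g i)\<^sup>2 / (2 * \<sigma>\<^sup>2)))"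
      by (simp add: likelihood_ratio_def exp_double)
    also have "2 * (\<Sum>i\<in>{1..N}. g i * y i / \<sigma>\<^sup>2 - (g i)\<^sup>2 / (2 * \<sigma>\<^sup>2))
      = (\<Sum>i\<in>{1..N}. (2 * g i / \<sigma>\<^sup>2) * y i) + (- (\<Sum>i\<in>{1..N}. (g i)\<^sup>2) / \<sigma>\<^sup>2)"
      by (simp add: sum_distrib_left sum_subtractf sum_divide_distrib sum_negf algebra_simps)
    finally show ?thesis by (simp only: exp_add)
  qed
  have "(\<integral>\<^sup>+y. ennreal ((likelihood_ratio \<sigma> N g y)\<^sup>2) \<partial>awgn \<sigma> N)
    = (\<integral>\<^sup>+y. ennreal (exp (\<Sum>i\<in>{1..N}. (2 * g i / \<sigma>\<^sup>2) * y i)) \<partial>awgn \<sigma> N) * ennreal (exp (- (\<Sum>i\<in>{1..N}. (g i)\<^sup>2) / \<sigma>\<^sup>2))"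
  proof (subst nn_integral_multc[symmetric])
    have "(\<lambda>y. ennreal (exp (\<Sum>i\<in>{1..N}. (2 * g i / \<sigma>\<^sup>2) * y i))) \<in> borel_measurable (samples N)"
      by measurable
    then show "(\<lambda>y. ennreal (exp (\<Sum>i\<in>{1..N}. (2 * g i / \<sigma>\<^sup>2) * y i))) \<in> borel_measurable (awgn \<sigma> N)"
      by (simp only: measurable_cong_sets[OF sets_awgn refl])
  qed (simp only: sq ennreal_mult exp_ge_zero)
  also have "(\<integral>\<^sup>+y. ennreal (exp (\<Sum>i\<in>{1..N}. (2 * g i / \<sigma>\<^sup>2) * y i)) \<partial>awgn \<sigma> N)
     = ennreal (\<Prod>i\<in>{1..N}. exp (\<sigma>\<^sup>2 * (2 * g i / \<sigma>\<^sup>2)\<^sup>2 / 2))"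
    by (rule nn_integral_awgn_exp_sum[OF assms _ gaussian_mgf[OF assms]]) auto
  also have "(\<Prod>i\<in>{1..N}. exp (\<sigma>\<^sup>2 * (2 * g i / \<sigma>\<^sup>2)\<^sup>2 / 2)) = exp (2 * (\<Sum>i\<in>{1..N}. (g i)\<^sup>2) / \<sigma>\<^sup>2)"
    using assms by (simp add: exp_sum[symmetric] sum_distrib_left sum_divide_distrib field_simps power2_eq_square)
  finally show ?thesis
    by (simp add: ennreal_mult[symmetric] mult_exp_exp field_simps)
qed

section \<open>Iterated integrals over the transmission space\<close>

text \<open>The codeword padded with zeros to the whole observation, which makes
  \<open>received\<close> a shift of the noise by a fixed vector, as the change of measure
  requires.\<close>

definition placed :: "nat \<Rightarrow> nat \<Rightarrow> (nat \<Rightarrow> real) \<Rightarrow> nat \<Rightarrow> real" where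
  "placed n l f i = (if l \<le> i \<and> i < l + n then f (i - l + 1) else 0)"

lemma received_eq: "received n N l f z = (\<lambda>i\<in>{1..N}. z i + placed n l f i)"
  by (simp add: received_def placed_def)

lemma sum_placed:
  assumes "1 \<le> l" "l + n - 1 \<le> N" and "\<And>i. h i 0 = (0::real)"
  shows "(\<Sum>i\<in>{1..N}. h i (placed n l f i)) = (\<Sum>j=1..n. h (l + j - 1) (f j))"
proof -
  have "(\<Sum>i\<in>{1..N}. h i (placed n l f i)) = (\<Sum>i\<in>{l..<l + n}. h i (placed n l f i))"
    using assms by (intro sum.mono_neutral_right) (auto simp: placed_def)
  also have "\<dots> = (\<Sum>j=1..n. h (l + j - 1) (f j))"
    using assms(1) by (intro sum.reindex_bij_witness[of _ "\<lambda>j. l + j - 1" "\<lambda>i. i - l + 1"])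
      (auto simp: placed_def)
  finally show ?thesis .
qed

lemma nn_integral_message_space:
  "(\<integral>\<^sup>+w. f w \<partial>message_space M) = (\<Sum>w\<in>{1..2 ^ M}. ennreal (1 / 2 ^ M) * f w)"
  by (simp add: message_space_def uniform_count_measure_def nn_integral_point_measure_finite)

lemma prob_space_message_space: "prob_space (message_space M)"
  unfolding message_space_def by (intro prob_space_uniform_count_measure) auto

lemma sets_message_space [measurable_cong]: "sets (message_space M) = sets (count_space {1..2 ^ M})"
  by (simp add: message_space_def sets_uniform_count_measure_count_space)

lemma space_message_space: "space (message_space M) = {1..2 ^ M}"
  by (simp add: message_space_def space_uniform_count_measure)

lemma measurable_awgn_kernel:
  assumes "\<sigma> > 0" "(\<lambda>(u, z). F u z) \<in> borel_measurable (M \<Otimes>\<^sub>M samples N)"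
  shows "(\<lambda>u. \<integral>\<^sup>+z. F u z \<partial>awgn \<sigma> N) \<in> borel_measurable M"
proof -
  interpret prob_space "awgn \<sigma> N" by (rule prob_space_awgn[OF assms(1)])
  show ?thesis
    using assms(2) by (intro borel_measurable_nn_integral)
      (simp add: measurable_cong_sets[OF sets_pair_measure_cong[OF refl sets_awgn] refl])
qed

definition source_space :: "'k coding_scheme \<Rightarrow> nat pmf \<Rightarrow> (nat \<times> 'k \<times> nat) measure" where
  "source_space S L = message_space (msg_bits S) \<Otimes>\<^sub>M (key_space S \<Otimes>\<^sub>M measure_pmf L)"

text \<open>The position read from the codeword varies with the random location. Locations are
  countable, so each fixed location can be treated alone.\<close>

lemma measurable_placed [measurable]:
  assumes "i \<in> {1..N}" and [measurable]: "f \<in> measurable M (samples n)" "l \<in> measurable M (count_space UNIV)"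
  shows "(\<lambda>x. placed n (l x) (f x) i) \<in> borel_measurable M"
proof -
  have "(\<lambda>x. placed n m (f x) i) \<in> borel_measurable M" for m
  proof (cases "m \<le> i \<and> i < m + n")
    case True
    then have "i - m + 1 \<in> {1..n}" by auto
    from measurable_sample[OF this] have "(\<lambda>x. f x (i - m + 1)) \<in> borel_measurable M"
      by measurable
    then show ?thesis using True by (simp add: placed_def)
  next
    case False
    then show ?thesis by (auto simp: placed_def)
  qed
  then show ?thesis by (rule measurable_compose_countable) fact
qed

lemma measurable_received [measurable]:
  assumes [measurable]: "f \<in> measurable M (samples n)" "l \<in> measurable M (count_space UNIV)"
    "z \<in> measurable M (samples N)"
  shows "(\<lambda>x. received n N (l x) (f x) (z x)) \<in> measurable M (samples N)"
proof -
  have "(\<lambda>x. \<lambda>i\<in>{1..N}. z x i + placed n (l x) (f x) i) \<in> measurable M (samples N)"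
    unfolding samples_def[of N]
  proof (rule measurable_restrict)
    fix i assume i[measurable]: "i \<in> {1..N}"
    have [measurable]: "(\<lambda>x. z x i) \<in> borel_measurable M"
      using measurable_compose[OF assms(3) measurable_sample[OF i]] by simp
    show "(\<lambda>x. z x i + placed n (l x) (f x) i) \<in> borel_measurable M"
      using measurable_placed[OF i assms(1,2)] by measurable
  qed
  then show ?thesis by (simp add: received_eq)
qed

lemma measurable_source_key [measurable]:
  "(\<lambda>(w, k, l). k) \<in> measurable (source_space S L) (key_space S)"
  "(\<lambda>(w, k, l). l) \<in> measurable (source_space S L) (count_space UNIV)"
  "(\<lambda>(w, k, l). (w, k)) \<in> measurable (source_space S L) (message_space (msg_bits S) \<Otimes>\<^sub>M key_space S)"
  "(\<lambda>(w, k, l). w) \<in> measurable (source_space S L) (count_space UNIV)"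
proof -
  have "(\<lambda>w. w) \<in> measurable (message_space M) (count_space UNIV)" for M
    by (simp add: measurable_cong_sets[OF sets_message_space refl])
  then show "(\<lambda>(w, k, l). w) \<in> measurable (source_space S L) (count_space UNIV)"
    unfolding source_space_def case_prod_beta' by (rule measurable_compose[OF measurable_fst])
qed (unfold source_space_def, measurable)

context
  fixes S :: "'k coding_scheme" and n N :: nat and P :: real
  assumes valid: "valid_scheme n N P S"
begin

lemma prob_space_key: "prob_space (key_space S)"
  using valid by (simp add: valid_scheme_def)

lemma measurable_encode:
  "(\<lambda>(w, k). encode S w k) \<in> measurable (message_space (msg_bits S) \<Otimes>\<^sub>M key_space S) (samples n)"
  using valid by (simp add: valid_scheme_def)

lemma measurable_decode:
  "(\<lambda>(y, k, l). decode S y k l)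
       \<in> measurable (samples N \<Otimes>\<^sub>M (key_space S \<Otimes>\<^sub>M count_space UNIV)) (count_space UNIV)"
  using valid by (simp add: valid_scheme_def)

lemma measurable_received_source:
  "(\<lambda>((w, k, l), z). received n N l (encode S w k) z) \<in> measurable (source_space S L \<Otimes>\<^sub>M samples N) (samples N)"
proof -
  have [measurable]: "(\<lambda>x. encode S (fst (fst x)) (fst (snd (fst x)))) \<in> measurable (source_space S L \<Otimes>\<^sub>M samples N) (samples n)"
    using measurable_compose[OF measurable_fst measurable_compose[OF measurable_source_key(3) measurable_encode], of L "samples N"]
    by (simp add: case_prod_beta')
  have [measurable]: "(\<lambda>x. snd (snd (fst x))) \<in> measurable (source_space S L \<Otimes>\<^sub>M samples N) (count_space UNIV)"
    using measurable_compose[OF measurable_fst measurable_source_key(2), of S L "samples N"]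
    by (simp add: case_prod_beta')
  show ?thesis unfolding case_prod_beta' by measurable
qed

text \<open>The decoder input \<open>y\<close> is left general because the converse feeds the
  decoder twice: with the received word and with noise that carries no signal.\<close>

lemma measurable_decode_source:
  assumes [measurable]: "(\<lambda>(u, z). y u z) \<in> measurable (source_space S L \<Otimes>\<^sub>M samples N) (samples N)"
  shows "(\<lambda>((w, k, l), z). decode S (y (w, k, l) z) k l) \<in> measurable (source_space S L \<Otimes>\<^sub>M samples N) (count_space UNIV)"
proof -
  let ?M = "source_space S L \<Otimes>\<^sub>M samples N"
  have [measurable]: "(\<lambda>x. fst (snd (fst x))) \<in> measurable ?M (key_space S)"
    using measurable_compose[OF measurable_fst measurable_source_key(1), of S L "samples N"]
    by (simp add: case_prod_beta')
  have [measurable]: "(\<lambda>x. snd (snd (fst x))) \<in> measurable ?M (count_space UNIV)"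
    using measurable_compose[OF measurable_fst measurable_source_key(2), of S L "samples N"]
    by (simp add: case_prod_beta')
  have "(\<lambda>x. (y (fst x) (snd x), fst (snd (fst x)), snd (snd (fst x)))) \<in> measurable ?M (samples N \<Otimes>\<^sub>M (key_space S \<Otimes>\<^sub>M count_space UNIV))"
    using assms by (intro measurable_Pair) (auto simp: case_prod_beta')
  from measurable_compose[OF this measurable_decode]
  show ?thesis by (simp add: case_prod_beta')
qed

lemma prob_space_source: "prob_space (source_space S L)"
  unfolding source_space_def
  by (intro prob_space_pair prob_space_message_space prob_space_key prob_space_measure_pmf)

lemma nn_integral_source:
  assumes "F \<in> borel_measurable (source_space S L)"
  shows "(\<integral>\<^sup>+u. F u \<partial>source_space S L)
    = (\<integral>\<^sup>+w. \<integral>\<^sup>+k. \<integral>\<^sup>+l. F (w, k, l) \<partial>measure_pmf L \<partial>key_space S \<partial>message_space (msg_bits S))"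
proof -
  interpret KL: prob_space "key_space S \<Otimes>\<^sub>M measure_pmf L"
    by (intro prob_space_pair prob_space_key prob_space_measure_pmf)
  note [measurable] = assms[unfolded source_space_def]
  show ?thesis unfolding source_space_def
    by (subst KL.nn_integral_fst[symmetric], measurable, intro nn_integral_cong)
      (subst measure_pmf.nn_integral_fst[symmetric], auto)
qed

text \<open>The integrand ignores Willie's noise, which integrates out with total mass 1.\<close>

lemma nn_integral_transmission_bob:
  assumes "\<sigma>b > 0" "\<sigma>w > 0" and [measurable]: "(\<lambda>(u, z). F u z) \<in> borel_measurable (source_space S L \<Otimes>\<^sub>M samples N)"
  shows "(\<integral>\<^sup>+\<omega>. (case \<omega> of (u, zb, zw) \<Rightarrow> F u zb) \<partial>transmission_space \<sigma>b \<sigma>w N S L)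
    = (\<integral>\<^sup>+u. \<integral>\<^sup>+z. F u z \<partial>awgn \<sigma>b N \<partial>source_space S L)"
proof -
  interpret B: prob_space "awgn \<sigma>b N" using assms by (intro prob_space_awgn)
  interpret W: prob_space "awgn \<sigma>w N" using assms by (intro prob_space_awgn)
  interpret BW: prob_space "awgn \<sigma>b N \<Otimes>\<^sub>M awgn \<sigma>w N" by (intro prob_space_pair) unfold_locales
  show ?thesis unfolding transmission_space_def source_space_def[symmetric]
    by (subst BW.nn_integral_fst[symmetric], measurable, intro nn_integral_cong)
      (subst W.nn_integral_fst[symmetric], auto simp: W.emeasure_space_1)
qed

lemma nn_integral_transmission_willie:
  assumes "\<sigma>b > 0" "\<sigma>w > 0" and [measurable]: "(\<lambda>(u, z). F u z) \<in> borel_measurable (source_space S L \<Otimes>\<^sub>M samples N)"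
  shows "(\<integral>\<^sup>+\<omega>. (case \<omega> of (u, zb, zw) \<Rightarrow> F u zw) \<partial>transmission_space \<sigma>b \<sigma>w N S L)
    = (\<integral>\<^sup>+u. \<integral>\<^sup>+z. F u z \<partial>awgn \<sigma>w N \<partial>source_space S L)"
proof -
  interpret B: prob_space "awgn \<sigma>b N" using assms by (intro prob_space_awgn)
  interpret W: prob_space "awgn \<sigma>w N" using assms by (intro prob_space_awgn)
  interpret BW: prob_space "awgn \<sigma>b N \<Otimes>\<^sub>M awgn \<sigma>w N" by (intro prob_space_pair) unfold_locales
  show ?thesis unfolding transmission_space_def source_space_def[symmetric]
    by (subst BW.nn_integral_fst[symmetric], measurable, intro nn_integral_cong)
      (subst W.nn_integral_fst[symmetric], auto simp: B.emeasure_space_1)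
qed

text \<open>The noise becomes the innermost integral, so that error bounds for fixed message, key
  and location can be inserted. The second claim is what later allows the source integral to be
  split.\<close>

lemma bob_error_eq:
  assumes "\<sigma>b > 0" "\<sigma>w > 0"
  shows "ennreal (bob_error \<sigma>b \<sigma>w n N S L)
    = (\<integral>\<^sup>+u. (case u of (w, k, l) \<Rightarrow> \<integral>\<^sup>+z. indicator {z. decode S (received n N l (encode S w k) z) k l \<noteq> w} z \<partial>awgn \<sigma>b N)
        \<partial>source_space S L)"
    and "(\<lambda>(w, k, l). \<integral>\<^sup>+z. indicator {z. decode S (received n N l (encode S w k) z) k l \<noteq> w} z \<partial>awgn \<sigma>b N)
      \<in> borel_measurable (source_space S L)"
proof -
  let ?T = "transmission_space \<sigma>b \<sigma>w N S L"
  interpret T: prob_space ?T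
    unfolding transmission_space_def source_space_def[symmetric]
    by (intro prob_space_pair prob_space_source prob_space_awgn assms)
  have dec: "(\<lambda>((w, k, l), z). decode S (received n N l (encode S w k) z) k l)
      \<in> measurable (source_space S L \<Otimes>\<^sub>M samples N) (count_space UNIV)"
    using measurable_decode_source[of "\<lambda>(w, k, l) z. received n N l (encode S w k) z"] measurable_received_source
    by (simp add: case_prod_beta')
  have msg: "(\<lambda>((w, k, l), z). w) \<in> measurable (source_space S L \<Otimes>\<^sub>M samples N) (count_space UNIV)"
    using measurable_compose[OF measurable_fst measurable_source_key(4), of S L "samples N"]
    by (simp add: case_prod_beta')
  let ?A = "\<lambda>u zb. case u of (w, k, l) \<Rightarrow> decode S (received n N l (encode S w k) zb) k l \<noteq> w"
  have A[measurable]: "Measurable.pred (source_space S L \<Otimes>\<^sub>M samples N) (\<lambda>(u, z). ?A u z)"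
  proof -
    have "Measurable.pred M (\<lambda>x. f x \<noteq> g x)"
      if [measurable]: "f \<in> measurable M (count_space UNIV)" "g \<in> measurable M (count_space UNIV)"
      for M and f g :: "(nat \<times> 'k \<times> nat) \<times> (nat \<Rightarrow> real) \<Rightarrow> nat"
      \<comment> \<open>One of the two decoded values is fixed at each natural number in turn, which
        reduces the comparison to countably many constants.\<close>
      by (rule measurable_compose_countable[where f = "\<lambda>m x. f x \<noteq> m"]) measurable
    from this[OF dec msg] have "Measurable.pred (source_space S L \<Otimes>\<^sub>M samples N)
       (\<lambda>x. (\<lambda>((w, k, l), z). decode S (received n N l (encode S w k) z) k l) x \<noteq> (\<lambda>((w, k, l), z). w) x)" .
    then show ?thesis by (simp add: case_prod_beta')
  qed
  have AT: "Measurable.pred ?T (\<lambda>\<omega>. case \<omega> of (u, zb, zw) \<Rightarrow> ?A u zb)"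
  proof -
    have "(\<lambda>\<omega>. (fst \<omega>, fst (snd \<omega>))) \<in> measurable ?T (source_space S L \<Otimes>\<^sub>M samples N)"
      unfolding transmission_space_def source_space_def[symmetric] by measurable
    from measurable_compose[OF this A] show ?thesis by (simp add: case_prod_beta')
  qed
  have ind: "(\<lambda>(u, z). indicator {z. ?A u z} z :: ennreal) \<in> borel_measurable (source_space S L \<Otimes>\<^sub>M samples N)"
  proof -
    have "(\<lambda>(u, z). indicator {z. ?A u z} z :: ennreal) = indicator {x. case x of (u, z) \<Rightarrow> ?A u z}"
      by (auto simp: fun_eq_iff indicator_def)
    also have "\<dots> \<in> borel_measurable (source_space S L \<Otimes>\<^sub>M samples N)"
      using A by (simp add: borel_measurable_indicator_iff pred_def Int_def conj_commute)
    finally show ?thesis .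
  qed
  have "(\<lambda>u. \<integral>\<^sup>+z. indicator {z. ?A u z} z \<partial>awgn \<sigma>b N) \<in> borel_measurable (source_space S L)"
    using ind by (rule measurable_awgn_kernel[OF assms(1)])
  then show "(\<lambda>(w, k, l). \<integral>\<^sup>+z. indicator {z. decode S (received n N l (encode S w k) z) k l \<noteq> w} z \<partial>awgn \<sigma>b N)
      \<in> borel_measurable (source_space S L)"
    by (simp add: case_prod_beta')
  have "ennreal (bob_error \<sigma>b \<sigma>w n N S L) = emeasure ?T {\<omega>\<in>space ?T. case \<omega> of (u, zb, zw) \<Rightarrow> ?A u zb}"
    unfolding bob_error_def T.emeasure_eq_measure by (simp add: case_prod_beta')
  also have "\<dots> = (\<integral>\<^sup>+\<omega>. indicator {\<omega>\<in>space ?T. case \<omega> of (u, zb, zw) \<Rightarrow> ?A u zb} \<omega> \<partial>?T)"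
    using AT by (intro nn_integral_indicator[symmetric]) (simp add: pred_def)
  also have "\<dots> = (\<integral>\<^sup>+\<omega>. (case \<omega> of (u, zb, zw) \<Rightarrow> indicator {z. ?A u z} zb) \<partial>?T)"
    by (intro nn_integral_cong) (auto simp: indicator_def split: prod.splits)
  also have "\<dots> = (\<integral>\<^sup>+u. \<integral>\<^sup>+z. indicator {z. ?A u z} z \<partial>awgn \<sigma>b N \<partial>source_space S L)"
    by (rule nn_integral_transmission_bob[OF assms ind])
 also have "\<dots> = (\<integral>\<^sup>+u. (case u of (w, k, l) \<Rightarrow> \<integral>\<^sup>+z. indicator {z. decode S (received n N l (encode S w k) z) k l \<noteq> w} z \<partial>awgn \<sigma>b N)
        \<partial>source_space S L)"
    by (intro nn_integral_cong) auto
  finally show "ennreal (bob_error \<sigma>b \<sigma>w n N S L) = \<dots>" .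
qed

lemma missed_detection_eq:
  assumes "\<sigma>b > 0" "\<sigma>w > 0" and "hypothesis_test N \<phi>"
  shows "ennreal (missed_detection \<sigma>b \<sigma>w n N S L \<phi>)
    = (\<integral>\<^sup>+u. (case u of (w, k, l) \<Rightarrow> \<integral>\<^sup>+z. ennreal (1 - \<phi> (received n N l (encode S w k) z)) \<partial>awgn \<sigma>w N)
        \<partial>source_space S L)"
    and "0 \<le> missed_detection \<sigma>b \<sigma>w n N S L \<phi>"
    and "(\<lambda>(w, k, l). \<integral>\<^sup>+z. ennreal (1 - \<phi> (received n N l (encode S w k) z)) \<partial>awgn \<sigma>w N)
      \<in> borel_measurable (source_space S L)"
proof -
  let ?T = "transmission_space \<sigma>b \<sigma>w N S L"
  interpret T: prob_space ?T
    unfolding transmission_space_def source_space_def[symmetric]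
    by (intro prob_space_pair prob_space_source prob_space_awgn assms)
  let ?F = "\<lambda>u z. case u of (w, k, l) \<Rightarrow> 1 - \<phi> (received n N l (encode S w k) z)"
  have [measurable]: "\<phi> \<in> borel_measurable (samples N)" and
    \<phi>: "y \<in> space (samples N) \<Longrightarrow> 0 \<le> \<phi> y \<and> \<phi> y \<le> 1" for y
    using assms(3) by (auto simp: hypothesis_test_def)
  have F[measurable]: "(\<lambda>(u, z). ?F u z) \<in> borel_measurable (source_space S L \<Otimes>\<^sub>M samples N)"
  proof -
    have "(\<lambda>x. 1 - \<phi> ((\<lambda>((w, k, l), z). received n N l (encode S w k) z) x)) \<in> borel_measurable (source_space S L \<Otimes>\<^sub>M samples N)"
      using measurable_received_source by measurable
    then show ?thesis by (simp add: case_prod_beta')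
  qed
  have F': "(\<lambda>(u, z). ennreal (?F u z)) \<in> borel_measurable (source_space S L \<Otimes>\<^sub>M samples N)"
    using measurable_compose[OF F measurable_ennreal] by (simp add: case_prod_beta')
  from measurable_awgn_kernel[OF assms(2) this]
  show "(\<lambda>(w, k, l). \<integral>\<^sup>+z. ennreal (1 - \<phi> (received n N l (encode S w k) z)) \<partial>awgn \<sigma>w N)
      \<in> borel_measurable (source_space S L)"
    by (simp add: case_prod_beta')
  have FT[measurable]: "(\<lambda>\<omega>. case \<omega> of (u, zb, zw) \<Rightarrow> ?F u zw) \<in> borel_measurable ?T"
  proof -
    have "(\<lambda>\<omega>. (fst \<omega>, snd (snd \<omega>))) \<in> measurable ?T (source_space S L \<Otimes>\<^sub>M samples N)"
      unfolding transmission_space_def source_space_def[symmetric] by measurable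
    from measurable_compose[OF this F] show ?thesis by (simp add: case_prod_beta')
  qed
  \<comment> \<open>A received word is extensional by construction, whatever \<open>f\<close> and
    \<open>z\<close> are, so the bounds on the test apply to it without side conditions.\<close>
  have rs: "received n N l f z \<in> space (samples N)" for l f z
    by (auto simp: received_def space_samples)
  have bnd: "0 \<le> ?F u z" "?F u z \<le> 1" for u z
    using \<phi>[OF rs] by (auto split: prod.splits)
  have int: "integrable ?T (\<lambda>\<omega>. case \<omega> of (u, zb, zw) \<Rightarrow> ?F u zw)"
    using bnd by (intro T.integrable_const_bound[of _ 1] AE_I2) (auto split: prod.splits)
  have md: "missed_detection \<sigma>b \<sigma>w n N S L \<phi> = (\<integral>\<omega>. (case \<omega> of (u, zb, zw) \<Rightarrow> ?F u zw) \<partial>?T)"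
    unfolding missed_detection_def by (intro Bochner_Integration.integral_cong) (auto split: prod.splits)
  show "0 \<le> missed_detection \<sigma>b \<sigma>w n N S L \<phi>"
    unfolding md using bnd by (intro integral_nonneg_AE AE_I2) (auto split: prod.splits)
  have "ennreal (missed_detection \<sigma>b \<sigma>w n N S L \<phi>) = (\<integral>\<^sup>+\<omega>. ennreal (case \<omega> of (u, zb, zw) \<Rightarrow> ?F u zw) \<partial>?T)"
    unfolding md using bnd
    by (intro nn_integral_eq_integral[symmetric] int AE_I2) (auto split: prod.splits)
  also have "\<dots> = (\<integral>\<^sup>+\<omega>. (case \<omega> of (u, zb, zw) \<Rightarrow> ennreal (?F u zw)) \<partial>?T)"
    by (intro nn_integral_cong) (auto split: prod.splits)
  also have "\<dots> = (\<integral>\<^sup>+u. \<integral>\<^sup>+z. ennreal (?F u z) \<partial>awgn \<sigma>w N \<partial>source_space S L)"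
    by (rule nn_integral_transmission_willie[OF assms(1,2) F'])
  also have "\<dots> = (\<integral>\<^sup>+u. (case u of (w, k, l) \<Rightarrow> \<integral>\<^sup>+z. ennreal (1 - \<phi> (received n N l (encode S w k) z)) \<partial>awgn \<sigma>w N)
        \<partial>source_space S L)"
    by (intro nn_integral_cong) (auto split: prod.splits)
  finally show "ennreal (missed_detection \<sigma>b \<sigma>w n N S L \<phi>) = \<dots>" .
qed

end

lemma false_alarm_eq:
  assumes "\<sigma>w > 0" and "hypothesis_test N \<phi>"
  shows "ennreal (false_alarm \<sigma>w N \<phi>) = (\<integral>\<^sup>+z. ennreal (\<phi> z) \<partial>awgn \<sigma>w N)"
    and "0 \<le> false_alarm \<sigma>w N \<phi>"
proof -
  interpret W: prob_space "awgn \<sigma>w N" using assms by (intro prob_space_awgn)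
  have [measurable]: "\<phi> \<in> borel_measurable (samples N)" and
    \<phi>: "\<And>y. y \<in> space (awgn \<sigma>w N) \<Longrightarrow> 0 \<le> \<phi> y \<and> \<phi> y \<le> 1"
    using assms(2) by (auto simp: hypothesis_test_def space_awgn)
  have int: "integrable (awgn \<sigma>w N) \<phi>"
    using \<phi> by (intro W.integrable_const_bound[of _ 1] AE_I2) auto
  show "ennreal (false_alarm \<sigma>w N \<phi>) = (\<integral>\<^sup>+z. ennreal (\<phi> z) \<partial>awgn \<sigma>w N)"
    unfolding false_alarm_def using \<phi> by (intro nn_integral_eq_integral[symmetric] int AE_I2) auto
  show "0 \<le> false_alarm \<sigma>w N \<phi>"
    unfolding false_alarm_def using \<phi> by (intro integral_nonneg_AE AE_I2) auto
qed

section \<open>Energy detection\<close>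

text \<open>The exponential moment of a noncentral chi-square variable with \<open>card J\<close>
  degrees of freedom. Coordinates outside \<open>J\<close> contribute the factor 1.\<close>

lemma nn_integral_awgn_exp_energy:
  assumes "\<sigma> > 0" and th: "1 - 2 * \<theta> * \<sigma>\<^sup>2 > 0" and J: "J \<subseteq> {1..N}"
  shows "(\<integral>\<^sup>+z. ennreal (exp (\<theta> * (\<Sum>i\<in>J. (z i + g i)\<^sup>2))) \<partial>awgn \<sigma> N)
    = ennreal (exp (\<theta> * (\<Sum>i\<in>J. (g i)\<^sup>2) / (1 - 2 * \<theta> * \<sigma>\<^sup>2)) * (1 / sqrt (1 - 2 * \<theta> * \<sigma>\<^sup>2)) ^ card J)"
proof -
  let ?D = "1 - 2 * \<theta> * \<sigma>\<^sup>2"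
  let ?r = "\<lambda>i. exp (\<theta> * (g i)\<^sup>2 / ?D) / sqrt ?D"
  interpret prob_space "gaussian \<sigma>" by (rule prob_space_gaussian[OF assms(1)])
  have fin: "finite J" using J finite_subset by blast
  have "(\<integral>\<^sup>+z. ennreal (exp (\<theta> * (\<Sum>i\<in>J. (z i + g i)\<^sup>2))) \<partial>awgn \<sigma> N)
    = (\<integral>\<^sup>+z. ennreal (exp (\<Sum>i\<in>{1..N}. if i \<in> J then \<theta> * (z i + g i)\<^sup>2 else 0)) \<partial>awgn \<sigma> N)"
    using J by (simp add: sum.If_cases Int_absorb1 sum_distrib_left)
  also have "\<dots> = ennreal (\<Prod>i\<in>{1..N}. if i \<in> J then ?r i else 1)"
    using gaussian_exp_square[OF assms(1) th] th emeasure_space_1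
    by (intro nn_integral_awgn_exp_sum[OF assms(1)]) auto
  also have "(\<Prod>i\<in>{1..N}. if i \<in> J then ?r i else 1) = (\<Prod>i\<in>J. ?r i)"
    using J by (simp add: prod.If_cases Int_absorb1)
  also have "\<dots> = exp (\<theta> * (\<Sum>i\<in>J. (g i)\<^sup>2) / ?D) * (1 / sqrt ?D) ^ card J"
    using fin by (simp add: divide_inverse prod.distrib sum_distrib_left sum_distrib_right flip: exp_sum)
  finally show ?thesis .
qed

text \<open>From \<open>ln (1 - x) \<ge> - x - 2 * x\<^sup>2\<close> at \<open>x = 2 * s\<close>,
  valid up to \<open>x = 1 / 2\<close>. The linear term \<open>s\<close> is the mean noise energy
  and cancels against the centring of the threshold; only the quadratic term remains as a
  cost.\<close>

lemma inverse_sqrt_one_minus_le: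
  assumes "0 \<le> s" "s \<le> 1 / 4"
  shows "1 / sqrt (1 - 2 * s) \<le> exp (s + 4 * s\<^sup>2)"
proof -
  have "- (2 * s) - 2 * (2 * s)\<^sup>2 \<le> ln (1 - 2 * s)"
    using assms by (intro ln_one_minus_pos_lower_bound) auto
  then have "- s - 4 * s\<^sup>2 \<le> ln (sqrt (1 - 2 * s))"
    using assms by (simp add: ln_sqrt power2_eq_square)
  then have "exp (- (s + 4 * s\<^sup>2)) \<le> sqrt (1 - 2 * s)"
    using assms by (subst (asm) ln_ge_iff) auto
  then have "inverse (sqrt (1 - 2 * s)) \<le> inverse (exp (- (s + 4 * s\<^sup>2)))"
    by (rule le_imp_inverse_le) simp
  then show ?thesis
    by (simp only: exp_minus inverse_inverse_eq divide_inverse mult_1_left)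
qed

lemma inverse_sqrt_one_plus_le:
  assumes "0 \<le> s" "s \<le> 1 / 4"
  shows "1 / sqrt (1 + 2 * s) \<le> exp (- s + 2 * s\<^sup>2)"
proof -
  have "(2 * s) - (2 * s)\<^sup>2 \<le> ln (1 + 2 * s)"
    using assms by (intro ln_one_plus_pos_lower_bound) auto
  then have "s - 2 * s\<^sup>2 \<le> ln (sqrt (1 + 2 * s))"
    using assms by (simp add: ln_sqrt power2_eq_square)
  then have "exp (- (- s + 2 * s\<^sup>2)) \<le> sqrt (1 + 2 * s)"
    using assms by (subst (asm) ln_ge_iff) (auto simp: add_pos_nonneg)
  then have "inverse (sqrt (1 + 2 * s)) \<le> inverse (exp (- (- s + 2 * s\<^sup>2)))"
    by (rule le_imp_inverse_le) simp
  then show ?thesis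
    by (simp only: exp_minus inverse_inverse_eq divide_inverse mult_1_left)
qed

text \<open>Chernoff bound with parameter \<open>s / \<sigma>\<^sup>2\<close>. Choosing
  \<open>s\<close> is postponed, since the union bound over windows and the missed detection must be
  served by related choices.\<close>

lemma energy_upper_tail:
  assumes "\<sigma> > 0" and J: "J \<subseteq> {1..N}" and s: "0 \<le> s" "s \<le> 1 / 4"
  shows "(\<integral>\<^sup>+z. indicator {z. (\<Sum>i\<in>J. (z i)\<^sup>2) > real (card J) * \<sigma>\<^sup>2 + \<sigma>\<^sup>2 * \<tau>} z \<partial>awgn \<sigma> N)
    \<le> ennreal (exp (4 * real (card J) * s\<^sup>2 - s * \<tau>))"
proof -
  let ?m = "real (card J)"
  let ?c = "exp (- s * (?m + \<tau>))"
  have D: "1 - 2 * (s / \<sigma>\<^sup>2) * \<sigma>\<^sup>2 = 1 - 2 * s" using assms(1) by simp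
  have [measurable]: "(\<lambda>z. \<Sum>i\<in>J. (z i)\<^sup>2) \<in> borel_measurable (samples N)"
    using J by (intro borel_measurable_sum) auto
  have "indicator {z. (\<Sum>i\<in>J. (z i)\<^sup>2) > ?m * \<sigma>\<^sup>2 + \<sigma>\<^sup>2 * \<tau>} z
      \<le> ennreal ?c * ennreal (exp (s / \<sigma>\<^sup>2 * (\<Sum>i\<in>J. (z i + 0)\<^sup>2)))" for z
  proof (cases "(\<Sum>i\<in>J. (z i)\<^sup>2) > ?m * \<sigma>\<^sup>2 + \<sigma>\<^sup>2 * \<tau>")
    case True
    have "s / \<sigma>\<^sup>2 * (?m * \<sigma>\<^sup>2 + \<sigma>\<^sup>2 * \<tau>) \<le> s / \<sigma>\<^sup>2 * (\<Sum>i\<in>J. (z i)\<^sup>2)"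
      using True s by (intro mult_left_mono) auto
    moreover have "s / \<sigma>\<^sup>2 * (?m * \<sigma>\<^sup>2 + \<sigma>\<^sup>2 * \<tau>) = s * (?m + \<tau>)"
      using assms(1) by (simp add: field_simps)
    ultimately have "1 \<le> ?c * exp (s / \<sigma>\<^sup>2 * (\<Sum>i\<in>J. (z i)\<^sup>2))"
      by (simp add: mult_exp_exp)
    then show ?thesis using True by (simp flip: ennreal_mult)
  qed simp
  then have "(\<integral>\<^sup>+z. indicator {z. (\<Sum>i\<in>J. (z i)\<^sup>2) > ?m * \<sigma>\<^sup>2 + \<sigma>\<^sup>2 * \<tau>} z \<partial>awgn \<sigma> N)
    \<le> (\<integral>\<^sup>+z. ennreal ?c * ennreal (exp (s / \<sigma>\<^sup>2 * (\<Sum>i\<in>J. (z i + 0)\<^sup>2))) \<partial>awgn \<sigma> N)"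
    by (intro nn_integral_mono)
  also have "\<dots> = ennreal ?c * ennreal ((1 / sqrt (1 - 2 * s)) ^ card J)"
    using s D nn_integral_awgn_exp_energy[OF assms(1) _ J, of "s / \<sigma>\<^sup>2" "\<lambda>_. 0"]
    by (subst nn_integral_cmult) auto
  also have "\<dots> = ennreal (?c * (1 / sqrt (1 - 2 * s)) ^ card J)"
    using s by (intro ennreal_mult[symmetric]) auto
  also have "\<dots> \<le> ennreal (?c * exp (s + 4 * s\<^sup>2) ^ card J)"
    using s by (intro ennreal_leI mult_left_mono power_mono inverse_sqrt_one_minus_le) auto
  also have "?c * exp (s + 4 * s\<^sup>2) ^ card J = exp (4 * ?m * s\<^sup>2 - s * \<tau>)"
    by (simp add: exp_of_nat_mult[symmetric] mult_exp_exp algebra_simps)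
  finally show ?thesis .
qed

text \<open>Chernoff bound with the negative parameter \<open>- s / \<sigma>\<^sup>2\<close>. The
  noncentrality makes the signal energy enter divided by \<open>1 + 2 * s\<close>.\<close>

lemma energy_lower_tail:
  assumes "\<sigma> > 0" and J: "J \<subseteq> {1..N}" and s: "0 \<le> s" "s \<le> 1 / 4"
    and E: "(\<Sum>i\<in>J. (g i)\<^sup>2) \<ge> \<sigma>\<^sup>2 * E"
  shows "(\<integral>\<^sup>+z. indicator {z. (\<Sum>i\<in>J. (z i + g i)\<^sup>2) \<le> real (card J) * \<sigma>\<^sup>2 + \<sigma>\<^sup>2 * \<tau>} z \<partial>awgn \<sigma> N)
    \<le> ennreal (exp (2 * real (card J) * s\<^sup>2 + s * \<tau> - s * E / (1 + 2 * s)))"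
proof -
  let ?m = "real (card J)"
  let ?c = "exp (s * (?m + \<tau>))"
  have D: "1 - 2 * (- s / \<sigma>\<^sup>2) * \<sigma>\<^sup>2 = 1 + 2 * s" using assms(1) by simp
  have [measurable]: "(\<lambda>z. \<Sum>i\<in>J. (z i + g i)\<^sup>2) \<in> borel_measurable (samples N)"
    using J by (intro borel_measurable_sum) auto
  have "indicator {z. (\<Sum>i\<in>J. (z i + g i)\<^sup>2) \<le> ?m * \<sigma>\<^sup>2 + \<sigma>\<^sup>2 * \<tau>} z
      \<le> ennreal ?c * ennreal (exp (- s / \<sigma>\<^sup>2 * (\<Sum>i\<in>J. (z i + g i)\<^sup>2)))" for z
  proof (cases "(\<Sum>i\<in>J. (z i + g i)\<^sup>2) \<le> ?m * \<sigma>\<^sup>2 + \<sigma>\<^sup>2 * \<tau>")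
    case True
    have "s / \<sigma>\<^sup>2 * (\<Sum>i\<in>J. (z i + g i)\<^sup>2) \<le> s / \<sigma>\<^sup>2 * (?m * \<sigma>\<^sup>2 + \<sigma>\<^sup>2 * \<tau>)"
      using True s by (intro mult_left_mono) auto
    moreover have "s / \<sigma>\<^sup>2 * (?m * \<sigma>\<^sup>2 + \<sigma>\<^sup>2 * \<tau>) = s * (?m + \<tau>)"
      using assms(1) by (simp add: field_simps)
    ultimately have "1 \<le> ?c * exp (- s / \<sigma>\<^sup>2 * (\<Sum>i\<in>J. (z i + g i)\<^sup>2))"
      by (simp add: mult_exp_exp)
    then show ?thesis using True by (simp flip: ennreal_mult)
  qed simp
  then have "(\<integral>\<^sup>+z. indicator {z. (\<Sum>i\<in>J. (z i + g i)\<^sup>2) \<le> ?m * \<sigma>\<^sup>2 + \<sigma>\<^sup>2 * \<tau>} z \<partial>awgn \<sigma> N)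
    \<le> (\<integral>\<^sup>+z. ennreal ?c * ennreal (exp (- s / \<sigma>\<^sup>2 * (\<Sum>i\<in>J. (z i + g i)\<^sup>2))) \<partial>awgn \<sigma> N)"
    by (intro nn_integral_mono)
  also have "\<dots> = ennreal ?c * ennreal (exp (- s / \<sigma>\<^sup>2 * (\<Sum>i\<in>J. (g i)\<^sup>2) / (1 + 2 * s)) * (1 / sqrt (1 + 2 * s)) ^ card J)"
    using s D nn_integral_awgn_exp_energy[OF assms(1) _ J, of "- s / \<sigma>\<^sup>2" g]
    by (subst nn_integral_cmult) auto
  also have "\<dots> = ennreal (?c * (exp (- s / \<sigma>\<^sup>2 * (\<Sum>i\<in>J. (g i)\<^sup>2) / (1 + 2 * s)) * (1 / sqrt (1 + 2 * s)) ^ card J))"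
    using s by (intro ennreal_mult[symmetric]) auto
  also have "\<dots> \<le> ennreal (?c * (exp (- s * E / (1 + 2 * s)) * exp (- s + 2 * s\<^sup>2) ^ card J))"
  proof (intro ennreal_leI mult_left_mono mult_mono power_mono inverse_sqrt_one_plus_le s)
    have "s / \<sigma>\<^sup>2 * (\<sigma>\<^sup>2 * E) \<le> s / \<sigma>\<^sup>2 * (\<Sum>i\<in>J. (g i)\<^sup>2)"
      using s by (intro mult_left_mono E) auto
    then show "exp (- s / \<sigma>\<^sup>2 * (\<Sum>i\<in>J. (g i)\<^sup>2) / (1 + 2 * s)) \<le> exp (- s * E / (1 + 2 * s))"
      using divide_right_mono[of _ _ "1 + 2 * s"] s assms(1) by fastforce
  qed (use s in auto)
  also have "?c * (exp (- s * E / (1 + 2 * s)) * exp (- s + 2 * s\<^sup>2) ^ card J) = exp (2 * ?m * s\<^sup>2 + s * \<tau> - s * E / (1 + 2 * s))"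
    by (simp add: exp_of_nat_mult[symmetric] mult_exp_exp algebra_simps)
  finally show ?thesis .
qed

text \<open>
  Every block of \<open>n\<close> consecutive periods lies in the union of two adjacent slots, so \<open>T\<close> windows
  suffice for arbitrary locations; a window per location would cost \<open>ln (n T)\<close> in the union bound.
\<close>

definition window :: "nat \<Rightarrow> nat \<Rightarrow> nat \<Rightarrow> nat set" where
  "window n N t = {t * n + 1..min ((t + 2) * n) N}"

text \<open>The threshold follows the size of each window, because the last window is cut off at the
  end of the observation and holds only one slot.\<close>

definition energy_test :: "real \<Rightarrow> real \<Rightarrow> nat \<Rightarrow> nat \<Rightarrow> (nat \<Rightarrow> real) \<Rightarrow> real" where
  "energy_test \<sigma> \<tau> n T y =
    (if \<exists>t\<in>{..<T}. (\<Sum>i\<in>window n (n * T) t. (y i)\<^sup>2) > real (card (window n (n * T) t)) * \<sigma>\<^sup>2 + \<sigma>\<^sup>2 * \<tau> then 1 else 0)"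

lemma window_subset: "window n N t \<subseteq> {1..N}"
  by (auto simp: window_def)

lemma card_window: "card (window n N t) \<le> 2 * n"
  by (auto simp: window_def algebra_simps)

lemma measurable_energy [measurable]:
  "J \<subseteq> {1..N} \<Longrightarrow> (\<lambda>z. \<Sum>i\<in>J. (z i)\<^sup>2) \<in> borel_measurable (samples N)"
  by (intro borel_measurable_sum borel_measurable_power measurable_sample) auto

lemma hypothesis_test_energy_test: "hypothesis_test (n * T) (energy_test \<sigma> \<tau> n T)"
proof -
  have [measurable]: "(\<lambda>z. \<Sum>i\<in>window n (n * T) t. (z i)\<^sup>2) \<in> borel_measurable (samples (n * T))" for t
    by (rule measurable_energy[OF window_subset])
  show ?thesis
    unfolding hypothesis_test_def energy_test_def by (auto intro!: measurable_If)
qed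

text \<open>Union bound over the \<open>T\<close> windows. The constant 8 is the 4 of the upper tail
  times the two slots of a window.\<close>

lemma false_alarm_energy_test:
  assumes "\<sigma> > 0" and s: "0 \<le> s" "s \<le> 1 / 4"
  shows "false_alarm \<sigma> (n * T) (energy_test \<sigma> \<tau> n T) \<le> real T * exp (8 * real n * s\<^sup>2 - s * \<tau>)"
proof -
  let ?A = "\<lambda>t. {z. (\<Sum>i\<in>window n (n * T) t. (z i)\<^sup>2) > real (card (window n (n * T) t)) * \<sigma>\<^sup>2 + \<sigma>\<^sup>2 * \<tau>}"
  have [measurable]: "(\<lambda>z. \<Sum>i\<in>window n (n * T) t. (z i)\<^sup>2) \<in> borel_measurable (samples (n * T))" for t
    by (rule measurable_energy[OF window_subset])
  have m: "(\<lambda>z. indicator (?A t) z :: ennreal) \<in> borel_measurable (awgn \<sigma> (n * T))" for t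
  proof -
    have "(\<lambda>z. if (\<Sum>i\<in>window n (n * T) t. (z i)\<^sup>2) > real (card (window n (n * T) t)) * \<sigma>\<^sup>2 + \<sigma>\<^sup>2 * \<tau> then 1 else 0 :: ennreal)
       \<in> borel_measurable (samples (n * T))" by measurable
    then show ?thesis by (simp add: indicator_def measurable_cong_sets[OF sets_awgn refl] if_distrib)
  qed
  have "ennreal (false_alarm \<sigma> (n * T) (energy_test \<sigma> \<tau> n T))
      = (\<integral>\<^sup>+z. ennreal (energy_test \<sigma> \<tau> n T z) \<partial>awgn \<sigma> (n * T))"
    by (rule false_alarm_eq[OF assms(1) hypothesis_test_energy_test])
  also have "\<dots> \<le> (\<integral>\<^sup>+z. (\<Sum>t<T. indicator (?A t) z) \<partial>awgn \<sigma> (n * T))"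
  proof (rule nn_integral_mono)
    fix z :: "nat \<Rightarrow> real"
    show "ennreal (energy_test \<sigma> \<tau> n T z) \<le> (\<Sum>t<T. indicator (?A t) z)"
    proof (cases "\<exists>t\<in>{..<T}. z \<in> ?A t")
      case True
      then obtain t where t: "t \<in> {..<T}" "z \<in> ?A t" by blast
      then have "(1::ennreal) \<le> (\<Sum>t\<in>{t}. indicator (?A t) z)" by simp
      also have "\<dots> \<le> (\<Sum>t<T. indicator (?A t) z)" using t by (intro sum_mono2) auto
      finally show ?thesis using True by (simp add: energy_test_def)
    qed (simp add: energy_test_def)
  qed
  also have "\<dots> = (\<Sum>t<T. \<integral>\<^sup>+z. indicator (?A t) z \<partial>awgn \<sigma> (n * T))"
    using m by (intro nn_integral_sum)
  also have "\<dots> \<le> (\<Sum>t<T. ennreal (exp (8 * real n * s\<^sup>2 - s * \<tau>)))"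
  proof (rule sum_mono)
    fix t
    have "4 * real (card (window n (n * T) t)) * s\<^sup>2 \<le> 4 * real (2 * n) * s\<^sup>2"
      using card_window[of n "n * T" t] by (intro mult_right_mono mult_left_mono) auto
    then have "exp (4 * real (card (window n (n * T) t)) * s\<^sup>2 - s * \<tau>) \<le> exp (8 * real n * s\<^sup>2 - s * \<tau>)"
      by simp
    with energy_upper_tail[OF assms(1) window_subset s]
    show "(\<integral>\<^sup>+z. indicator (?A t) z \<partial>awgn \<sigma> (n * T)) \<le> ennreal (exp (8 * real n * s\<^sup>2 - s * \<tau>))"
      by (rule order_trans[OF _ ennreal_leI])
  qed
  also have "\<dots> = ennreal (real T * exp (8 * real n * s\<^sup>2 - s * \<tau>))"
    by (simp add: ennreal_mult ennreal_of_nat_eq_real_of_nat)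
  finally show ?thesis by (subst (asm) ennreal_le_iff) auto
qed

lemma missed_energy_test:
  assumes "\<sigma> > 0" and s: "0 \<le> s" "s \<le> 1 / 4" and n: "n \<ge> 1"
    and l: "1 \<le> l" "l + n - 1 \<le> n * T" and E: "E \<ge> 0" "(\<Sum>i=1..n. (f i)\<^sup>2) \<ge> \<sigma>\<^sup>2 * E"
  shows "(\<integral>\<^sup>+z. ennreal (1 - energy_test \<sigma> \<tau> n T (received n (n * T) l f z)) \<partial>awgn \<sigma> (n * T))
    \<le> ennreal (exp (4 * real n * s\<^sup>2 + s * \<tau> - s * E / 2))"
proof -
  \<comment> \<open>The slot, counted from 0, in which the block begins. The block ends at latest in
    the next slot, so window \<open>t\<close> holds all of its energy and this one window suffices
    for the bound.\<close>
  define t where "t = (l - 1) div n"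
  have "l - 1 < n * T" using l n by linarith
  then have t: "t < T" unfolding t_def using n
    by (metis div_less_iff_less_mult mult.commute less_le_trans zero_less_one)
  have t1: "t * n \<le> l - 1" unfolding t_def by (rule div_times_less_eq_dividend)
  have t2: "l - 1 < (t + 1) * n" unfolding t_def using n
    by (metis Suc_eq_plus1 dividend_less_div_times mult.commute mult_Suc_right add.commute less_le_trans zero_less_one)
  have sub: "{l..<l + n} \<subseteq> window n (n * T) t"
    using t1 t2 l by (auto simp: window_def algebra_simps)
  let ?J = "window n (n * T) t"
  let ?g = "placed n l f"
  have "(\<Sum>i\<in>?J. (?g i)\<^sup>2) = (\<Sum>i\<in>{l..<l + n}. (?g i)\<^sup>2)"
    using sub by (intro sum.mono_neutral_right) (auto simp: placed_def window_def)
  also have "\<dots> = (\<Sum>i\<in>{1..n * T}. (?g i)\<^sup>2)"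
    using l by (intro sum.mono_neutral_left) (auto simp: placed_def)
  also have "\<dots> = (\<Sum>j=1..n. (f j)\<^sup>2)"
    using sum_placed[OF l, of "\<lambda>_ x. x\<^sup>2"] by simp
  finally have E': "(\<Sum>i\<in>?J. (?g i)\<^sup>2) \<ge> \<sigma>\<^sup>2 * E" using E by simp
  have "(\<integral>\<^sup>+z. ennreal (1 - energy_test \<sigma> \<tau> n T (received n (n * T) l f z)) \<partial>awgn \<sigma> (n * T))
    \<le> (\<integral>\<^sup>+z. indicator {z. (\<Sum>i\<in>?J. (z i + ?g i)\<^sup>2) \<le> real (card ?J) * \<sigma>\<^sup>2 + \<sigma>\<^sup>2 * \<tau>} z \<partial>awgn \<sigma> (n * T))"
  proof (rule nn_integral_mono)
    fix z :: "nat \<Rightarrow> real"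
    have "(\<Sum>i\<in>?J. (received n (n * T) l f z i)\<^sup>2) = (\<Sum>i\<in>?J. (z i + ?g i)\<^sup>2)"
      using window_subset[of n "n * T" t] by (intro sum.cong) (auto simp: received_eq)
    then show "ennreal (1 - energy_test \<sigma> \<tau> n T (received n (n * T) l f z))
       \<le> indicator {z. (\<Sum>i\<in>?J. (z i + ?g i)\<^sup>2) \<le> real (card ?J) * \<sigma>\<^sup>2 + \<sigma>\<^sup>2 * \<tau>} z"
      using t by (auto simp: energy_test_def indicator_def not_le intro!: bexI[of _ t])
  qed
  also have "\<dots> \<le> ennreal (exp (2 * real (card ?J) * s\<^sup>2 + s * \<tau> - s * E / (1 + 2 * s)))"
    by (rule energy_lower_tail[OF assms(1) window_subset s E'])
  also have "\<dots> \<le> ennreal (exp (4 * real n * s\<^sup>2 + s * \<tau> - s * E / 2))"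
  proof -
    have "2 * real (card ?J) * s\<^sup>2 \<le> 2 * real (2 * n) * s\<^sup>2"
      using card_window[of n "n * T" t] by (intro mult_right_mono mult_left_mono) auto
    \<comment> \<open>Here \<open>1 + 2 * s \<le> 3 / 2\<close>, and the rounder denominator 2 is
      enough.\<close>
    moreover have "s * E / 2 \<le> s * E / (1 + 2 * s)"
      using s E by (intro divide_left_mono) auto
    moreover have "2 * real (2 * n) * s\<^sup>2 = 4 * real n * s\<^sup>2" by simp
    ultimately show ?thesis by (intro ennreal_leI iffD2[OF exp_le_cancel_iff]) linarith
  qed
  finally show ?thesis .
qed

section \<open>Converse\<close>

text \<open>The event is taken inside the message and key space so that it stays measurable and
  carries a probability; the location has no influence on the energy of a codeword.\<close>

definition low_energy :: "'k coding_scheme \<Rightarrow> nat \<Rightarrow> real \<Rightarrow> (nat \<times> 'k) set" where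
  "low_energy S n E = {(w, k) \<in> space (message_space (msg_bits S) \<Otimes>\<^sub>M key_space S). (\<Sum>i = 1..n. (encode S w k i)\<^sup>2) \<le> E}"

definition low_energy_prob :: "'k coding_scheme \<Rightarrow> nat \<Rightarrow> real \<Rightarrow> real" where
  "low_energy_prob S n E = measure (message_space (msg_bits S) \<Otimes>\<^sub>M key_space S) (low_energy S n E)"

context
  fixes S :: "'k coding_scheme" and n N :: nat and P :: real
  assumes valid: "valid_scheme n N P S"
begin

lemma prob_space_message_key: "prob_space (message_space (msg_bits S) \<Otimes>\<^sub>M key_space S)"
  by (intro prob_space_pair prob_space_message_space prob_space_key[OF valid])

lemma sets_low_energy [measurable]:
  "low_energy S n E \<in> sets (message_space (msg_bits S) \<Otimes>\<^sub>M key_space S)"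
proof -
  let ?M = "message_space (msg_bits S) \<Otimes>\<^sub>M key_space S"
  have "(\<lambda>x. case x of (w, k) \<Rightarrow> \<Sum>i = 1..n. (encode S w k i)\<^sup>2) \<in> borel_measurable ?M"
    using valid unfolding valid_scheme_def by (intro borel_measurable_integrable) simp
  then have "{x \<in> space ?M. (case x of (w, k) \<Rightarrow> \<Sum>i = 1..n. (encode S w k i)\<^sup>2) \<le> E} \<in> sets ?M"
    by measurable
  then show ?thesis by (simp add: low_energy_def case_prod_beta')
qed

lemma low_energy_prob_nn_integral:
  "ennreal (low_energy_prob S n E) = (\<integral>\<^sup>+(w, k, l). indicator (low_energy S n E) (w, k) \<partial>source_space S L)"
proof -
  interpret K: prob_space "key_space S" by (rule prob_space_key[OF valid])
  interpret MK: prob_space "message_space (msg_bits S) \<Otimes>\<^sub>M key_space S"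
    by (rule prob_space_message_key)
  have "(\<integral>\<^sup>+(w, k, l). indicator (low_energy S n E) (w, k) \<partial>source_space S L)
      = (\<integral>\<^sup>+w. \<integral>\<^sup>+k. \<integral>\<^sup>+l. indicator (low_energy S n E) (w, k) \<partial>measure_pmf L \<partial>key_space S \<partial>message_space (msg_bits S))"
  proof (subst nn_integral_source[OF valid])
    show "(\<lambda>(w, k, l). indicator (low_energy S n E) (w, k) :: ennreal) \<in> borel_measurable (source_space S L)"
      using measurable_compose[OF measurable_source_key(3) borel_measurable_indicator[OF sets_low_energy]]
      by (simp add: case_prod_beta')
  qed simp
  also have "\<dots> = (\<integral>\<^sup>+w. \<integral>\<^sup>+k. indicator (low_energy S n E) (w, k) \<partial>key_space S \<partial>message_space (msg_bits S))"
    by (simp add: measure_pmf.emeasure_space_1)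
  also have "\<dots> = emeasure (message_space (msg_bits S) \<Otimes>\<^sub>M key_space S) (low_energy S n E)"
    by (subst K.nn_integral_fst) auto
  finally show ?thesis by (simp add: low_energy_prob_def MK.emeasure_eq_measure)
qed

lemma low_energy_prob_mono: "E \<le> E' \<Longrightarrow> low_energy_prob S n E \<le> low_energy_prob S n E'"
proof -
  interpret MK: prob_space "message_space (msg_bits S) \<Otimes>\<^sub>M key_space S"
    by (rule prob_space_message_key)
  show "E \<le> E' \<Longrightarrow> low_energy_prob S n E \<le> low_energy_prob S n E'"
    unfolding low_energy_prob_def by (intro MK.finite_measure_mono sets_low_energy) (auto simp: low_energy_def)
qed

text \<open>Markov's inequality at twice the mean energy allowed by the power constraint. This is
  the only use of that constraint in the converse: it forbids the energy from exceeding multiples of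
  \<open>n\<close> with high probability.\<close>

lemma low_energy_prob_ge_half:
  assumes "n \<ge> 1" "P > 0"
  shows "low_energy_prob S n (2 * P * real n) \<ge> 1 / 2"
proof -
  let ?M = "message_space (msg_bits S) \<Otimes>\<^sub>M key_space S"
  let ?e = "\<lambda>x. case x of (w, k) \<Rightarrow> \<Sum>i = 1..n. (encode S w k i)\<^sup>2"
  interpret MK: prob_space ?M by (rule prob_space_message_key)
  have int: "integrable ?M ?e" and pw: "(\<integral>x. ?e x \<partial>?M) \<le> P * real n"
    using valid assms by (auto simp: valid_scheme_def field_simps)
  have "1 - low_energy_prob S n (2 * P * real n) = measure ?M (space ?M - low_energy S n (2 * P * real n))"
    unfolding low_energy_prob_def by (rule MK.prob_compl[symmetric]) measurable
  also have "\<dots> \<le> measure ?M {x\<in>space ?M. ?e x \<ge> 2 * P * real n}"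
    using int by (intro MK.finite_measure_mono) (auto simp: low_energy_def)
  also have "\<dots> \<le> (\<integral>x. ?e x \<partial>?M) / (2 * P * real n)"
    using assms by (intro integral_Markov_inequality_measure[OF int, of "{}"]) (auto intro!: sum_nonneg)
  also have "\<dots> \<le> (P * real n) / (2 * P * real n)"
    using assms by (intro divide_right_mono pw) auto
  also have "\<dots> = 1 / 2" using assms by simp
  finally show ?thesis by simp
qed

text \<open>
  Change of measure: a decoder that never sees a signal succeeds with probability at most
  \<open>2 ^ - M\<close>, and for a signal of energy \<open>E\<close> the likelihood ratio with respect to pure noise
  has second moment \<open>exp (E / \<sigma>\<^sup>2)\<close>.
\<close>

lemma correct_decoding_le:
  assumes \<sigma>: "\<sigma> > 0" and \<gamma>: "\<gamma> > 0" and l: "1 \<le> l" "l + n - 1 \<le> N"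
    and E: "(\<Sum>i = 1..n. (f i)\<^sup>2) \<le> E"
    and [measurable]: "(\<lambda>y. d y) \<in> measurable (samples N) (count_space UNIV)"
  shows "(\<integral>\<^sup>+z. indicator {y. d y = w} (received n N l f z) \<partial>awgn \<sigma> N)
    \<le> ennreal \<gamma> * (\<integral>\<^sup>+y. indicator {y. d y = w} y \<partial>awgn \<sigma> N) + ennreal (exp (E / \<sigma>\<^sup>2) / \<gamma>)"
proof -
  let ?g = "placed n l f"
  let ?L = "likelihood_ratio \<sigma> N ?g"
  have "Measurable.pred (samples N) (\<lambda>y. d y = w)" by measurable
  then have ind[measurable]: "(indicator {y. d y = w} :: _ \<Rightarrow> ennreal) \<in> borel_measurable (samples N)"
    by (simp add: borel_measurable_indicator_iff pred_def Int_def conj_commute)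
  have "(\<integral>\<^sup>+z. indicator {y. d y = w} (received n N l f z) \<partial>awgn \<sigma> N)
     = (\<integral>\<^sup>+y. ennreal (?L y) * indicator {y. d y = w} y \<partial>awgn \<sigma> N)"
    unfolding received_eq by (rule nn_integral_awgn_shift[OF \<sigma> ind])
  also have "\<dots> \<le> (\<integral>\<^sup>+y. ennreal \<gamma> * indicator {y. d y = w} y + ennreal (1 / \<gamma>) * ennreal ((?L y)\<^sup>2) \<partial>awgn \<sigma> N)"
  proof (rule nn_integral_mono)
    fix y :: "nat \<Rightarrow> real"
    have L0: "?L y \<ge> 0" by (simp add: likelihood_ratio_def)
    \<comment> \<open>Truncation at \<open>\<gamma>\<close>: beyond it, one factor of the ratio is
      at least \<open>\<gamma>\<close>, so the ratio is at most its square over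
      \<open>\<gamma>\<close>.\<close>
    have "?L y \<le> \<gamma> + 1 / \<gamma> * (?L y)\<^sup>2"
    proof (cases "?L y \<le> \<gamma>")
      case True
      have "0 \<le> 1 / \<gamma> * (?L y)\<^sup>2" using \<gamma> by simp
      then show ?thesis using True by linarith
    next
      case False
      then have "\<gamma> * ?L y \<le> ?L y * ?L y" using L0 by (intro mult_right_mono) auto
      then have "?L y \<le> 1 / \<gamma> * (?L y)\<^sup>2" using \<gamma> by (simp add: field_simps power2_eq_square)
      then show ?thesis using \<gamma> by linarith
    qed
    then show "ennreal (?L y) * indicator {y. d y = w} y
       \<le> ennreal \<gamma> * indicator {y. d y = w} y + ennreal (1 / \<gamma>) * ennreal ((?L y)\<^sup>2)"
      using \<gamma> by (auto simp: indicator_def simp flip: ennreal_mult ennreal_plus intro: ennreal_leI)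
  qed
  also have "\<dots> = ennreal \<gamma> * (\<integral>\<^sup>+y. indicator {y. d y = w} y \<partial>awgn \<sigma> N)
      + ennreal (1 / \<gamma>) * (\<integral>\<^sup>+y. ennreal ((?L y)\<^sup>2) \<partial>awgn \<sigma> N)"
    using ind by (subst nn_integral_add, measurable, simp_all add: nn_integral_cmult measurable_cong_sets[OF sets_awgn refl])
  also have "(\<integral>\<^sup>+y. ennreal ((?L y)\<^sup>2) \<partial>awgn \<sigma> N) = ennreal (exp ((\<Sum>i = 1..n. (f i)\<^sup>2) / \<sigma>\<^sup>2))"
    using sum_placed[OF l, of "\<lambda>_ x. x\<^sup>2" f] by (simp add: nn_integral_likelihood_ratio_square[OF \<sigma>])
  also have "ennreal (1 / \<gamma>) * \<dots> = ennreal (exp ((\<Sum>i = 1..n. (f i)\<^sup>2) / \<sigma>\<^sup>2) / \<gamma>)"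
    using \<gamma> by (simp flip: ennreal_mult)
  also have "\<dots> \<le> ennreal (exp (E / \<sigma>\<^sup>2) / \<gamma>)"
    using \<gamma> E by (intro ennreal_leI divide_right_mono) (auto intro: divide_right_mono)
  finally show ?thesis by (simp add: add_left_mono)
qed

text \<open>Low energy occurs either with a decoding error or with correct decoding. In the second
  case the change of measure for fixed message, key and location compares with a decoder that sees
  no signal. That decoder is right for a share \<open>1 / 2 ^ M\<close> of the messages at most,
  even though it is told the true key and location. Arbitrary codebooks and arbitrary laws of the
  location are thus covered at once.\<close>

lemma low_energy_prob_le:
  assumes \<sigma>: "\<sigma>b > 0" "\<sigma>w > 0" and \<gamma>: "\<gamma> > 0"
    and L: "\<forall>l\<in>set_pmf L. 1 \<le> l \<and> l + n - 1 \<le> N"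
  shows "low_energy_prob S n E \<le> bob_error \<sigma>b \<sigma>w n N S L + (\<gamma> / 2 ^ msg_bits S + exp (E / \<sigma>b\<^sup>2) / \<gamma>)"
proof -
  let ?M = "message_space (msg_bits S)" and ?K = "key_space S"
  let ?e = "exp (E / \<sigma>b\<^sup>2) / \<gamma>"
  interpret B: prob_space "awgn \<sigma>b N" by (rule prob_space_awgn[OF \<sigma>(1)])
  interpret K: prob_space ?K by (rule prob_space_key[OF valid])
  interpret KL: prob_space "?K \<Otimes>\<^sub>M measure_pmf L" by (intro prob_space_pair K.prob_space_axioms prob_space_measure_pmf)
  define dec where "dec = (\<lambda>(w, k, l) z. decode S (received n N l (encode S w k) z) k l)"
  define err where "err = (\<lambda>(w::nat, k, l). \<integral>\<^sup>+z. indicator {z. dec (w, k, l) z \<noteq> w} z \<partial>awgn \<sigma>b N)"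
  define cor where "cor = (\<lambda>(w::nat, k, l). \<integral>\<^sup>+z. indicator {z. dec (w, k, l) z = w} z \<partial>awgn \<sigma>b N)"
  \<comment> \<open>The decoder keeps the true key and location but receives noise alone, so its
    output no longer depends on the message.\<close>
  define blind where "blind = (\<lambda>(w::nat, k, l). \<integral>\<^sup>+y. indicator {y. decode S y k l = w} y \<partial>awgn \<sigma>b N)"
  note dm = measurable_decode_source[OF valid]
  have dec_m: "(\<lambda>(u, z). dec u z) \<in> measurable (source_space S L \<Otimes>\<^sub>M samples N) (count_space UNIV)"
    using dm[of "\<lambda>(w, k, l) z. received n N l (encode S w k) z"] measurable_received_source[OF valid]
    by (simp add: dec_def case_prod_beta')
  have bl_m: "(\<lambda>((w, k, l), z). decode S z k l) \<in> measurable (source_space S L \<Otimes>\<^sub>M samples N) (count_space UNIV)"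
    using dm[of "\<lambda>u z. z"] by (simp add: case_prod_beta')
  have msg_m: "(\<lambda>((w, k, l), z). w) \<in> measurable (source_space S L \<Otimes>\<^sub>M samples N) (count_space UNIV)"
    using measurable_compose[OF measurable_fst measurable_source_key(4), of S L "samples N"]
    by (simp add: case_prod_beta')
  have eq_m: "(\<lambda>(u, z). if f (u, z) = g (u, z) then 1 else 0 :: ennreal) \<in> borel_measurable (source_space S L \<Otimes>\<^sub>M samples N)"
    if [measurable]: "f \<in> measurable (source_space S L \<Otimes>\<^sub>M samples N) (count_space UNIV)"
      "g \<in> measurable (source_space S L \<Otimes>\<^sub>M samples N) (count_space UNIV)" for f g :: "_ \<Rightarrow> nat"
  proof -
    have [measurable]: "Measurable.pred (source_space S L \<Otimes>\<^sub>M samples N) (\<lambda>x. f x = g x)"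
      by (rule measurable_compose_countable[where f = "\<lambda>m x. f x = m"]) measurable
    have "(\<lambda>x. if f x = g x then 1 else 0 :: ennreal) \<in> borel_measurable (source_space S L \<Otimes>\<^sub>M samples N)"
      by measurable
    then show ?thesis by (simp add: case_prod_beta')
  qed
  have neq_m: "(\<lambda>(u, z). if f (u, z) \<noteq> g (u, z) then 1 else 0 :: ennreal) \<in> borel_measurable (source_space S L \<Otimes>\<^sub>M samples N)"
    if [measurable]: "f \<in> measurable (source_space S L \<Otimes>\<^sub>M samples N) (count_space UNIV)"
      "g \<in> measurable (source_space S L \<Otimes>\<^sub>M samples N) (count_space UNIV)" for f g :: "_ \<Rightarrow> nat"
  proof -
    have [measurable]: "Measurable.pred (source_space S L \<Otimes>\<^sub>M samples N) (\<lambda>x. f x \<noteq> g x)"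
      by (rule measurable_compose_countable[where f = "\<lambda>m x. f x \<noteq> m"]) measurable
    have "(\<lambda>x. if f x \<noteq> g x then 1 else 0 :: ennreal) \<in> borel_measurable (source_space S L \<Otimes>\<^sub>M samples N)"
      by measurable
    then show ?thesis by (simp add: case_prod_beta')
  qed
  note ind_m = measurable_awgn_kernel[OF \<sigma>(1), of _ "source_space S L" N]
  have cor_m[measurable]: "cor \<in> borel_measurable (source_space S L)"
    using ind_m[OF eq_m[OF dec_m msg_m]] by (simp add: cor_def indicator_def case_prod_beta' of_bool_def)
  have blind_m[measurable]: "blind \<in> borel_measurable (source_space S L)"
    using ind_m[OF eq_m[OF bl_m msg_m]] by (simp add: blind_def indicator_def case_prod_beta' of_bool_def)
  have err_m[measurable]: "err \<in> borel_measurable (source_space S L)"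
    using ind_m[OF neq_m[OF dec_m msg_m]] by (simp add: err_def indicator_def case_prod_beta' of_bool_def)
  have low_m[measurable]: "(\<lambda>(w, k, l). indicator (low_energy S n E) (w, k) :: ennreal) \<in> borel_measurable (source_space S L)"
    using measurable_compose[OF measurable_source_key(3) borel_measurable_indicator[OF sets_low_energy]]
    by (simp add: case_prod_beta')
  have err_cor: "err u + cor u = 1" if "u \<in> space (source_space S L)" for u
  proof -
    obtain w k l where u: "u = (w, k, l)" by (cases u)
    have 1: "(\<lambda>z. F (u, z)) \<in> borel_measurable (awgn \<sigma>b N)"
      if "F \<in> borel_measurable (source_space S L \<Otimes>\<^sub>M samples N)" for F :: "_ \<Rightarrow> ennreal"
      using measurable_compose[OF measurable_Pair1'[OF \<open>u \<in> _\<close>] that] by (simp add: measurable_cong_sets[OF sets_awgn refl])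
    have "err u + cor u = (\<integral>\<^sup>+z. indicator {z. dec u z \<noteq> w} z + indicator {z. dec u z = w} z \<partial>awgn \<sigma>b N)"
      using 1[OF eq_m[OF dec_m msg_m]] 1[OF neq_m[OF dec_m msg_m]] unfolding u err_def cor_def
      by (subst nn_integral_add) (simp_all add: indicator_def[abs_def] of_bool_def)
    also have "\<dots> = (\<integral>\<^sup>+z. 1 \<partial>awgn \<sigma>b N)"
      by (intro nn_integral_cong) (auto simp: indicator_def)
    finally show ?thesis by (simp add: B.emeasure_space_1)
  qed
  have low_cor: "indicator (low_energy S n E) (w, k) * cor (w, k, l) \<le> ennreal \<gamma> * blind (w, k, l) + ennreal ?e"
    if "k \<in> space ?K" "l \<in> set_pmf L" for w k l
  proof (cases "(w, k) \<in> low_energy S n E")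
    case True
    have "(\<lambda>y. (y, k, l)) \<in> measurable (samples N) (samples N \<Otimes>\<^sub>M (?K \<Otimes>\<^sub>M count_space UNIV))"
      using that by measurable
    from measurable_compose[OF this measurable_decode[OF valid]]
    have "(\<lambda>y. decode S y k l) \<in> measurable (samples N) (count_space UNIV)" by simp
    from correct_decoding_le[OF \<sigma>(1) \<gamma> _ _ _ this] True that L
    show ?thesis by (simp add: low_energy_def cor_def blind_def dec_def indicator_def)
  qed simp
  \<comment> \<open>For fixed key and location the events of decoding to different messages are
    disjoint, so their probabilities add up to at most 1.\<close>
  have blind_sum: "(\<Sum>w\<in>{1..2 ^ msg_bits S}. blind (w, k, l)) \<le> 1" if "k \<in> space ?K" for k l
  proof -
    have "(\<lambda>y. (y, k, l)) \<in> measurable (samples N) (samples N \<Otimes>\<^sub>M (?K \<Otimes>\<^sub>M count_space UNIV))"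
      using that by measurable
    from measurable_compose[OF this measurable_decode[OF valid]]
    have [measurable]: "(\<lambda>y. decode S y k l) \<in> measurable (samples N) (count_space UNIV)" by simp
    have "(\<lambda>y. if decode S y k l = w then 1 else 0 :: ennreal) \<in> borel_measurable (samples N)" for w
      by measurable
    then have "(\<Sum>w\<in>{1..2 ^ msg_bits S}. blind (w, k, l))
       = (\<integral>\<^sup>+y. (\<Sum>w\<in>{1..2 ^ msg_bits S}. indicator {y. decode S y k l = w} y) \<partial>awgn \<sigma>b N)"
      unfolding blind_def by (subst nn_integral_sum)
        (simp_all add: indicator_def of_bool_def measurable_cong_sets[OF sets_awgn refl])
    also have "\<dots> \<le> (\<integral>\<^sup>+y. 1 \<partial>awgn \<sigma>b N)"
      by (intro nn_integral_mono) (simp add: indicator_def of_bool_def)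
    finally show ?thesis by (simp add: B.emeasure_space_1)
  qed
  have bl_KL: "(\<lambda>x. blind (w, x)) \<in> borel_measurable (?K \<Otimes>\<^sub>M measure_pmf L)" if "w \<in> {1..2 ^ msg_bits S}" for w
  proof -
    have "(\<lambda>x. (w, x)) \<in> measurable (?K \<Otimes>\<^sub>M measure_pmf L) (source_space S L)"
      unfolding source_space_def using that by (intro measurable_Pair1') (simp add: space_message_space)
    from measurable_compose[OF this blind_m] show ?thesis .
  qed
  have blind_int: "(\<integral>\<^sup>+u. blind u \<partial>source_space S L) \<le> ennreal (1 / 2 ^ msg_bits S)"
  proof -
    have "(\<integral>\<^sup>+u. blind u \<partial>source_space S L) = (\<integral>\<^sup>+w. \<integral>\<^sup>+x. blind (w, x) \<partial>(?K \<Otimes>\<^sub>M measure_pmf L) \<partial>?M)"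
      using blind_m unfolding source_space_def by (rule KL.nn_integral_fst[symmetric])
    also have "\<dots> = ennreal (1 / 2 ^ msg_bits S) * (\<Sum>w\<in>{1..2 ^ msg_bits S}. \<integral>\<^sup>+x. blind (w, x) \<partial>(?K \<Otimes>\<^sub>M measure_pmf L))"
      by (simp add: nn_integral_message_space sum_distrib_left)
    also have "(\<Sum>w\<in>{1..2 ^ msg_bits S}. \<integral>\<^sup>+x. blind (w, x) \<partial>(?K \<Otimes>\<^sub>M measure_pmf L))
        = (\<integral>\<^sup>+x. (\<Sum>w\<in>{1..2 ^ msg_bits S}. blind (w, x)) \<partial>(?K \<Otimes>\<^sub>M measure_pmf L))"
      using bl_KL by (intro nn_integral_sum[symmetric])
    also have "\<dots> \<le> (\<integral>\<^sup>+x. 1 \<partial>(?K \<Otimes>\<^sub>M measure_pmf L))"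
      using blind_sum by (intro nn_integral_mono) (auto simp: space_pair_measure)
    also have "\<dots> = 1" by (simp add: KL.emeasure_space_1)
    finally show ?thesis by (simp add: mult_left_mono)
  qed
  have "ennreal (low_energy_prob S n E) = (\<integral>\<^sup>+(w, k, l). indicator (low_energy S n E) (w, k) \<partial>source_space S L)"
    by (rule low_energy_prob_nn_integral)
  \<comment> \<open>Since \<open>err u + cor u = 1\<close>, an indicator is at most
    \<open>err u\<close> plus the indicator times \<open>cor u\<close>.\<close>
  also have "\<dots> \<le> (\<integral>\<^sup>+u. err u + (case u of (w, k, l) \<Rightarrow> indicator (low_energy S n E) (w, k)) * cor u \<partial>source_space S L)"
  proof (rule nn_integral_mono)
    fix u assume u: "u \<in> space (source_space S L)"
    show "(case u of (w, k, l) \<Rightarrow> indicator (low_energy S n E) (w, k)) \<le> err u + (case u of (w, k, l) \<Rightarrow> indicator (low_energy S n E) (w, k)) * cor u"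
      using err_cor[OF u] by (cases u) (auto simp: indicator_def)
  qed
  also have "\<dots> = (\<integral>\<^sup>+u. err u \<partial>source_space S L) + (\<integral>\<^sup>+u. (case u of (w, k, l) \<Rightarrow> indicator (low_energy S n E) (w, k)) * cor u \<partial>source_space S L)"
    by (intro nn_integral_add borel_measurable_times_ennreal low_m cor_m err_m)
  also have "(\<integral>\<^sup>+u. (case u of (w, k, l) \<Rightarrow> indicator (low_energy S n E) (w, k)) * cor u \<partial>source_space S L)
     = (\<integral>\<^sup>+w. \<integral>\<^sup>+k. \<integral>\<^sup>+l. indicator (low_energy S n E) (w, k) * cor (w, k, l) \<partial>measure_pmf L \<partial>?K \<partial>?M)"
    by (subst nn_integral_source[OF valid borel_measurable_times_ennreal[OF low_m cor_m]]) simp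
  also have "\<dots> \<le> (\<integral>\<^sup>+w. \<integral>\<^sup>+k. \<integral>\<^sup>+l. ennreal \<gamma> * blind (w, k, l) + ennreal ?e \<partial>measure_pmf L \<partial>?K \<partial>?M)"
    using low_cor by (intro nn_integral_mono nn_integral_mono_AE) (simp add: AE_measure_pmf_iff)
  also have "\<dots> = (\<integral>\<^sup>+u. ennreal \<gamma> * blind u + ennreal ?e \<partial>source_space S L)"
    by (rule nn_integral_source[OF valid, symmetric]) measurable
  also have "\<dots> = ennreal \<gamma> * (\<integral>\<^sup>+u. blind u \<partial>source_space S L) + ennreal ?e"
    using prob_space.emeasure_space_1[OF prob_space_source[OF valid, of L]]
    by (subst nn_integral_add) (measurable, simp add: nn_integral_cmult)
  also have "\<dots> \<le> ennreal \<gamma> * ennreal (1 / 2 ^ msg_bits S) + ennreal ?e"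
    by (intro add_right_mono mult_left_mono blind_int) auto
  also have "\<dots> = ennreal (\<gamma> / 2 ^ msg_bits S + ?e)"
    using \<gamma> by (simp flip: ennreal_mult ennreal_plus)
  also have "(\<integral>\<^sup>+u. err u \<partial>source_space S L) = ennreal (bob_error \<sigma>b \<sigma>w n N S L)"
    unfolding bob_error_eq[OF valid \<sigma>] by (intro nn_integral_cong) (auto simp: err_def dec_def)
  finally have "ennreal (low_energy_prob S n E) \<le> ennreal (bob_error \<sigma>b \<sigma>w n N S L) + ennreal (\<gamma> / 2 ^ msg_bits S + ?e)"
    by (simp add: add_left_mono)
  moreover have "bob_error \<sigma>b \<sigma>w n N S L \<ge> 0" by (simp add: bob_error_def)
  ultimately show ?thesis using \<gamma>
    by (simp flip: ennreal_plus)
qed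

end

text \<open>On the low energy event the trivial bound 1 is used; off that event the window detector
  applies for every fixed message, key and location.\<close>

lemma missed_detection_energy_test:
  assumes valid: "valid_scheme n (n * T) P S"
    and \<sigma>: "\<sigma>b > 0" "\<sigma>w > 0" and s: "0 \<le> s" "s \<le> 1 / 4" and n: "n \<ge> 1" and E: "E \<ge> 0"
    and L: "\<forall>l\<in>set_pmf L. 1 \<le> l \<and> l + n - 1 \<le> n * T"
  shows "missed_detection \<sigma>b \<sigma>w n (n * T) S L (energy_test \<sigma>w \<tau> n T)
    \<le> low_energy_prob S n (\<sigma>w\<^sup>2 * E) + exp (4 * real n * s\<^sup>2 + s * \<tau> - s * E / 2)"
proof -
  let ?M = "message_space (msg_bits S)" and ?K = "key_space S"
  let ?e = "exp (4 * real n * s\<^sup>2 + s * \<tau> - s * E / 2)"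
  let ?\<phi> = "energy_test \<sigma>w \<tau> n T"
  let ?low = "low_energy S n (\<sigma>w\<^sup>2 * E)"
  interpret W: prob_space "awgn \<sigma>w (n * T)" by (rule prob_space_awgn[OF \<sigma>(2)])
  have low_m[measurable]: "(\<lambda>(w, k, l). indicator ?low (w, k) :: ennreal) \<in> borel_measurable (source_space S L)"
    using measurable_compose[OF measurable_source_key(3) borel_measurable_indicator[OF sets_low_energy[OF valid]]]
    by (simp add: case_prod_beta')
  define F where "F = (\<lambda>u. case u of (w, k, l) \<Rightarrow> \<integral>\<^sup>+z. ennreal (1 - ?\<phi> (received n (n * T) l (encode S w k) z)) \<partial>awgn \<sigma>w (n * T))"
  have F_m: "F \<in> borel_measurable (source_space S L)"
    unfolding F_def by (rule missed_detection_eq(3)[OF valid \<sigma> hypothesis_test_energy_test])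
  have bound: "F (w, k, l) \<le> indicator ?low (w, k) + ennreal ?e"
    if "w \<in> space ?M" "k \<in> space ?K" "l \<in> set_pmf L" for w k l
  proof (cases "(w, k) \<in> ?low")
    case True
    have "F (w, k, l) \<le> (\<integral>\<^sup>+z. 1 \<partial>awgn \<sigma>w (n * T))"
      unfolding F_def prod.case by (intro nn_integral_mono) (simp add: energy_test_def)
    then have "F (w, k, l) \<le> 1" by (simp add: W.emeasure_space_1)
    also have "\<dots> \<le> 1 + ennreal ?e" by simp
    finally show ?thesis using True by simp
  next
    case False
    then have "(\<Sum>i = 1..n. (encode S w k i)\<^sup>2) \<ge> \<sigma>w\<^sup>2 * E"
      using that by (auto simp: low_energy_def space_pair_measure)
    then show ?thesis using missed_energy_test[OF \<sigma>(2) s n _ _ E] L that False by (simp add: F_def)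
  qed
  have "ennreal (missed_detection \<sigma>b \<sigma>w n (n * T) S L ?\<phi>) = (\<integral>\<^sup>+u. F u \<partial>source_space S L)"
    unfolding F_def by (rule missed_detection_eq(1)[OF valid \<sigma> hypothesis_test_energy_test])
  also have "\<dots> = (\<integral>\<^sup>+w. \<integral>\<^sup>+k. \<integral>\<^sup>+l. F (w, k, l) \<partial>measure_pmf L \<partial>?K \<partial>?M)"
    by (rule nn_integral_source[OF valid F_m])
  also have "\<dots> \<le> (\<integral>\<^sup>+w. \<integral>\<^sup>+k. \<integral>\<^sup>+l. (case (w, k, l) of (w, k, l) \<Rightarrow> indicator ?low (w, k)) + ennreal ?e \<partial>measure_pmf L \<partial>?K \<partial>?M)"
    using bound by (intro nn_integral_mono nn_integral_mono_AE) (simp add: AE_measure_pmf_iff)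
  also have "\<dots> = (\<integral>\<^sup>+u. (case u of (w, k, l) \<Rightarrow> indicator ?low (w, k)) + ennreal ?e \<partial>source_space S L)"
    by (rule nn_integral_source[OF valid, symmetric]) measurable
  also have "\<dots> = (\<integral>\<^sup>+(w, k, l). indicator ?low (w, k) \<partial>source_space S L) + ennreal ?e"
    using prob_space.emeasure_space_1[OF prob_space_source[OF valid, of L]]
    by (subst nn_integral_add[OF low_m]) auto
  also have "\<dots> = ennreal (low_energy_prob S n (\<sigma>w\<^sup>2 * E) + ?e)"
    unfolding low_energy_prob_nn_integral[OF valid, symmetric]
    by (simp add: low_energy_prob_def flip: ennreal_plus)
  finally show ?thesis
    by (subst (asm) ennreal_le_iff) (auto simp: low_energy_prob_def intro: add_nonneg_nonneg)
qed

definition root_nlog :: "(nat \<Rightarrow> nat) \<Rightarrow> nat \<Rightarrow> real" where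
  "root_nlog T n = sqrt (real n * ln (real (T n)))"

lemma eventually_ln_ge:
  assumes "filterlim T at_top sequentially"
  shows "eventually (\<lambda>n. ln (real (T n)) \<ge> c) sequentially"
proof -
  have "filterlim (\<lambda>n. ln (real (T n))) at_top sequentially"
    by (rule filterlim_compose[OF ln_at_top filterlim_compose[OF filterlim_real_sequentially assms]])
  then show ?thesis by (simp add: filterlim_at_top)
qed

lemma filterlim_root_nlog:
  assumes "filterlim T at_top sequentially"
  shows "filterlim (root_nlog T) at_top sequentially"
proof (rule filterlim_at_top_mono)
  show "filterlim (\<lambda>n. sqrt (real n)) at_top sequentially"
    by (rule filterlim_compose[OF sqrt_at_top filterlim_real_sequentially])
  show "\<forall>\<^sub>F n in sequentially. sqrt (real n) \<le> root_nlog T n"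
    using eventually_ln_ge[OF assms, of 1]
    by eventually_elim (auto simp: root_nlog_def intro!: mult_le_cancel_left1[THEN iffD2])
qed

lemma covert_converse:
  fixes S :: "nat \<Rightarrow> 'k coding_scheme" and L :: "nat \<Rightarrow> nat pmf"
  assumes \<sigma>: "\<sigma>b > 0" "\<sigma>w > 0" and P: "P > 0"
    and T: "filterlim T at_top sequentially"
    and valid: "\<And>n. n \<ge> 1 \<Longrightarrow> valid_scheme n (n * T n) P (S n)"
    and L: "\<And>n. n \<ge> 1 \<Longrightarrow> \<forall>l\<in>set_pmf (L n). 1 \<le> l \<and> l + n - 1 \<le> n * T n"
    and M: "filterlim (\<lambda>n. real (msg_bits (S n)) / sqrt (real n * ln (real (T n)))) at_top sequentially"
    and err: "(\<lambda>n. bob_error \<sigma>b \<sigma>w n (n * T n) (S n) (L n)) \<longlonglongrightarrow> 0"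
  shows "\<exists>\<phi>. (\<forall>n. hypothesis_test (n * T n) (\<phi> n)) \<and>
    (\<lambda>n. false_alarm \<sigma>w (n * T n) (\<phi> n)
      + missed_detection \<sigma>b \<sigma>w n (n * T n) (S n) (L n) (\<phi> n)) \<longlonglongrightarrow> 0"
proof -
  let ?r = "root_nlog T"
  note rtop = filterlim_root_nlog[OF T]
  have r_pos: "eventually (\<lambda>n. ?r n > 0) sequentially"
    using rtop by (simp add: filterlim_at_top_dense)
  have low0: "(\<lambda>n. low_energy_prob (S n) n (C * ?r n)) \<longlonglongrightarrow> 0" for C :: real
  proof (rule tendsto_sandwich[OF _ _ tendsto_const])
    have "(\<lambda>n. bob_error \<sigma>b \<sigma>w n (n * T n) (S n) (L n) + 2 * exp (- ?r n)) \<longlonglongrightarrow> 0 + 2 * 0"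
      by (intro tendsto_add tendsto_mult err tendsto_const filterlim_compose[OF exp_at_bot]
          filterlim_compose[OF filterlim_uminus_at_bot_at_top rtop])
    then show "(\<lambda>n. bob_error \<sigma>b \<sigma>w n (n * T n) (S n) (L n) + 2 * exp (- ?r n)) \<longlonglongrightarrow> 0" by simp
    show "\<forall>\<^sub>F n in sequentially. 0 \<le> low_energy_prob (S n) n (C * ?r n)"
      using eventually_ge_at_top[of 1] by eventually_elim (simp add: low_energy_prob_def)
    \<comment> \<open>The constant is chosen to give
      \<open>M * ln 2 / 2 \<ge> \<bar>C\<bar> * r / \<sigma>b\<^sup>2 + r\<close>, where
      \<open>r\<close> is \<open>root_nlog T n\<close>. Then both error terms at the threshold
      \<open>exp (M * ln 2 / 2)\<close> are at most \<open>exp (- r)\<close>. The absolute value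
      keeps the first of them under control for negative \<open>C\<close> too.\<close>
    have "\<forall>\<^sub>F n in sequentially. real (msg_bits (S n)) / sqrt (real n * ln (real (T n))) \<ge> 2 / ln 2 * (\<bar>C\<bar> / \<sigma>b\<^sup>2 + 1)"
      using M by (simp add: filterlim_at_top)
    with r_pos eventually_ge_at_top[of 1]
    show "\<forall>\<^sub>F n in sequentially. low_energy_prob (S n) n (C * ?r n)
        \<le> bob_error \<sigma>b \<sigma>w n (n * T n) (S n) (L n) + 2 * exp (- ?r n)"
    proof eventually_elim
      case (elim n)
      let ?M = "real (msg_bits (S n))"
      have 1: "?M * ln 2 / 2 \<ge> (\<bar>C\<bar> / \<sigma>b\<^sup>2 + 1) * ?r n"
      proof -
        have "2 / ln 2 * (\<bar>C\<bar> / \<sigma>b\<^sup>2 + 1) * ?r n \<le> ?M"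
          using elim(1,3) by (simp add: root_nlog_def pos_le_divide_eq)
        then have "ln 2 / 2 * (2 / ln 2 * (\<bar>C\<bar> / \<sigma>b\<^sup>2 + 1) * ?r n) \<le> ln 2 / 2 * ?M"
          by (intro mult_left_mono) auto
        moreover have "ln 2 / 2 * (2 / ln 2 * (\<bar>C\<bar> / \<sigma>b\<^sup>2 + 1) * ?r n) = (\<bar>C\<bar> / \<sigma>b\<^sup>2 + 1) * ?r n"
          by simp
        moreover have "ln 2 / 2 * ?M = ?M * ln 2 / 2" by simp
        ultimately show ?thesis by (simp only:)
      qed
      have 2: "?r n \<le> ?M * ln 2 / 2" "C * ?r n / \<sigma>b\<^sup>2 - ?M * ln 2 / 2 \<le> - ?r n"
      proof -
        have expand: "(\<bar>C\<bar> / \<sigma>b\<^sup>2 + 1) * ?r n = \<bar>C\<bar> / \<sigma>b\<^sup>2 * ?r n + ?r n"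
          by (simp only: distrib_right mult_1_left)
        have "0 \<le> \<bar>C\<bar> / \<sigma>b\<^sup>2 * ?r n" using elim by simp
        then show "?r n \<le> ?M * ln 2 / 2" using 1 expand by linarith
        have "C / \<sigma>b\<^sup>2 * ?r n \<le> \<bar>C\<bar> / \<sigma>b\<^sup>2 * ?r n"
          using elim by (intro divide_right_mono mult_right_mono) auto
        moreover have "C * ?r n / \<sigma>b\<^sup>2 = C / \<sigma>b\<^sup>2 * ?r n" by simp
        ultimately have le: "C * ?r n / \<sigma>b\<^sup>2 \<le> \<bar>C\<bar> / \<sigma>b\<^sup>2 * ?r n" by (simp only:)
        have "a - m \<le> - x" if "a \<le> b" "c \<le> m" "c = b + x" for a b c m x :: real
          using that by linarith
        from this[OF le 1 expand] show "C * ?r n / \<sigma>b\<^sup>2 - ?M * ln 2 / 2 \<le> - ?r n" .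
      qed
      have pw: "(2::real) ^ msg_bits (S n) = exp (?M * ln 2)"
        by (simp add: exp_of_nat_mult)
      \<comment> \<open>the threshold \<open>\<gamma> = 2 powr (M / 2)\<close> balances the two error terms\<close>
      have "low_energy_prob (S n) n (C * ?r n) \<le> bob_error \<sigma>b \<sigma>w n (n * T n) (S n) (L n)
        + (exp (?M * ln 2 / 2) / 2 ^ msg_bits (S n) + exp (C * ?r n / \<sigma>b\<^sup>2) / exp (?M * ln 2 / 2))"
        using elim by (intro low_energy_prob_le[OF valid \<sigma> _ L]) auto
      also have "exp (?M * ln 2 / 2) / 2 ^ msg_bits (S n) = exp (- (?M * ln 2 / 2))"
        by (simp add: pw flip: exp_diff)
      also have "exp (C * ?r n / \<sigma>b\<^sup>2) / exp (?M * ln 2 / 2) = exp (C * ?r n / \<sigma>b\<^sup>2 - ?M * ln 2 / 2)"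
        by (simp add: exp_diff)
      also have "exp (- (?M * ln 2 / 2)) + \<dots> \<le> exp (- ?r n) + exp (- ?r n)"
        using 2 by (intro add_mono) auto
      finally show ?case by simp
    qed
  qed
  have small: "eventually (\<lambda>n. ln (real (T n)) \<le> real n) sequentially"
  proof -
    have "eventually (\<lambda>n. low_energy_prob (S n) n (2 * P * ?r n) < 1 / 2) sequentially"
      using low0[of "2 * P"] by (rule order_tendstoD) simp
    with eventually_ge_at_top[of 1] show ?thesis
    proof eventually_elim
      case (elim n)
      show ?case
      proof (rule ccontr)
        assume "\<not> ln (real (T n)) \<le> real n"
        \<comment> \<open>If \<open>ln T > n\<close>, then \<open>n \<le> sqrt (n * ln T)\<close>,
          so energy at most \<open>2 * P * n\<close>, which has probability at least 1/2, would
          count as low energy.\<close>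
        then have "real n * real n \<le> real n * ln (real (T n))" by (intro mult_left_mono) auto
        then have "real n \<le> ?r n" unfolding root_nlog_def by (intro real_le_rsqrt) (simp add: power2_eq_square)
        then have "low_energy_prob (S n) n (2 * P * real n) \<le> low_energy_prob (S n) n (2 * P * ?r n)"
          using P by (intro low_energy_prob_mono[OF valid[OF elim(1)]]) auto
        with low_energy_prob_ge_half[OF valid[OF elim(1)] elim(1) P] elim(2) show False by simp
      qed
    qed
  qed
  \<comment> \<open>With \<open>s\<close> as chosen below and \<open>r = root_nlog T n\<close>, one
    has \<open>s * r = ln T / 4\<close> and \<open>n * s\<^sup>2 = ln T / 16\<close>. The threshold
    10 then gives the upper tail the exponent \<open>- 2 * ln T\<close>, of which the union bound
    consumes one \<open>ln T\<close>. The energy level 40 used later leaves the missed detection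
    with an exponent below \<open>- ln T\<close>.\<close>
  define \<phi> where "\<phi> = (\<lambda>n. energy_test \<sigma>w (10 * ?r n) n (T n))"
  have ht: "hypothesis_test (n * T n) (\<phi> n)" for n
    unfolding \<phi>_def by (rule hypothesis_test_energy_test)
  have "(\<lambda>n. false_alarm \<sigma>w (n * T n) (\<phi> n)
      + missed_detection \<sigma>b \<sigma>w n (n * T n) (S n) (L n) (\<phi> n)) \<longlonglongrightarrow> 0"
  proof (rule tendsto_sandwich[OF _ _ tendsto_const])
    show "\<forall>\<^sub>F n in sequentially. 0 \<le> false_alarm \<sigma>w (n * T n) (\<phi> n) + missed_detection \<sigma>b \<sigma>w n (n * T n) (S n) (L n) (\<phi> n)"
      using eventually_ge_at_top[of 1]
      by eventually_elim (intro add_nonneg_nonneg false_alarm_eq(2)[OF \<sigma>(2) ht] missed_detection_eq(2)[OF valid \<sigma> ht])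
    have lt: "filterlim (\<lambda>n. ln (real (T n))) at_top sequentially"
      by (rule filterlim_compose[OF ln_at_top filterlim_compose[OF filterlim_real_sequentially T]])
    have "(\<lambda>n. 2 * exp (- ln (real (T n))) + low_energy_prob (S n) n (40 * \<sigma>w\<^sup>2 * ?r n)) \<longlonglongrightarrow> 2 * 0 + 0"
      by (intro tendsto_add tendsto_mult low0 tendsto_const filterlim_compose[OF exp_at_bot]
          filterlim_compose[OF filterlim_uminus_at_bot_at_top lt])
    then show "(\<lambda>n. 2 * exp (- ln (real (T n))) + low_energy_prob (S n) n (40 * \<sigma>w\<^sup>2 * ?r n)) \<longlonglongrightarrow> 0" by simp
    show "\<forall>\<^sub>F n in sequentially. false_alarm \<sigma>w (n * T n) (\<phi> n) + missed_detection \<sigma>b \<sigma>w n (n * T n) (S n) (L n) (\<phi> n)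
       \<le> 2 * exp (- ln (real (T n))) + low_energy_prob (S n) n (40 * \<sigma>w\<^sup>2 * ?r n)"
      using eventually_ge_at_top[of 1] small eventually_ln_ge[OF T, of 1]
    proof eventually_elim
      case (elim n)
      let ?l = "ln (real (T n))"
      \<comment> \<open>The order \<open>sqrt (ln T / n)\<close> balances the quadratic and the
        linear Chernoff terms. The quarter makes \<open>s \<le> 1 / 4\<close> follow from
        \<open>ln T \<le> n\<close>.\<close>
      define s where "s = sqrt (?l / real n) / 4"
      have Tpos: "real (T n) > 0" using elim(3) by (cases "T n = 0") auto
      have s: "0 \<le> s" "s \<le> 1 / 4"
        using elim by (auto simp: s_def real_sqrt_le_1_iff divide_le_eq)
      have s2: "real n * s\<^sup>2 = ?l / 16"
        using elim by (simp add: s_def power_divide)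
      have sr: "s * ?r n = ?l / 4"
        using elim by (simp add: s_def root_nlog_def flip: real_sqrt_mult)
      have "false_alarm \<sigma>w (n * T n) (\<phi> n) \<le> real (T n) * exp (8 * real n * s\<^sup>2 - s * (10 * ?r n))"
        unfolding \<phi>_def by (rule false_alarm_energy_test[OF \<sigma>(2) s])
      also have "8 * real n * s\<^sup>2 - s * (10 * ?r n) = - ?l + (- ?l)"
        using s2 sr by simp
      also have "real (T n) * exp (- ?l + - ?l) = exp (- ?l)"
        using Tpos unfolding exp_add by (simp add: exp_minus)
      finally have fa: "false_alarm \<sigma>w (n * T n) (\<phi> n) \<le> exp (- ?l)" .
      have "missed_detection \<sigma>b \<sigma>w n (n * T n) (S n) (L n) (\<phi> n)
        \<le> low_energy_prob (S n) n (\<sigma>w\<^sup>2 * (40 * ?r n)) + exp (4 * real n * s\<^sup>2 + s * (10 * ?r n) - s * (40 * ?r n) / 2)"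
        unfolding \<phi>_def using elim
        by (intro missed_detection_energy_test[OF valid \<sigma> s _ _ L]) (auto simp: root_nlog_def)
      also have "exp (4 * real n * s\<^sup>2 + s * (10 * ?r n) - s * (40 * ?r n) / 2) \<le> exp (- ?l)"
        using s2 sr elim by simp
      finally show ?case using fa by (simp add: mult_ac)
    qed
  qed
  with ht show ?thesis by blast
qed

section \<open>Achievability\<close>

text \<open>
  A codebook takes the symbol period first and the message second, so that averages over
  codebooks factor over symbol periods.
\<close>

definition codebooks :: "nat \<Rightarrow> nat \<Rightarrow> (nat \<Rightarrow> nat \<Rightarrow> real) set" where
  "codebooks n M = {1..n} \<rightarrow>\<^sub>E ({1..2 ^ M} \<rightarrow>\<^sub>E {1, - 1})"

text \<open>
  The guard on \<open>l + i - 1\<close> keeps the decoder measurable for locations \<open>l\<close> outside the observed block.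
\<close>

definition correlation :: "nat \<Rightarrow> nat \<Rightarrow> (nat \<Rightarrow> real) \<Rightarrow> nat \<Rightarrow> (nat \<Rightarrow> real) \<Rightarrow> real" where
  "correlation n N c l y = (\<Sum>i=1..n. c i * (if l + i - 1 \<in> {1..N} then y (l + i - 1) else 0))"

text \<open>All codewords have equal energy, so the largest correlation is the maximum likelihood
  decision; \<open>LEAST\<close> only breaks ties. The codeword is restricted to
  \<open>{1..n}\<close> because points of \<open>samples n\<close> are extensional.\<close>

definition bpsk_scheme :: "real \<Rightarrow> nat \<Rightarrow> nat \<Rightarrow> nat \<Rightarrow> (nat \<Rightarrow> nat \<Rightarrow> real) coding_scheme" where
  "bpsk_scheme a n N M = \<lparr>
     msg_bits = M,
     key_space = uniform_count_measure (codebooks n M),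
     encode = (\<lambda>w k. \<lambda>i\<in>{1..n}. a * k i w),
     decode = (\<lambda>y k l. LEAST w. w \<in> {1..2 ^ M} \<and>
       (\<forall>v\<in>{1..2 ^ M}. correlation n N (\<lambda>i. a * k i v) l y \<le> correlation n N (\<lambda>i. a * k i w) l y))\<rparr>"

section \<open>Averages over the random codebook\<close>

lemma finite_signs: "finite ({1..m::nat} \<rightarrow>\<^sub>E {1, - 1 :: real})"
  by (intro finite_PiE) auto

lemma card_signs: "card ({1..m::nat} \<rightarrow>\<^sub>E {1, - 1 :: real}) = 2 ^ m"
  by (simp add: card_PiE numeral_2_eq_2)

lemma finite_codebooks: "finite (codebooks n M)"
  unfolding codebooks_def by (intro finite_PiE finite_signs) auto

lemma card_codebooks: "card (codebooks n M) = (2 ^ 2 ^ M) ^ n"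
  unfolding codebooks_def by (simp add: card_PiE card_signs del: power_mult)

lemma codebooks_nonempty: "codebooks n M \<noteq> {}"
  using card_codebooks[of n M] by (intro notI) simp

lemma codebook_sign: "k \<in> codebooks n M \<Longrightarrow> i \<in> {1..n} \<Longrightarrow> w \<in> {1..2 ^ M} \<Longrightarrow> k i w = 1 \<or> k i w = - 1"
  unfolding codebooks_def by (auto dest!: PiE_mem)

text \<open>Uniform choice from a product set is independent choice in each symbol period, so the
  mean of a product is the product of the means.\<close>

lemma sum_codebooks_prod:
  "(\<Sum>k\<in>codebooks n M. \<Prod>i=1..n. h i (k i)) / real (card (codebooks n M))
    = (\<Prod>i=1..n. (\<Sum>r\<in>{1..2 ^ M} \<rightarrow>\<^sub>E {1, - 1}. h i r) / 2 ^ 2 ^ M)" for h :: "nat \<Rightarrow> (nat \<Rightarrow> real) \<Rightarrow> real"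
proof -
  have "(\<Sum>k\<in>codebooks n M. \<Prod>i=1..n. h i (k i)) = (\<Prod>i=1..n. \<Sum>r\<in>{1..2 ^ M} \<rightarrow>\<^sub>E {1, - 1}. h i r)"
    unfolding codebooks_def by (rule prod_sum_PiE[symmetric]) (auto intro: finite_signs)
  then show ?thesis by (simp add: prod_dividef card_codebooks)
qed

text \<open>Each message in \<open>U\<close> contributes a factor \<open>1 + (- 1)\<close>.\<close>

lemma sum_signs_prod:
  fixes m :: nat
  assumes "U \<subseteq> {1..m}" "U \<noteq> {}"
  shows "(\<Sum>r\<in>{1..m} \<rightarrow>\<^sub>E {1, - 1 :: real}. \<Prod>u\<in>U. r u) = 0"
proof -
  have "(\<Sum>r\<in>{1..m} \<rightarrow>\<^sub>E {1, - 1 :: real}. \<Prod>u\<in>U. r u)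
      = (\<Sum>r\<in>{1..m} \<rightarrow>\<^sub>E {1, - 1 :: real}. \<Prod>u\<in>{1..m}. if u \<in> U then r u else 1)"
    using assms by (simp add: prod.If_cases Int_absorb1)
  also have "\<dots> = (\<Prod>u\<in>{1..m}. \<Sum>x\<in>{1, - 1 :: real}. if u \<in> U then x else 1)"
    by (rule prod_sum_PiE[symmetric]) auto
  also have "\<dots> = 0"
    using assms by (intro prod_zero) auto
  finally show ?thesis .
qed

lemma sum_signs_one:
  fixes m :: nat
  assumes "w \<in> {1..m}"
  shows "(\<Sum>r\<in>{1..m} \<rightarrow>\<^sub>E {1, - 1 :: real}. F (r w)) / 2 ^ m = (F 1 + F (- 1)) / (2::real)"
proof -
  \<comment> \<open>functions of a sign are affine, and products of distinct signs average to 0\<close>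
  have "F (r w) = (F 1 + F (- 1)) / 2 + (F 1 - F (- 1)) / 2 * (\<Prod>u\<in>{w}. r u)"
    if "r \<in> {1..m} \<rightarrow>\<^sub>E {1, - 1 :: real}" for r
    using PiE_mem[OF that assms] by (auto simp: field_simps)
  then have "(\<Sum>r\<in>{1..m} \<rightarrow>\<^sub>E {1, - 1 :: real}. F (r w))
     = (\<Sum>r\<in>{1..m} \<rightarrow>\<^sub>E {1, - 1 :: real}. (F 1 + F (- 1)) / 2 + (F 1 - F (- 1)) / 2 * (\<Prod>u\<in>{w}. r u))"
    by (rule sum.cong[OF refl])
  also have "\<dots> = 2 ^ m * ((F 1 + F (- 1)) / 2)"
    using sum_signs_prod[of "{w}" m] assms
    unfolding sum.distrib sum_distrib_left[symmetric] by (simp add: card_signs)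
  finally show ?thesis by simp
qed

text \<open>The squared difference is 0 for equal signs and \<open>4 * a\<^sup>2\<close> for
  opposite ones, hence a function of the product of the two signs, and that product has mean
  zero.\<close>

lemma sum_signs_two:
  fixes m :: nat
  assumes "w \<in> {1..m}" "v \<in> {1..m}" "v \<noteq> w"
  shows "(\<Sum>r\<in>{1..m} \<rightarrow>\<^sub>E {1, - 1 :: real}. exp (- (a * r v - a * r w)\<^sup>2 * b)) / 2 ^ m
    = (1 + exp (- 4 * a\<^sup>2 * b)) / (2::real)"
proof -
  let ?e = "exp (- 4 * a\<^sup>2 * b)"
  have "exp (- (a * r v - a * r w)\<^sup>2 * b) = (1 + ?e) / 2 + (1 - ?e) / 2 * (\<Prod>u\<in>{v, w}. r u)"
    if "r \<in> {1..m} \<rightarrow>\<^sub>E {1, - 1 :: real}" for r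
    using PiE_mem[OF that assms(1)] PiE_mem[OF that assms(2)] assms(3)
    by (auto simp: field_simps power2_eq_square)
  then have "(\<Sum>r\<in>{1..m} \<rightarrow>\<^sub>E {1, - 1 :: real}. exp (- (a * r v - a * r w)\<^sup>2 * b))
     = (\<Sum>r\<in>{1..m} \<rightarrow>\<^sub>E {1, - 1 :: real}. (1 + ?e) / 2 + (1 - ?e) / 2 * (\<Prod>u\<in>{v, w}. r u))"
    by (rule sum.cong[OF refl])
  also have "\<dots> = 2 ^ m * ((1 + ?e) / 2)"
    using sum_signs_prod[of "{v, w}" m] assms
    unfolding sum.distrib sum_distrib_left[symmetric] by (simp add: card_signs)
  finally show ?thesis by simp
qed

lemma sum_codebooks_pair:
  assumes "w \<in> {1..2 ^ M}" "v \<in> {1..2 ^ M}" "v \<noteq> w"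
  shows "(\<Sum>k\<in>codebooks n M. exp (- (\<Sum>i=1..n. (a * k i v - a * k i w)\<^sup>2) * b)) / real (card (codebooks n M))
    = ((1 + exp (- 4 * a\<^sup>2 * b)) / 2) ^ n"
proof -
  have eq: "exp (- (\<Sum>i=1..n. (a * k i v - a * k i w)\<^sup>2) * b) = (\<Prod>i=1..n. exp (- (a * k i v - a * k i w)\<^sup>2 * b))" for k
    by (simp add: sum_distrib_right sum_negf flip: exp_sum)
  show ?thesis
    unfolding eq sum_codebooks_prod[where h = "\<lambda>i r. exp (- (a * r v - a * r w)\<^sup>2 * b)"] sum_signs_two[OF assms]
    by simp
qed

lemma sum_codebooks_one:
  assumes "w \<in> {1..2 ^ M}"
  shows "(\<Sum>k\<in>codebooks n M. \<Prod>i=1..n. h i (k i w)) / real (card (codebooks n M))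
    = (\<Prod>i=1..n. (h i 1 + h i (- 1)) / (2::real))"
  using sum_codebooks_prod[where n = n and M = M and h = "\<lambda>i r. h i (r w)"] by (simp add: sum_signs_one[OF assms])

section \<open>Bob's error under correlation decoding\<close>

text \<open>For equal norms the signal lies half the squared distance \<open>D\<close> on the right
  side of the decision boundary. An error thus needs a Gaussian of variance
  \<open>\<sigma>\<^sup>2 * D\<close> to reach \<open>D / 2\<close>.\<close>

lemma pairwise_error:
  assumes \<sigma>: "\<sigma> > 0" and l: "1 \<le> l" "l + n - 1 \<le> N"
    and norm: "(\<Sum>i=1..n. (c i)\<^sup>2) = (\<Sum>i=1..n. (c' i)\<^sup>2)"
  shows "(\<integral>\<^sup>+z. indicator {y. correlation n N c l y \<le> correlation n N c' l y} (received n N l c z) \<partial>awgn \<sigma> N)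
    \<le> ennreal (exp (- (\<Sum>i=1..n. (c' i - c i)\<^sup>2) * (1 / (8 * \<sigma>\<^sup>2))))"
proof -
  define d where "d = (\<lambda>i. c' i - c i)"
  define D where "D = (\<Sum>i=1..n. (d i)\<^sup>2)"
  \<comment> \<open>The minimizer of the Chernoff exponent
    \<open>- s * D / 2 + \<sigma>\<^sup>2 * s\<^sup>2 * D / 2\<close>, with minimum
    \<open>- D / (8 * \<sigma>\<^sup>2)\<close>.\<close>
  define s where "s = 1 / (2 * \<sigma>\<^sup>2)"
  have corr: "correlation n N c'' l (received n N l c z) = (\<Sum>i=1..n. c'' i * (z (l + i - 1) + c i))" for c'' z
    unfolding correlation_def using l by (intro sum.cong) (auto simp: received_eq placed_def)
  have cross: "(\<Sum>i=1..n. d i * c i) = - D / 2"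
  proof -
    have "D = (\<Sum>i=1..n. (c' i)\<^sup>2) - (\<Sum>i=1..n. (c i)\<^sup>2) - 2 * (\<Sum>i=1..n. d i * c i)"
      by (simp add: D_def d_def sum_distrib_left power2_eq_square algebra_simps flip: sum_subtractf sum.distrib)
    then show ?thesis using norm by simp
  qed
  have "indicator {y. correlation n N c l y \<le> correlation n N c' l y} (received n N l c z)
     \<le> ennreal (exp (- s * D / 2)) * ennreal (exp (\<Sum>j\<in>{1..N}. s * placed n l d j * z j))" for z
  proof (cases "correlation n N c l (received n N l c z) \<le> correlation n N c' l (received n N l c z)")
    case True
    then have "0 \<le> (\<Sum>i=1..n. d i * (z (l + i - 1) + c i))"
      by (simp only: corr d_def left_diff_distrib sum_subtractf diff_ge_0_iff_ge)
    then have "0 \<le> (\<Sum>i=1..n. d i * z (l + i - 1)) + (\<Sum>i=1..n. d i * c i)"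
      by (simp only: distrib_left sum.distrib)
    then have "0 \<le> s * ((\<Sum>i=1..n. d i * z (l + i - 1)) - D / 2)"
      unfolding cross s_def by simp
    also have "\<dots> = - s * D / 2 + (\<Sum>j\<in>{1..N}. s * placed n l d j * z j)"
      using sum_placed[OF l, of "\<lambda>j x. s * x * z j" d] by (simp add: sum_distrib_left algebra_simps)
    finally have "1 \<le> exp (- s * D / 2) * exp (\<Sum>j\<in>{1..N}. s * placed n l d j * z j)"
      by (simp add: mult_exp_exp)
    then show ?thesis using True by (simp flip: ennreal_mult)
  qed simp
  then have "(\<integral>\<^sup>+z. indicator {y. correlation n N c l y \<le> correlation n N c' l y} (received n N l c z) \<partial>awgn \<sigma> N)
     \<le> (\<integral>\<^sup>+z. ennreal (exp (- s * D / 2)) * ennreal (exp (\<Sum>j\<in>{1..N}. s * placed n l d j * z j)) \<partial>awgn \<sigma> N)"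
    by (intro nn_integral_mono)
  also have "\<dots> = ennreal (exp (- s * D / 2)) * (\<integral>\<^sup>+z. ennreal (exp (\<Sum>j\<in>{1..N}. s * placed n l d j * z j)) \<partial>awgn \<sigma> N)"
  proof (rule nn_integral_cmult)
    have "(\<lambda>z. ennreal (exp (\<Sum>j\<in>{1..N}. s * placed n l d j * z j))) \<in> borel_measurable (samples N)"
      by measurable
    then show "(\<lambda>z. ennreal (exp (\<Sum>j\<in>{1..N}. s * placed n l d j * z j))) \<in> borel_measurable (awgn \<sigma> N)"
      by (simp only: measurable_cong_sets[OF sets_awgn refl])
  qed
  also have "(\<integral>\<^sup>+z. ennreal (exp (\<Sum>j\<in>{1..N}. s * placed n l d j * z j)) \<partial>awgn \<sigma> N)
     = ennreal (\<Prod>j\<in>{1..N}. exp (\<sigma>\<^sup>2 * (s * placed n l d j)\<^sup>2 / 2))"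
    by (rule nn_integral_awgn_exp_sum[OF \<sigma> _ gaussian_mgf[OF \<sigma>]]) auto
  also have "(\<Prod>j\<in>{1..N}. exp (\<sigma>\<^sup>2 * (s * placed n l d j)\<^sup>2 / 2)) = exp (\<sigma>\<^sup>2 * s\<^sup>2 * D / 2)"
    using sum_placed[OF l, of "\<lambda>j x. \<sigma>\<^sup>2 * (s * x)\<^sup>2 / 2" d]
    by (simp add: D_def power_mult_distrib sum_distrib_left sum_divide_distrib mult_ac flip: exp_sum)
  also have "ennreal (exp (- s * D / 2)) * ennreal (exp (\<sigma>\<^sup>2 * s\<^sup>2 * D / 2)) = ennreal (exp (- D * (1 / (8 * \<sigma>\<^sup>2))))"
    using \<sigma> by (simp add: mult_exp_exp s_def power2_eq_square field_simps flip: ennreal_mult)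
  finally show ?thesis by (simp add: D_def d_def)
qed

lemma nn_integral_codebooks:
  "(\<integral>\<^sup>+k. F k \<partial>uniform_count_measure (codebooks n M)) = (\<Sum>k\<in>codebooks n M. ennreal (1 / real (card (codebooks n M))) * F k)"
  by (simp add: uniform_count_measure_def nn_integral_point_measure_finite finite_codebooks)

lemma nn_integral_slot_location:
  assumes "T \<ge> 1"
  shows "(\<integral>\<^sup>+l. F l \<partial>slot_location n T) = (\<Sum>t\<in>{1..T}. ennreal (1 / real T) * F ((t - 1) * n + 1))"
proof -
  have "(\<integral>\<^sup>+l. F l \<partial>slot_location n T) = (\<Sum>t\<in>{1..T}. F ((t - 1) * n + 1)) / of_nat T"
    using assms unfolding slot_location_def by (simp add: nn_integral_pmf_of_set)
  also have "\<dots> = (\<Sum>t\<in>{1..T}. F ((t - 1) * n + 1)) * inverse (ennreal (real T))"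
    by (simp only: divide_ennreal_def ennreal_of_nat_eq_real_of_nat)
  also have "inverse (ennreal (real T)) = ennreal (1 / real T)"
    using assms by (simp only: inverse_ennreal inverse_eq_divide)
  finally show ?thesis by (simp only: mult.commute sum_distrib_left)
qed

lemma slot_location_bounds:
  assumes "(t::nat) \<in> {1..T}" "n \<ge> 1"
  shows "1 \<le> (t - 1) * n + 1" "(t - 1) * n + 1 + n - 1 \<le> n * T"
proof -
  have "t = Suc (t - 1)" using assms by simp
  then have "(t - 1) * n + n = t * n" by (metis add.commute mult_Suc)
  also have "\<dots> \<le> T * n" using assms by (intro mult_right_mono) auto
  finally show "(t - 1) * n + 1 + n - 1 \<le> n * T" by (simp add: mult.commute)
qed simp

lemma bpsk_energy:
  assumes "k \<in> codebooks n M" "w \<in> {1..2 ^ M}"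
  shows "(\<Sum>i=1..n. (a * k i w)\<^sup>2) = real n * a\<^sup>2"
proof -
  have "(a * k i w)\<^sup>2 = a\<^sup>2" if "i \<in> {1..n}" for i
    using codebook_sign[OF assms(1) that assms(2)] by (auto simp: power_mult_distrib)
  then show ?thesis by simp
qed

lemma measurable_correlation [measurable]: "correlation n N c l \<in> borel_measurable (samples N)"
proof -
  have "(\<lambda>y. if j \<in> {1..N} then y j else 0 :: real) \<in> borel_measurable (samples N)" for j
    by (cases "j \<in> {1..N}") (auto intro: measurable_sample)
  then show ?thesis
    unfolding correlation_def by (intro borel_measurable_sum borel_measurable_times) auto
qed

text \<open>Messages, codebooks and locations are countable, so measurability is checked with all of
  them fixed. The energy is the same for every codeword, which turns the mean power into a
  constant.\<close>

lemma valid_bpsk_scheme: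
  assumes "n \<ge> 1" "a\<^sup>2 \<le> P"
  shows "valid_scheme n N P (bpsk_scheme a n N M)"
proof -
  let ?S = "bpsk_scheme a n N M"
  let ?K = "uniform_count_measure (codebooks n M)"
  let ?MK = "message_space M \<Otimes>\<^sub>M ?K"
  have K: "prob_space ?K"
    by (rule prob_space_uniform_count_measure[OF finite_codebooks codebooks_nonempty])
  interpret MK: prob_space ?MK by (intro prob_space_pair prob_space_message_space K)
  have id_msg: "(\<lambda>w. w) \<in> measurable (message_space M) (count_space {1..2 ^ M})"
    by (simp add: measurable_cong_sets[OF sets_message_space refl])
  have id_key: "(\<lambda>k. k) \<in> measurable ?K (count_space (codebooks n M))"
    by (simp add: measurable_cong_sets[OF sets_uniform_count_measure_count_space refl])
  have enc: "(\<lambda>(w, k). encode ?S w k) \<in> measurable ?MK (samples n)"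
  proof -
    have c: "(\<lambda>x. \<lambda>i\<in>{1..n}. a * k i w) \<in> measurable ?MK (samples n)" for w k
      by (rule measurable_const) (simp add: space_samples)
    have "(\<lambda>x. \<lambda>i\<in>{1..n}. a * k i (fst x)) \<in> measurable ?MK (samples n)" for k
      by (rule measurable_compose_countable'[OF c measurable_compose[OF measurable_fst id_msg]]) auto
    then have "(\<lambda>x. \<lambda>i\<in>{1..n}. a * snd x i (fst x)) \<in> measurable ?MK (samples n)"
      by (rule measurable_compose_countable'[OF _ measurable_compose[OF measurable_snd id_key]])
        (simp_all add: finite_codebooks countable_finite)
    then show ?thesis by (simp add: bpsk_scheme_def case_prod_beta')
  qed
  have dec: "(\<lambda>(y, k, l). decode ?S y k l) \<in> measurable (samples N \<Otimes>\<^sub>M (?K \<Otimes>\<^sub>M count_space UNIV)) (count_space UNIV)"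
  proof -
    let ?D = "samples N \<Otimes>\<^sub>M (?K \<Otimes>\<^sub>M count_space UNIV)"
    have 1: "(\<lambda>x. decode ?S (fst x) k l) \<in> measurable ?D (count_space UNIV)" for k l
      unfolding bpsk_scheme_def by simp measurable
    have "(\<lambda>x. decode ?S (fst x) k (snd (snd x))) \<in> measurable ?D (count_space UNIV)" for k
      by (rule measurable_compose_countable[OF 1]) measurable
    then have "(\<lambda>x. decode ?S (fst x) (fst (snd x)) (snd (snd x))) \<in> measurable ?D (count_space UNIV)"
      by (rule measurable_compose_countable'[OF _ measurable_compose[OF measurable_compose[OF measurable_snd measurable_fst] id_key]])
        (simp_all add: finite_codebooks countable_finite)
    then show ?thesis by (simp add: case_prod_beta')
  qed
  have en: "(case x of (w, k) \<Rightarrow> \<Sum>i = 1..n. (encode ?S w k i)\<^sup>2) = real n * a\<^sup>2" if "x \<in> space ?MK" for x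
    using that bpsk_energy[of "snd x" n M "fst x" a]
    by (auto simp: bpsk_scheme_def space_pair_measure space_message_space space_uniform_count_measure)
  have int: "integrable ?MK (\<lambda>(w, k). \<Sum>i = 1..n. (encode ?S w k i)\<^sup>2)"
    by (subst Bochner_Integration.integrable_cong[OF refl en]) auto
  have "(\<integral>(w, k). (\<Sum>i = 1..n. (encode ?S w k i)\<^sup>2) \<partial>?MK) = (\<integral>x. real n * a\<^sup>2 \<partial>?MK)"
    by (rule Bochner_Integration.integral_cong[OF refl en])
  then have "1 / real n * (\<integral>(w, k). (\<Sum>i = 1..n. (encode ?S w k i)\<^sup>2) \<partial>?MK) \<le> P"
    using assms MK.prob_space by simp
  moreover have "msg_bits ?S = M" "key_space ?S = ?K" by (simp_all add: bpsk_scheme_def)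
  ultimately show ?thesis
    unfolding valid_scheme_def using K enc dec int by simp
qed

lemma nn_integral_source_bpsk:
  assumes "valid_scheme n N P (bpsk_scheme a n N M)" "T \<ge> 1"
    and "F \<in> borel_measurable (source_space (bpsk_scheme a n N M) (slot_location n T))"
  shows "(\<integral>\<^sup>+u. F u \<partial>source_space (bpsk_scheme a n N M) (slot_location n T))
    = (\<Sum>w\<in>{1..2 ^ M}. ennreal (1 / 2 ^ M) * (\<Sum>k\<in>codebooks n M. ennreal (1 / real (card (codebooks n M))) *
        (\<Sum>t\<in>{1..T}. ennreal (1 / real T) * F (w, k, (t - 1) * n + 1))))"
proof -
  have "msg_bits (bpsk_scheme a n N M) = M" "key_space (bpsk_scheme a n N M) = uniform_count_measure (codebooks n M)"
    by (simp_all add: bpsk_scheme_def)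
  then show ?thesis
    unfolding nn_integral_source[OF assms(1,3)]
    by (simp only: nn_integral_message_space nn_integral_codebooks nn_integral_slot_location[OF assms(2)])
qed

lemma sum_ennreal_cmult:
  assumes "c \<ge> 0" "\<And>i. i \<in> A \<Longrightarrow> f i \<ge> 0"
  shows "(\<Sum>i\<in>A. ennreal c * ennreal (f i)) = ennreal (\<Sum>i\<in>A. c * f i)"
proof -
  have "(\<Sum>i\<in>A. ennreal c * ennreal (f i)) = (\<Sum>i\<in>A. ennreal (c * f i))"
    using assms by (intro sum.cong refl ennreal_mult[symmetric])
  also have "\<dots> = ennreal (\<Sum>i\<in>A. c * f i)"
    using assms by (intro sum_ennreal mult_nonneg_nonneg)
  finally show ?thesis .
qed

lemma weighted_sum_le:
  assumes "finite A" "A \<noteq> {}" "\<And>t. t \<in> A \<Longrightarrow> F t \<le> (X::ennreal)"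
  shows "(\<Sum>t\<in>A. ennreal (1 / real (card A)) * F t) \<le> X"
proof -
  have c: "card A > 0" using assms by (simp add: card_gt_0_iff)
  have "(\<Sum>t\<in>A. ennreal (1 / real (card A)) * F t) \<le> (\<Sum>t\<in>A. ennreal (1 / real (card A)) * X)"
    using assms by (intro sum_mono mult_left_mono) auto
  also have "\<dots> = (ennreal (real (card A)) * ennreal (1 / real (card A))) * X"
    by (simp add: ennreal_of_nat_eq_real_of_nat mult.assoc)
  also have "ennreal (real (card A)) * ennreal (1 / real (card A)) = 1"
    using c by (simp flip: ennreal_mult)
  finally show ?thesis by simp
qed

lemma placed_restrict: "placed n l (\<lambda>i\<in>{1..n}. f i) = placed n l f"
  by (auto simp: placed_def fun_eq_iff)

lemma received_restrict: "received n N l (\<lambda>i\<in>{1..n}. f i) z = received n N l f z"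
  by (simp add: received_eq placed_restrict)

text \<open>A maximizer exists among finitely many messages and the decoder returns one, so a wrong
  output beats or ties with the true message.\<close>

lemma bpsk_decode_error:
  assumes w: "w \<in> {1..2 ^ M}" and ne: "decode (bpsk_scheme a n N M) y k l \<noteq> w"
  shows "\<exists>v\<in>{1..2 ^ M} - {w}. correlation n N (\<lambda>i. a * k i w) l y \<le> correlation n N (\<lambda>i. a * k i v) l y"
proof -
  let ?c = "\<lambda>v. correlation n N (\<lambda>i. a * k i v) l y"
  let ?P = "\<lambda>w. w \<in> {1..2 ^ M} \<and> (\<forall>v\<in>{1..2 ^ M}. ?c v \<le> ?c w)"
  have "finite (?c ` {1..2 ^ M})" "?c ` {1..2 ^ M} \<noteq> {}" using w by auto
  then have "Max (?c ` {1..2 ^ M}) \<in> ?c ` {1..2 ^ M}" by (rule Max_in)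
  then obtain x where x: "x \<in> {1..2 ^ M}" "?c x = Max (?c ` {1..2 ^ M})" by force
  then have Px: "?P x" by simp
  define d where "d = decode (bpsk_scheme a n N M) y k l"
  then have d: "d = (LEAST w. ?P w)" by (simp add: bpsk_scheme_def)
  have "?P d" unfolding d using Px by (rule LeastI)
  then show ?thesis using w ne d_def by (intro bexI[of _ d]) auto
qed

lemma bpsk_conditional_error:
  assumes \<sigma>: "\<sigma> > 0" and k: "k \<in> codebooks n M" and w: "w \<in> {1..2 ^ M}"
    and l: "1 \<le> l" "l + n - 1 \<le> N"
  shows "(\<integral>\<^sup>+z. indicator {z. decode (bpsk_scheme a n N M) (received n N l (encode (bpsk_scheme a n N M) w k) z) k l \<noteq> w} z \<partial>awgn \<sigma> N)
    \<le> ennreal (\<Sum>v\<in>{1..2 ^ M} - {w}. exp (- (\<Sum>i=1..n. (a * k i v - a * k i w)\<^sup>2) * (1 / (8 * \<sigma>\<^sup>2))))"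
proof -
  let ?c = "\<lambda>v i. a * k i v"
  let ?A = "\<lambda>v. {y. correlation n N (?c w) l y \<le> correlation n N (?c v) l y}"
  have enc: "received n N l (encode (bpsk_scheme a n N M) w k) z = received n N l (?c w) z" for z
    by (simp add: bpsk_scheme_def received_restrict)
  have m: "(\<lambda>z. indicator (?A v) (received n N l (?c w) z) :: ennreal) \<in> borel_measurable (awgn \<sigma> N)" for v
  proof -
    have "(\<lambda>y. if correlation n N (?c w) l y \<le> correlation n N (?c v) l y then 1 else 0 :: ennreal) \<in> borel_measurable (samples N)"
      by measurable
    from measurable_compose[OF measurable_shift this]
    show ?thesis
      by (simp add: received_eq indicator_def of_bool_def measurable_cong_sets[OF sets_awgn refl])
  qed
  have "(\<integral>\<^sup>+z. indicator {z. decode (bpsk_scheme a n N M) (received n N l (encode (bpsk_scheme a n N M) w k) z) k l \<noteq> w} z \<partial>awgn \<sigma> N)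
    \<le> (\<integral>\<^sup>+z. (\<Sum>v\<in>{1..2 ^ M} - {w}. indicator (?A v) (received n N l (?c w) z)) \<partial>awgn \<sigma> N)"
  proof (rule nn_integral_mono)
    fix z :: "nat \<Rightarrow> real"
    let ?y = "received n N l (?c w) z"
    show "indicator {z. decode (bpsk_scheme a n N M) (received n N l (encode (bpsk_scheme a n N M) w k) z) k l \<noteq> w} z
      \<le> (\<Sum>v\<in>{1..2 ^ M} - {w}. indicator (?A v) ?y :: ennreal)"
    proof (cases "decode (bpsk_scheme a n N M) ?y k l \<noteq> w")
      case True
      from bpsk_decode_error[OF w True] obtain v where v: "v \<in> {1..2 ^ M} - {w}"
        and le: "correlation n N (?c w) l ?y \<le> correlation n N (?c v) l ?y" by (rule bexE)
      from le have "(1::ennreal) \<le> (\<Sum>v\<in>{v}. indicator (?A v) ?y)" by simp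
      also have "\<dots> \<le> (\<Sum>v\<in>{1..2 ^ M} - {w}. indicator (?A v) ?y)"
        using v by (intro sum_mono2) auto
      finally show ?thesis using True by (simp add: enc)
    qed (simp add: enc)
  qed
  also have "\<dots> = (\<Sum>v\<in>{1..2 ^ M} - {w}. \<integral>\<^sup>+z. indicator (?A v) (received n N l (?c w) z) \<partial>awgn \<sigma> N)"
    using m by (intro nn_integral_sum)
  also have "\<dots> \<le> (\<Sum>v\<in>{1..2 ^ M} - {w}. ennreal (exp (- (\<Sum>i=1..n. (a * k i v - a * k i w)\<^sup>2) * (1 / (8 * \<sigma>\<^sup>2)))))"
    using w k by (intro sum_mono pairwise_error[OF \<sigma> l]) (auto simp: bpsk_energy)
  also have "\<dots> = ennreal (\<Sum>v\<in>{1..2 ^ M} - {w}. exp (- (\<Sum>i=1..n. (a * k i v - a * k i w)\<^sup>2) * (1 / (8 * \<sigma>\<^sup>2))))"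
    by (rule sum_ennreal) simp
  finally show ?thesis .
qed

text \<open>The codebook is the key, so \<open>bob_error\<close> already averages over it and no
  good codebook has to be singled out. Exchanging this average with the union bound gives the same
  value for each competing message; the exponent is
  \<open>4 * a\<^sup>2 / (8 * \<sigma>b\<^sup>2)\<close>.\<close>

lemma bob_error_bpsk_le:
  assumes \<sigma>: "\<sigma>b > 0" "\<sigma>w > 0" and n: "n \<ge> 1" and T: "T \<ge> 1" and P: "a\<^sup>2 \<le> P"
  shows "bob_error \<sigma>b \<sigma>w n (n * T) (bpsk_scheme a n (n * T) M) (slot_location n T)
    \<le> 2 ^ M * ((1 + exp (- a\<^sup>2 / (2 * \<sigma>b\<^sup>2))) / 2) ^ n"
proof -
  let ?S = "bpsk_scheme a n (n * T) M"
  let ?CB = "codebooks n M"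
  let ?q = "(1 + exp (- 4 * a\<^sup>2 * (1 / (8 * \<sigma>b\<^sup>2)))) / 2"
  let ?e = "\<lambda>k w v. exp (- (\<Sum>i=1..n. (a * k i v - a * k i w)\<^sup>2) * (1 / (8 * \<sigma>b\<^sup>2)))"
  have valid: "valid_scheme n (n * T) P ?S" by (rule valid_bpsk_scheme[OF n P])
  define F where "F = (\<lambda>(w, k, l). \<integral>\<^sup>+z. indicator {z. decode ?S (received n (n * T) l (encode ?S w k) z) k l \<noteq> w} z \<partial>awgn \<sigma>b (n * T))"
  have F_m: "F \<in> borel_measurable (source_space ?S (slot_location n T))"
    unfolding F_def by (rule bob_error_eq(2)[OF valid \<sigma>])
  have "ennreal (bob_error \<sigma>b \<sigma>w n (n * T) ?S (slot_location n T))
     = (\<integral>\<^sup>+u. F u \<partial>source_space ?S (slot_location n T))"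
    unfolding F_def by (rule bob_error_eq(1)[OF valid \<sigma>])
  also have "\<dots> = (\<Sum>w\<in>{1..2 ^ M}. ennreal (1 / 2 ^ M) * (\<Sum>k\<in>?CB. ennreal (1 / real (card ?CB)) *
        (\<Sum>t\<in>{1..T}. ennreal (1 / real T) * F (w, k, (t - 1) * n + 1))))"
    by (rule nn_integral_source_bpsk[OF valid T F_m])
  also have "\<dots> \<le> ennreal (2 ^ M * ?q ^ n)"
  proof -
    have t: "(\<Sum>t\<in>{1..T}. ennreal (1 / real T) * F (w, k, (t - 1) * n + 1)) \<le> ennreal (\<Sum>v\<in>{1..2 ^ M} - {w}. ?e k w v)"
      if "w \<in> {1..2 ^ M}" "k \<in> ?CB" for w k
    proof -
      have "F (w, k, (t - 1) * n + 1) \<le> ennreal (\<Sum>v\<in>{1..2 ^ M} - {w}. ?e k w v)" if t: "t \<in> {1..T}" for t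
        unfolding F_def prod.case
        by (rule bpsk_conditional_error[OF \<sigma>(1) \<open>k \<in> ?CB\<close> \<open>w \<in> _\<close> slot_location_bounds[OF t n]])
      then show ?thesis using weighted_sum_le[of "{1..T}"] T by simp
    qed
    have k: "(\<Sum>k\<in>?CB. ennreal (1 / real (card ?CB)) * (\<Sum>t\<in>{1..T}. ennreal (1 / real T) * F (w, k, (t - 1) * n + 1)))
       \<le> ennreal (2 ^ M * ?q ^ n)" if w: "w \<in> {1..2 ^ M}" for w
    proof -
      have "(\<Sum>k\<in>?CB. ennreal (1 / real (card ?CB)) * (\<Sum>t\<in>{1..T}. ennreal (1 / real T) * F (w, k, (t - 1) * n + 1)))
        \<le> (\<Sum>k\<in>?CB. ennreal (1 / real (card ?CB)) * ennreal (\<Sum>v\<in>{1..2 ^ M} - {w}. ?e k w v))"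
        using t[OF w] by (intro sum_mono mult_left_mono) auto
      also have "\<dots> = ennreal (\<Sum>k\<in>?CB. 1 / real (card ?CB) * (\<Sum>v\<in>{1..2 ^ M} - {w}. ?e k w v))"
        by (intro sum_ennreal_cmult sum_nonneg) auto
      also have "(\<Sum>k\<in>?CB. 1 / real (card ?CB) * (\<Sum>v\<in>{1..2 ^ M} - {w}. ?e k w v))
          = (\<Sum>k\<in>?CB. \<Sum>v\<in>{1..2 ^ M} - {w}. ?e k w v / real (card ?CB))"
        by (simp add: sum_divide_distrib)
      also have "\<dots> = (\<Sum>v\<in>{1..2 ^ M} - {w}. \<Sum>k\<in>?CB. ?e k w v / real (card ?CB))"
        by (rule sum.swap)
      also have "\<dots> = (\<Sum>v\<in>{1..2 ^ M} - {w}. (\<Sum>k\<in>?CB. ?e k w v) / real (card ?CB))"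
        by (simp add: sum_divide_distrib)
      also have "\<dots> = (\<Sum>v\<in>{1..2 ^ M} - {w}. ?q ^ n)"
        using w by (intro sum.cong refl sum_codebooks_pair) auto
      also have "\<dots> \<le> (\<Sum>v\<in>{1..2 ^ M::nat}. ?q ^ n)"
        by (intro sum_mono2) (auto intro!: add_nonneg_nonneg)
      also have "\<dots> = 2 ^ M * ?q ^ n" by simp
      finally show ?thesis by (simp add: ennreal_leI)
    qed
    show ?thesis using weighted_sum_le[of "{1..2 ^ M::nat}", OF _ _ k] by simp
  qed
  also have "?q = (1 + exp (- a\<^sup>2 / (2 * \<sigma>b\<^sup>2))) / 2" by simp
  finally show ?thesis
    by (subst (asm) ennreal_le_iff) (auto intro!: mult_nonneg_nonneg add_nonneg_nonneg)
qed

text \<open>The \<open>\<chi>\<^sup>2\<close> bound on total variation, with \<open>\<bar>u\<bar> \<le> \<delta> + u\<^sup>2 / \<delta>\<close> in place of Cauchy--Schwarz.\<close>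

lemma sum_of_errors_ge:
  fixes f \<phi> :: "'a \<Rightarrow> real"
  assumes "prob_space M" and [measurable]: "f \<in> borel_measurable M" "\<phi> \<in> borel_measurable M"
    and f: "\<And>y. 0 \<le> f y" and \<phi>: "\<And>y. y \<in> space M \<Longrightarrow> 0 \<le> \<phi> y \<and> \<phi> y \<le> 1"
    and int1: "(\<integral>\<^sup>+y. ennreal (f y) \<partial>M) = 1" and int2: "(\<integral>\<^sup>+y. ennreal ((f y)\<^sup>2) \<partial>M) = ennreal (1 + x)"
    and x: "x \<ge> 0" and \<delta>: "\<delta> > 0"
  shows "1 \<le> (\<integral>\<^sup>+y. ennreal (\<phi> y) \<partial>M) + (\<integral>\<^sup>+y. ennreal (f y) * ennreal (1 - \<phi> y) \<partial>M) + ennreal (\<delta> + x / \<delta>)"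
proof -
  interpret prob_space M by fact
  \<comment> \<open>Subtraction is awkward for extended nonnegative integrals, so the variance
    identity is proved after adding 2 to both sides, which is cancelled at the end.\<close>
  have "(\<integral>\<^sup>+y. ennreal ((f y - 1)\<^sup>2) \<partial>M) + 2 = (\<integral>\<^sup>+y. ennreal ((f y - 1)\<^sup>2) \<partial>M) + 2 * (\<integral>\<^sup>+y. ennreal (f y) \<partial>M)"
    by (simp add: int1)
  also have "\<dots> = (\<integral>\<^sup>+y. ennreal ((f y - 1)\<^sup>2) + 2 * ennreal (f y) \<partial>M)"
    by (simp add: nn_integral_add nn_integral_cmult)
  also have "\<dots> = (\<integral>\<^sup>+y. ennreal ((f y)\<^sup>2) + 1 \<partial>M)"
  proof (rule nn_integral_cong)
    fix y
    have "ennreal ((f y - 1)\<^sup>2) + 2 * ennreal (f y) = ennreal ((f y - 1)\<^sup>2 + 2 * f y)"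
      using f[of y] by (simp add: ennreal_mult)
    also have "(f y - 1)\<^sup>2 + 2 * f y = (f y)\<^sup>2 + 1" by (simp add: power2_eq_square algebra_simps)
    finally show "ennreal ((f y - 1)\<^sup>2) + 2 * ennreal (f y) = ennreal ((f y)\<^sup>2) + 1" by simp
  qed
  also have "\<dots> = ennreal (1 + x) + 1" by (simp add: nn_integral_add int2 emeasure_space_1)
  also have "\<dots> = ennreal x + 2" using x by (simp add: ennreal_plus[symmetric] del: ennreal_plus flip: ennreal_1 ennreal_numeral)
  finally have var: "(\<integral>\<^sup>+y. ennreal ((f y - 1)\<^sup>2) \<partial>M) = ennreal x"
    by (simp add: add.commute[of _ 2] ennreal_add_left_cancel)
  have "1 = (\<integral>\<^sup>+y. 1 \<partial>M)" by (simp add: emeasure_space_1)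
  also have "\<dots> \<le> (\<integral>\<^sup>+y. (ennreal (\<phi> y) + ennreal (f y) * ennreal (1 - \<phi> y)) + (ennreal \<delta> + ennreal (1 / \<delta>) * ennreal ((f y - 1)\<^sup>2)) \<partial>M)"
  proof (rule nn_integral_mono)
    fix y assume y: "y \<in> space M"
    have "\<bar>f y - 1\<bar> \<le> \<delta> + 1 / \<delta> * (f y - 1)\<^sup>2"
    proof (cases "\<bar>f y - 1\<bar> \<le> \<delta>")
      case True
      have "0 \<le> 1 / \<delta> * (f y - 1)\<^sup>2" using \<delta> by simp
      then show ?thesis using True by linarith
    next
      case False
      then have "\<delta> * \<bar>f y - 1\<bar> \<le> \<bar>f y - 1\<bar> * \<bar>f y - 1\<bar>" by (intro mult_right_mono) auto
      then have "\<bar>f y - 1\<bar> \<le> 1 / \<delta> * (f y - 1)\<^sup>2" using \<delta> by (simp add: field_simps power2_eq_square)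
      then show ?thesis using \<delta> by linarith
    qed
    \<comment> \<open>This bounds the last term of
      \<open>1 = \<phi> + f * (1 - \<phi>) + (1 - f) * (1 - \<phi>)\<close>.\<close>
    moreover have "(1 - f y) * (1 - \<phi> y) \<le> \<bar>f y - 1\<bar> * 1"
      using \<phi>[OF y] by (intro mult_mono) auto
    ultimately have "1 \<le> (\<phi> y + f y * (1 - \<phi> y)) + (\<delta> + 1 / \<delta> * (f y - 1)\<^sup>2)"
      by (simp add: algebra_simps)
    then have "ennreal 1 \<le> ennreal ((\<phi> y + f y * (1 - \<phi> y)) + (\<delta> + 1 / \<delta> * (f y - 1)\<^sup>2))"
      by (rule ennreal_leI)
    also have "\<dots> = (ennreal (\<phi> y) + ennreal (f y) * ennreal (1 - \<phi> y)) + (ennreal \<delta> + ennreal (1 / \<delta>) * ennreal ((f y - 1)\<^sup>2))"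
      using \<phi>[OF y] f[of y] \<delta> by (simp only: ennreal_plus ennreal_mult mult_nonneg_nonneg add_nonneg_nonneg
          diff_ge_0_iff_ge zero_le_power2 divide_nonneg_nonneg zero_le_one less_imp_le)
    finally show "1 \<le> (ennreal (\<phi> y) + ennreal (f y) * ennreal (1 - \<phi> y)) + (ennreal \<delta> + ennreal (1 / \<delta>) * ennreal ((f y - 1)\<^sup>2))"
      by simp
  qed
  also have "\<dots> = (\<integral>\<^sup>+y. ennreal (\<phi> y) \<partial>M) + (\<integral>\<^sup>+y. ennreal (f y) * ennreal (1 - \<phi> y) \<partial>M) + (ennreal \<delta> + ennreal (1 / \<delta>) * ennreal x)"
    by (simp add: nn_integral_add nn_integral_cmult var emeasure_space_1)
  also have "ennreal \<delta> + ennreal (1 / \<delta>) * ennreal x = ennreal (\<delta> + x / \<delta>)"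
    using \<delta> x by (simp flip: ennreal_mult ennreal_plus)
  finally show ?thesis .
qed

section \<open>Willie's likelihood ratio and its second moment\<close>

text \<open>The likelihood ratio of one observed symbol when \<open>a\<close> and \<open>- a\<close>
  are sent with equal probability.\<close>

definition symbol_ratio :: "real \<Rightarrow> real \<Rightarrow> real \<Rightarrow> real" where
  "symbol_ratio \<sigma> a y = (exp (a * y / \<sigma>\<^sup>2 - a\<^sup>2 / (2 * \<sigma>\<^sup>2)) + exp (- a * y / \<sigma>\<^sup>2 - a\<^sup>2 / (2 * \<sigma>\<^sup>2))) / 2"

definition slot :: "nat \<Rightarrow> nat \<Rightarrow> nat set" where
  "slot n t = {(t - 1) * n + 1..<(t - 1) * n + 1 + n}"

text \<open>The product runs over all periods, with factor 1 off the slot, to fit the integration of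
  products over the full noise vector.\<close>

definition slot_ratio :: "real \<Rightarrow> real \<Rightarrow> nat \<Rightarrow> nat \<Rightarrow> nat \<Rightarrow> (nat \<Rightarrow> real) \<Rightarrow> real" where
  "slot_ratio \<sigma> a n N t y = (\<Prod>j\<in>{1..N}. if j \<in> slot n t then symbol_ratio \<sigma> a (y j) else 1)"

definition mixture_ratio :: "real \<Rightarrow> real \<Rightarrow> nat \<Rightarrow> nat \<Rightarrow> (nat \<Rightarrow> real) \<Rightarrow> real" where
  "mixture_ratio \<sigma> a n T y = (\<Sum>t\<in>{1..T}. 1 / real T * slot_ratio \<sigma> a n (n * T) t y)"

lemma symbol_ratio_nonneg: "0 \<le> symbol_ratio \<sigma> a y"
  by (simp add: symbol_ratio_def add_nonneg_nonneg)

lemma measurable_symbol_ratio [measurable]: "symbol_ratio \<sigma> a \<in> borel_measurable borel"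
  unfolding symbol_ratio_def by measurable

lemma slot_ratio_nonneg: "0 \<le> slot_ratio \<sigma> a n N t y"
  unfolding slot_ratio_def by (intro prod_nonneg) (auto simp: symbol_ratio_nonneg)

lemma mixture_ratio_nonneg: "0 \<le> mixture_ratio \<sigma> a n T y"
  unfolding mixture_ratio_def by (intro sum_nonneg mult_nonneg_nonneg slot_ratio_nonneg) auto

lemma measurable_slot_ratio [measurable]: "slot_ratio \<sigma> a n N t \<in> borel_measurable (samples N)"
proof -
  have "(\<lambda>y. if j \<in> slot n t then symbol_ratio \<sigma> a (y j) else 1) \<in> borel_measurable (samples N)" if "j \<in> {1..N}" for j
    using measurable_compose[OF measurable_sample[OF that] measurable_symbol_ratio] by (cases "j \<in> slot n t") auto
  then show ?thesis unfolding slot_ratio_def by (intro borel_measurable_prod) auto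
qed

lemma measurable_mixture_ratio [measurable]: "mixture_ratio \<sigma> a n T \<in> borel_measurable (samples (n * T))"
  unfolding mixture_ratio_def by measurable

text \<open>For any fixed message the signs of its codeword are independent and uniform. The average
  is therefore the same for all messages, and the message drops out of Willie's observation.\<close>

lemma average_likelihood_ratio:
  assumes w: "w \<in> {1..2 ^ M}" and t: "t \<in> {1..T}" and n: "n \<ge> 1"
  shows "(\<Sum>k\<in>codebooks n M. likelihood_ratio \<sigma> (n * T) (placed n ((t - 1) * n + 1) (\<lambda>i. a * k i w)) y)
      / real (card (codebooks n M))
    = slot_ratio \<sigma> a n (n * T) t y"
proof -
  let ?l = "(t - 1) * n + 1"
  let ?h = "\<lambda>i x. exp (a * x * y (?l + i - 1) / \<sigma>\<^sup>2 - (a * x)\<^sup>2 / (2 * \<sigma>\<^sup>2))"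
  note l = slot_location_bounds[OF t n]
  have "likelihood_ratio \<sigma> (n * T) (placed n ?l (\<lambda>i. a * k i w)) y = (\<Prod>i=1..n. ?h i (k i w))" for k
    unfolding likelihood_ratio_def
    by (subst sum_placed[OF l, of "\<lambda>j x. x * y j / \<sigma>\<^sup>2 - x\<^sup>2 / (2 * \<sigma>\<^sup>2)"]) (simp_all add: exp_sum)
  then have "(\<Sum>k\<in>codebooks n M. likelihood_ratio \<sigma> (n * T) (placed n ?l (\<lambda>i. a * k i w)) y) / real (card (codebooks n M))
    = (\<Prod>i=1..n. (?h i 1 + ?h i (- 1)) / 2)"
    by (simp only: sum_codebooks_one[OF w, where n = n and h = ?h])
  also have "\<dots> = (\<Prod>i=1..n. symbol_ratio \<sigma> a (y (?l + i - 1)))"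
    by (simp add: symbol_ratio_def)
  also have "\<dots> = (\<Prod>j\<in>slot n t. symbol_ratio \<sigma> a (y j))"
    unfolding slot_def
    by (intro prod.reindex_bij_witness[of _ "\<lambda>j. j - ?l + 1" "\<lambda>i. ?l + i - 1"]) auto
  also have "\<dots> = slot_ratio \<sigma> a n (n * T) t y"
  proof -
    have "slot n t \<subseteq> {1..n * T}" using l by (auto simp: slot_def)
    then show ?thesis by (simp add: slot_ratio_def prod.If_cases Int_absorb1)
  qed
  finally show ?thesis .
qed

text \<open>Secrecy of codebook and slot enters here: Willie's test depends on neither, so their
  averages pass through it onto the likelihood ratio.\<close>

lemma missed_detection_bpsk:
  assumes \<sigma>: "\<sigma>b > 0" "\<sigma>w > 0" and n: "n \<ge> 1" and T: "T \<ge> 1" and P: "a\<^sup>2 \<le> P"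
    and \<phi>: "hypothesis_test (n * T) \<phi>"
  shows "ennreal (missed_detection \<sigma>b \<sigma>w n (n * T) (bpsk_scheme a n (n * T) M) (slot_location n T) \<phi>)
    = (\<integral>\<^sup>+y. ennreal (mixture_ratio \<sigma>w a n T y) * ennreal (1 - \<phi> y) \<partial>awgn \<sigma>w (n * T))"
proof -
  let ?S = "bpsk_scheme a n (n * T) M"
  let ?CB = "codebooks n M"
  let ?Q = "awgn \<sigma>w (n * T)"
  let ?L = "\<lambda>w k t y. likelihood_ratio \<sigma>w (n * T) (placed n ((t - 1) * n + 1) (\<lambda>i. a * k i w)) y"
  have valid: "valid_scheme n (n * T) P ?S" by (rule valid_bpsk_scheme[OF n P])
  have \<phi>_m[measurable]: "\<phi> \<in> borel_measurable (samples (n * T))"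
    using \<phi> by (simp add: hypothesis_test_def)
  define F where "F = (\<lambda>(w, k, l). \<integral>\<^sup>+z. ennreal (1 - \<phi> (received n (n * T) l (encode ?S w k) z)) \<partial>?Q)"
  have F_m: "F \<in> borel_measurable (source_space ?S (slot_location n T))"
    unfolding F_def by (rule missed_detection_eq(3)[OF valid \<sigma> \<phi>])
  have L_m: "(\<lambda>y. ennreal (?L w k t y) * ennreal (1 - \<phi> y)) \<in> borel_measurable ?Q" for w k t
  proof -
    have "(\<lambda>y. ennreal (?L w k t y) * ennreal (1 - \<phi> y)) \<in> borel_measurable (samples (n * T))"
      by measurable
    then show ?thesis by (simp only: measurable_cong_sets[OF sets_awgn refl])
  qed
  have F: "F (w, k, (t - 1) * n + 1) = (\<integral>\<^sup>+y. ennreal (?L w k t y) * ennreal (1 - \<phi> y) \<partial>?Q)" for w k t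
  proof -
    have m: "(\<lambda>y. ennreal (1 - \<phi> y)) \<in> borel_measurable (samples (n * T))" by measurable
    show ?thesis
      unfolding F_def using nn_integral_awgn_shift[OF \<sigma>(2) m]
      by (simp add: bpsk_scheme_def received_eq placed_restrict)
  qed
  have "ennreal (missed_detection \<sigma>b \<sigma>w n (n * T) ?S (slot_location n T) \<phi>)
     = (\<integral>\<^sup>+u. F u \<partial>source_space ?S (slot_location n T))"
    unfolding F_def by (rule missed_detection_eq(1)[OF valid \<sigma> \<phi>])
  also have "\<dots> = (\<Sum>w\<in>{1..2 ^ M}. ennreal (1 / 2 ^ M) * (\<Sum>k\<in>?CB. ennreal (1 / real (card ?CB)) *
        (\<Sum>t\<in>{1..T}. ennreal (1 / real T) * F (w, k, (t - 1) * n + 1))))"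
    by (rule nn_integral_source_bpsk[OF valid T F_m])
  also have "\<dots> = (\<integral>\<^sup>+y. (\<Sum>w\<in>{1..2 ^ M}. ennreal (1 / 2 ^ M) * (\<Sum>k\<in>?CB. ennreal (1 / real (card ?CB)) *
        (\<Sum>t\<in>{1..T}. ennreal (1 / real T) * (ennreal (?L w k t y) * ennreal (1 - \<phi> y))))) \<partial>?Q)"
    unfolding F using L_m by (simp add: nn_integral_sum nn_integral_cmult)
  also have "\<dots> = (\<integral>\<^sup>+y. ennreal (mixture_ratio \<sigma>w a n T y) * ennreal (1 - \<phi> y) \<partial>?Q)"
  proof (rule nn_integral_cong)
    fix y
    have L0: "0 \<le> ?L w k t y" for w k t by (simp add: likelihood_ratio_def)
    have "(\<Sum>w\<in>{1..2 ^ M}. ennreal (1 / 2 ^ M) * (\<Sum>k\<in>?CB. ennreal (1 / real (card ?CB)) *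
        (\<Sum>t\<in>{1..T}. ennreal (1 / real T) * (ennreal (?L w k t y) * ennreal (1 - \<phi> y)))))
      = (\<Sum>w\<in>{1..2 ^ M}. ennreal (1 / 2 ^ M) * (\<Sum>k\<in>?CB. ennreal (1 / real (card ?CB)) *
        (\<Sum>t\<in>{1..T}. ennreal (1 / real T) * ennreal (?L w k t y)))) * ennreal (1 - \<phi> y)"
      by (simp only: sum_distrib_right mult.assoc)
    also have "(\<Sum>w\<in>{1..2 ^ M}. ennreal (1 / 2 ^ M) * (\<Sum>k\<in>?CB. ennreal (1 / real (card ?CB)) *
        (\<Sum>t\<in>{1..T}. ennreal (1 / real T) * ennreal (?L w k t y))))
      = ennreal (\<Sum>w\<in>{1..2 ^ M}. 1 / 2 ^ M * (\<Sum>k\<in>?CB. 1 / real (card ?CB) * (\<Sum>t\<in>{1..T}. 1 / real T * ?L w k t y)))"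
    proof -
      have t: "(\<Sum>t\<in>{1..T}. ennreal (1 / real T) * ennreal (?L w k t y)) = ennreal (\<Sum>t\<in>{1..T}. 1 / real T * ?L w k t y)" for w k
        by (intro sum_ennreal_cmult L0) simp
      have t0: "0 \<le> (\<Sum>t\<in>{1..T}. 1 / real T * ?L w k t y)" for w k
        using L0 by (intro sum_nonneg mult_nonneg_nonneg) auto
      have k: "(\<Sum>k\<in>?CB. ennreal (1 / real (card ?CB)) * ennreal (\<Sum>t\<in>{1..T}. 1 / real T * ?L w k t y))
         = ennreal (\<Sum>k\<in>?CB. 1 / real (card ?CB) * (\<Sum>t\<in>{1..T}. 1 / real T * ?L w k t y))" for w
        by (intro sum_ennreal_cmult t0) simp
      have k0: "0 \<le> (\<Sum>k\<in>?CB. 1 / real (card ?CB) * (\<Sum>t\<in>{1..T}. 1 / real T * ?L w k t y))" for w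
        by (rule sum_nonneg, rule mult_nonneg_nonneg[OF _ t0]) simp
      show ?thesis unfolding t k
        by (intro sum_ennreal_cmult k0) simp
    qed
    also have "(\<Sum>w\<in>{1..2 ^ M}. 1 / 2 ^ M * (\<Sum>k\<in>?CB. 1 / real (card ?CB) * (\<Sum>t\<in>{1..T}. 1 / real T * ?L w k t y)))
       = (\<Sum>w\<in>{1..2 ^ M::nat}. 1 / 2 ^ M * mixture_ratio \<sigma>w a n T y)"
    proof (intro sum.cong refl arg_cong2[where f = "(*)"])
      fix w :: nat assume w: "w \<in> {1..2 ^ M}"
      have "(\<Sum>k\<in>?CB. 1 / real (card ?CB) * (\<Sum>t\<in>{1..T}. 1 / real T * ?L w k t y))
        = (\<Sum>k\<in>?CB. \<Sum>t\<in>{1..T}. 1 / real T * (?L w k t y / real (card ?CB)))"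
        by (simp add: sum_distrib_left sum_divide_distrib mult.commute)
      also have "\<dots> = (\<Sum>t\<in>{1..T}. \<Sum>k\<in>?CB. 1 / real T * (?L w k t y / real (card ?CB)))"
        by (rule sum.swap)
      also have "\<dots> = (\<Sum>t\<in>{1..T}. 1 / real T * ((\<Sum>k\<in>?CB. ?L w k t y) / real (card ?CB)))"
        by (simp only: sum_divide_distrib sum_distrib_left)
      also have "\<dots> = mixture_ratio \<sigma>w a n T y"
        unfolding mixture_ratio_def by (intro sum.cong refl) (simp only: average_likelihood_ratio[OF w _ n])
      finally show "(\<Sum>k\<in>?CB. 1 / real (card ?CB) * (\<Sum>t\<in>{1..T}. 1 / real T * ?L w k t y)) = mixture_ratio \<sigma>w a n T y" .
    qed
    also have "\<dots> = mixture_ratio \<sigma>w a n T y" by simp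
    finally show "(\<Sum>w\<in>{1..2 ^ M}. ennreal (1 / 2 ^ M) * (\<Sum>k\<in>?CB. ennreal (1 / real (card ?CB)) *
        (\<Sum>t\<in>{1..T}. ennreal (1 / real T) * (ennreal (?L w k t y) * ennreal (1 - \<phi> y)))))
       = ennreal (mixture_ratio \<sigma>w a n T y) * ennreal (1 - \<phi> y)" .
  qed
  finally show ?thesis .
qed

lemma gaussian_exp_combination:
  assumes "\<sigma> > 0" "p \<ge> 0" "q \<ge> 0" "r \<ge> 0"
  shows "(\<integral>\<^sup>+x. ennreal (p * exp (b * x) + q * exp (c * x) + r) \<partial>gaussian \<sigma>)
    = ennreal (p * exp (\<sigma>\<^sup>2 * b\<^sup>2 / 2) + q * exp (\<sigma>\<^sup>2 * c\<^sup>2 / 2) + r)"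
proof -
  interpret prob_space "gaussian \<sigma>" by (rule prob_space_gaussian[OF assms(1)])
  have mass: "emeasure (gaussian \<sigma>) UNIV = 1" using emeasure_space_1 by simp
  have "(\<integral>\<^sup>+x. ennreal (p * exp (b * x) + q * exp (c * x) + r) \<partial>gaussian \<sigma>)
     = (\<integral>\<^sup>+x. ennreal p * ennreal (exp (b * x)) + ennreal q * ennreal (exp (c * x)) + ennreal r \<partial>gaussian \<sigma>)"
    using assms by (simp add: ennreal_mult)
  also have "\<dots> = ennreal p * ennreal (exp (\<sigma>\<^sup>2 * b\<^sup>2 / 2)) + ennreal q * ennreal (exp (\<sigma>\<^sup>2 * c\<^sup>2 / 2)) + ennreal r"
    by (simp add: nn_integral_add nn_integral_cmult gaussian_mgf[OF assms(1)] mass)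
  finally show ?thesis using assms by (simp add: ennreal_mult)
qed

lemma nn_integral_symbol_ratio:
  assumes "\<sigma> > 0"
  shows "(\<integral>\<^sup>+x. ennreal (symbol_ratio \<sigma> a x) \<partial>gaussian \<sigma>) = 1"
proof -
  let ?c = "exp (- a\<^sup>2 / (2 * \<sigma>\<^sup>2)) / 2"
  have "symbol_ratio \<sigma> a x = ?c * exp (a / \<sigma>\<^sup>2 * x) + ?c * exp (- a / \<sigma>\<^sup>2 * x) + 0" for x
    by (simp add: symbol_ratio_def exp_diff exp_minus field_simps)
  then have "(\<integral>\<^sup>+x. ennreal (symbol_ratio \<sigma> a x) \<partial>gaussian \<sigma>)
     = ennreal (?c * exp (\<sigma>\<^sup>2 * (a / \<sigma>\<^sup>2)\<^sup>2 / 2) + ?c * exp (\<sigma>\<^sup>2 * (- a / \<sigma>\<^sup>2)\<^sup>2 / 2) + 0)"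
    by (simp only:) (rule gaussian_exp_combination, use assms in auto)
  also have "?c * exp (\<sigma>\<^sup>2 * (a / \<sigma>\<^sup>2)\<^sup>2 / 2) + ?c * exp (\<sigma>\<^sup>2 * (- a / \<sigma>\<^sup>2)\<^sup>2 / 2) + 0 = 1"
  proof -
    have "\<sigma>\<^sup>2 * (a / \<sigma>\<^sup>2)\<^sup>2 / 2 = a\<^sup>2 / (2 * \<sigma>\<^sup>2)" "\<sigma>\<^sup>2 * (- a / \<sigma>\<^sup>2)\<^sup>2 / 2 = a\<^sup>2 / (2 * \<sigma>\<^sup>2)"
      using assms by (simp_all add: power2_eq_square)
    then show ?thesis by (simp add: mult_exp_exp)
  qed
  finally show ?thesis by simp
qed

text \<open>Pairs of equal signs contribute \<open>exp (a\<^sup>2 / \<sigma>\<^sup>2)\<close>, pairs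
  of opposite signs \<open>exp (- a\<^sup>2 / \<sigma>\<^sup>2)\<close>, each with weight one half.
  The linear terms in \<open>a\<^sup>2\<close> cancel, which is the gain from random signs.\<close>

lemma nn_integral_symbol_ratio_square:
  assumes "\<sigma> > 0"
  shows "(\<integral>\<^sup>+x. ennreal (symbol_ratio \<sigma> a x * symbol_ratio \<sigma> a x) \<partial>gaussian \<sigma>) = ennreal (cosh (a\<^sup>2 / \<sigma>\<^sup>2))"
proof -
  let ?c = "exp (- a\<^sup>2 / \<sigma>\<^sup>2) / 4"
  have "symbol_ratio \<sigma> a x * symbol_ratio \<sigma> a x
      = ?c * exp (2 * a / \<sigma>\<^sup>2 * x) + ?c * exp (- 2 * a / \<sigma>\<^sup>2 * x) + ?c * 2" for x
  proof -
    have c: "exp (- a\<^sup>2 / \<sigma>\<^sup>2) = exp (- a\<^sup>2 / (2 * \<sigma>\<^sup>2)) * exp (- a\<^sup>2 / (2 * \<sigma>\<^sup>2))"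
      by (simp add: mult_exp_exp)
    have e1: "exp (2 * a / \<sigma>\<^sup>2 * x) = exp (a * x / \<sigma>\<^sup>2) * exp (a * x / \<sigma>\<^sup>2)"
      by (simp add: mult_exp_exp)
    have e2: "exp (- 2 * a / \<sigma>\<^sup>2 * x) = exp (- a * x / \<sigma>\<^sup>2) * exp (- a * x / \<sigma>\<^sup>2)"
      by (simp add: mult_exp_exp)
    have e3: "exp (a * x / \<sigma>\<^sup>2) * exp (- a * x / \<sigma>\<^sup>2) = 1"
      by (simp add: mult_exp_exp)
    have s: "symbol_ratio \<sigma> a x = exp (- a\<^sup>2 / (2 * \<sigma>\<^sup>2)) * (exp (a * x / \<sigma>\<^sup>2) + exp (- a * x / \<sigma>\<^sup>2)) / 2"
      by (simp add: symbol_ratio_def distrib_left mult_exp_exp)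
    have "(p * (q + r) / 2) * (p * (q + r) / 2) = (p * p) / 4 * (q * q) + (p * p) / 4 * (r * r) + (p * p) / 4 * (2 * (q * r))" for p q r :: real
      by (simp add: field_simps)
    from this[of "exp (- a\<^sup>2 / (2 * \<sigma>\<^sup>2))" "exp (a * x / \<sigma>\<^sup>2)" "exp (- a * x / \<sigma>\<^sup>2)"]
    show ?thesis unfolding s e1 e2 e3 c by simp
  qed
  then have "(\<integral>\<^sup>+x. ennreal (symbol_ratio \<sigma> a x * symbol_ratio \<sigma> a x) \<partial>gaussian \<sigma>)
     = ennreal (?c * exp (\<sigma>\<^sup>2 * (2 * a / \<sigma>\<^sup>2)\<^sup>2 / 2) + ?c * exp (\<sigma>\<^sup>2 * (- 2 * a / \<sigma>\<^sup>2)\<^sup>2 / 2) + ?c * 2)"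
    by (simp only:) (rule gaussian_exp_combination, use assms in auto)
  also have "?c * exp (\<sigma>\<^sup>2 * (2 * a / \<sigma>\<^sup>2)\<^sup>2 / 2) + ?c * exp (\<sigma>\<^sup>2 * (- 2 * a / \<sigma>\<^sup>2)\<^sup>2 / 2) + ?c * 2 = cosh (a\<^sup>2 / \<sigma>\<^sup>2)"
  proof -
    have "\<sigma>\<^sup>2 * (2 * a / \<sigma>\<^sup>2)\<^sup>2 / 2 = 2 * (a\<^sup>2 / \<sigma>\<^sup>2)" "\<sigma>\<^sup>2 * (- 2 * a / \<sigma>\<^sup>2)\<^sup>2 / 2 = 2 * (a\<^sup>2 / \<sigma>\<^sup>2)"
      using assms by (simp_all add: power2_eq_square)
    then show ?thesis by (simp add: cosh_def mult_exp_exp field_simps)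
  qed
  finally show ?thesis .
qed

lemma disjoint_slots:
  assumes "t \<in> {1..T}" "t' \<in> {1..T}" "t \<noteq> (t'::nat)"
  shows "slot n t \<inter> slot n t' = {}"
proof -
  \<comment> \<open>The condition \<open>1 \<le> t\<close> matters: by truncated subtraction slot 0
    would coincide with slot 1.\<close>
  have *: "slot n t \<inter> slot n t' = {}" if "t < t'" "1 \<le> t" for t t'
  proof -
    have "Suc (t - 1) * n \<le> (t' - 1) * n" using that by (intro mult_le_mono1) simp
    then have "(t - 1) * n + n \<le> (t' - 1) * n" by simp
    then show ?thesis by (auto simp: slot_def)
  qed
  show ?thesis
    using *[of t t'] *[of t' t] assms by (cases "t < t'") (auto simp: Int_commute)
qed

lemma nn_integral_slot_ratio:
  assumes "\<sigma> > 0"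
  shows "(\<integral>\<^sup>+y. ennreal (slot_ratio \<sigma> a n N t y) \<partial>awgn \<sigma> N) = 1"
proof -
  interpret prob_space "gaussian \<sigma>" by (rule prob_space_gaussian[OF assms])
  have "(\<integral>\<^sup>+y. ennreal (slot_ratio \<sigma> a n N t y) \<partial>awgn \<sigma> N)
     = (\<integral>\<^sup>+y. (\<Prod>j\<in>{1..N}. ennreal (if j \<in> slot n t then symbol_ratio \<sigma> a (y j) else 1)) \<partial>awgn \<sigma> N)"
    unfolding slot_ratio_def by (subst prod_ennreal) (auto simp: symbol_ratio_nonneg)
  also have "\<dots> = (\<Prod>j\<in>{1..N}. \<integral>\<^sup>+x. ennreal (if j \<in> slot n t then symbol_ratio \<sigma> a x else 1) \<partial>gaussian \<sigma>)"
    by (rule nn_integral_awgn_prod[OF assms]) measurable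
  also have "\<dots> = 1"
  proof (intro prod.neutral ballI)
    fix j
    show "(\<integral>\<^sup>+x. ennreal (if j \<in> slot n t then symbol_ratio \<sigma> a x else 1) \<partial>gaussian \<sigma>) = 1"
      using nn_integral_symbol_ratio[OF assms] emeasure_space_1 by (cases "j \<in> slot n t") simp_all
  qed
  finally show ?thesis .
qed

text \<open>Only periods common to both slots see a squared factor; elsewhere a single factor or
  none is left, with mean 1. Distinct slots share no period and are thus uncorrelated.\<close>

lemma nn_integral_slot_ratio_mult:
  assumes "\<sigma> > 0" and t: "t \<in> {1..T}" "t' \<in> {1..T}" and n: "n \<ge> 1"
  shows "(\<integral>\<^sup>+y. ennreal (slot_ratio \<sigma> a n (n * T) t y * slot_ratio \<sigma> a n (n * T) t' y) \<partial>awgn \<sigma> (n * T))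
    = ennreal (if t = t' then cosh (a\<^sup>2 / \<sigma>\<^sup>2) ^ n else 1)"
proof -
  interpret prob_space "gaussian \<sigma>" by (rule prob_space_gaussian[OF assms(1)])
  let ?f = "\<lambda>j x. if j \<in> slot n t then symbol_ratio \<sigma> a x else 1"
  let ?f' = "\<lambda>j x. if j \<in> slot n t' then symbol_ratio \<sigma> a x else 1"
  let ?\<chi> = "cosh (a\<^sup>2 / \<sigma>\<^sup>2)"
  have "(\<integral>\<^sup>+y. ennreal (slot_ratio \<sigma> a n (n * T) t y * slot_ratio \<sigma> a n (n * T) t' y) \<partial>awgn \<sigma> (n * T))
     = (\<integral>\<^sup>+y. (\<Prod>j\<in>{1..n * T}. ennreal (?f j (y j) * ?f' j (y j))) \<partial>awgn \<sigma> (n * T))"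
    unfolding slot_ratio_def prod.distrib[symmetric]
    by (subst prod_ennreal) (auto simp: symbol_ratio_nonneg intro!: mult_nonneg_nonneg)
  also have "\<dots> = (\<Prod>j\<in>{1..n * T}. \<integral>\<^sup>+x. ennreal (?f j x * ?f' j x) \<partial>gaussian \<sigma>)"
    by (rule nn_integral_awgn_prod[OF assms(1)]) measurable
  also have "\<dots> = (\<Prod>j\<in>{1..n * T}. ennreal (if j \<in> slot n t \<inter> slot n t' then ?\<chi> else 1))"
  proof (intro prod.cong refl)
    fix j
    show "(\<integral>\<^sup>+x. ennreal (?f j x * ?f' j x) \<partial>gaussian \<sigma>) = ennreal (if j \<in> slot n t \<inter> slot n t' then ?\<chi> else 1)"
      using nn_integral_symbol_ratio[OF assms(1)] nn_integral_symbol_ratio_square[OF assms(1)] emeasure_space_1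
      by (cases "j \<in> slot n t"; cases "j \<in> slot n t'") simp_all
  qed
  also have "\<dots> = ennreal (\<Prod>j\<in>{1..n * T}. if j \<in> slot n t \<inter> slot n t' then ?\<chi> else 1)"
    by (rule prod_ennreal) (auto simp: cosh_real_nonneg)
  also have "(\<Prod>j\<in>{1..n * T}. if j \<in> slot n t \<inter> slot n t' then ?\<chi> else 1) = ?\<chi> ^ card (slot n t \<inter> slot n t')"
  proof -
    have "slot n t \<inter> slot n t' \<subseteq> {1..n * T}"
      using slot_location_bounds[OF t(1) n] by (auto simp: slot_def)
    then show ?thesis by (simp add: prod.If_cases Int_absorb1 flip: Collect_conj_eq Int_def)
  qed
  also have "\<dots> = (if t = t' then ?\<chi> ^ n else 1)"
    using disjoint_slots[OF t, of n] by (auto simp: slot_def)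
  finally show ?thesis .
qed

lemma nn_integral_mixture_ratio:
  assumes "\<sigma> > 0" and T: "T \<ge> 1"
  shows "(\<integral>\<^sup>+y. ennreal (mixture_ratio \<sigma> a n T y) \<partial>awgn \<sigma> (n * T)) = 1"
proof -
  have m: "(\<lambda>y. ennreal (slot_ratio \<sigma> a n (n * T) t y)) \<in> borel_measurable (awgn \<sigma> (n * T))" for t
    using measurable_compose[OF measurable_slot_ratio measurable_ennreal] by (simp add: measurable_cong_sets[OF sets_awgn refl])
  have "ennreal (mixture_ratio \<sigma> a n T y) = (\<Sum>t\<in>{1..T}. ennreal (1 / real T) * ennreal (slot_ratio \<sigma> a n (n * T) t y))" for y
    unfolding mixture_ratio_def
    by (rule sum_ennreal_cmult[symmetric]) (auto simp: slot_ratio_nonneg)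
  then have "(\<integral>\<^sup>+y. ennreal (mixture_ratio \<sigma> a n T y) \<partial>awgn \<sigma> (n * T)) = (\<Sum>t\<in>{1..T}. ennreal (1 / real T) * 1)"
    using m by (simp add: nn_integral_sum nn_integral_cmult nn_integral_slot_ratio[OF assms(1)])
  also have "\<dots> = ennreal (\<Sum>t\<in>{1..T}. 1 / real T)" by (subst sum_ennreal[symmetric]) auto
  also have "\<dots> = 1" using T by simp
  finally show ?thesis .
qed

text \<open>Of the \<open>T * T\<close> products only the \<open>T\<close> diagonal ones exceed 1,
  which divides the excess of a single slot by \<open>T\<close>.\<close>

lemma nn_integral_mixture_ratio_square:
  assumes "\<sigma> > 0" and T: "T \<ge> 1" and n: "n \<ge> 1"
  shows "(\<integral>\<^sup>+y. ennreal ((mixture_ratio \<sigma> a n T y)\<^sup>2) \<partial>awgn \<sigma> (n * T))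
    = ennreal (1 + (cosh (a\<^sup>2 / \<sigma>\<^sup>2) ^ n - 1) / real T)"
proof -
  let ?B = "\<lambda>t y. slot_ratio \<sigma> a n (n * T) t y"
  let ?\<chi> = "cosh (a\<^sup>2 / \<sigma>\<^sup>2)"
  let ?c = "1 / real T * (1 / real T)"
  have m: "(\<lambda>y. ennreal (?B t y * ?B t' y)) \<in> borel_measurable (awgn \<sigma> (n * T))" for t t'
    using measurable_compose[OF borel_measurable_times[OF measurable_slot_ratio measurable_slot_ratio] measurable_ennreal]
    by (simp add: measurable_cong_sets[OF sets_awgn refl])
  have sq: "(mixture_ratio \<sigma> a n T y)\<^sup>2 = (\<Sum>t\<in>{1..T}. \<Sum>t'\<in>{1..T}. ?c * (?B t y * ?B t' y))" for y
    unfolding mixture_ratio_def power2_eq_square sum_product by (intro sum.cong refl) (simp only: mult_ac)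
  have "ennreal ((mixture_ratio \<sigma> a n T y)\<^sup>2) = (\<Sum>t\<in>{1..T}. \<Sum>t'\<in>{1..T}. ennreal ?c * ennreal (?B t y * ?B t' y))" for y
  proof -
    have "(\<Sum>t'\<in>{1..T}. ennreal ?c * ennreal (?B t y * ?B t' y)) = ennreal (\<Sum>t'\<in>{1..T}. ?c * (?B t y * ?B t' y))" for t
      by (rule sum_ennreal_cmult) (auto intro!: mult_nonneg_nonneg simp: slot_ratio_nonneg)
    then show ?thesis unfolding sq
      by (simp only:) (rule sum_ennreal[symmetric], intro sum_nonneg mult_nonneg_nonneg slot_ratio_nonneg, auto)
  qed
  then have "(\<integral>\<^sup>+y. ennreal ((mixture_ratio \<sigma> a n T y)\<^sup>2) \<partial>awgn \<sigma> (n * T))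
     = (\<integral>\<^sup>+y. (\<Sum>t\<in>{1..T}. \<Sum>t'\<in>{1..T}. ennreal ?c * ennreal (?B t y * ?B t' y)) \<partial>awgn \<sigma> (n * T))"
    by (simp only:)
  also have "\<dots> = (\<Sum>t\<in>{1..T}. \<Sum>t'\<in>{1..T}. ennreal ?c * (\<integral>\<^sup>+y. ennreal (?B t y * ?B t' y) \<partial>awgn \<sigma> (n * T)))"
    using m by (subst nn_integral_sum, simp, subst nn_integral_sum) (simp_all add: nn_integral_cmult)
  also have "\<dots> = (\<Sum>t\<in>{1..T}. \<Sum>t'\<in>{1..T}. ennreal (?c * (if t = t' then ?\<chi> ^ n else 1)))"
  proof (intro sum.cong refl)
    fix t t' assume "t \<in> {1..T}" "t' \<in> {1..T}"
    then show "ennreal ?c * (\<integral>\<^sup>+y. ennreal (?B t y * ?B t' y) \<partial>awgn \<sigma> (n * T)) = ennreal (?c * (if t = t' then ?\<chi> ^ n else 1))"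
      by (subst nn_integral_slot_ratio_mult[OF assms(1) _ _ n]) (assumption+, rule ennreal_mult[symmetric], auto simp: cosh_real_nonneg)
  qed
  also have "\<dots> = ennreal (\<Sum>t\<in>{1..T}. \<Sum>t'\<in>{1..T}. ?c * (if t = t' then ?\<chi> ^ n else 1))"
    by (subst sum_ennreal, simp add: cosh_real_nonneg, rule sum_ennreal) (intro sum_nonneg, simp add: cosh_real_nonneg)
  also have "(\<Sum>t\<in>{1..T}. \<Sum>t'\<in>{1..T}. ?c * (if t = t' then ?\<chi> ^ n else 1)) = 1 + (?\<chi> ^ n - 1) / real T"
  proof -
    have "(\<Sum>t'\<in>{1..T}. if t = t' then ?\<chi> ^ n else 1) = ?\<chi> ^ n - 1 + real T" if "t \<in> {1..T}" for t
    proof -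
      have "(\<Sum>t'\<in>{1..T}. if t = t' then ?\<chi> ^ n else 1) = (\<Sum>t'\<in>{1..T}. (if t = t' then ?\<chi> ^ n - 1 else 0) + 1)"
        by (intro sum.cong) auto
      also have "\<dots> = ?\<chi> ^ n - 1 + real T" using that by (simp only: sum.distrib sum.delta) simp
      finally show ?thesis .
    qed
    then have "(\<Sum>t\<in>{1..T}. \<Sum>t'\<in>{1..T}. ?c * (if t = t' then ?\<chi> ^ n else 1)) = (\<Sum>t\<in>{1..T}. ?c * (?\<chi> ^ n - 1 + real T))"
      by (intro sum.cong refl) (simp only: sum_distrib_left[symmetric])
    also have "\<dots> = real T * (?c * (?\<chi> ^ n - 1 + real T))" by simp
    also have "\<dots> = 1 + (?\<chi> ^ n - 1) / real T" using T by (simp add: field_simps)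
    finally show ?thesis .
  qed
  finally show ?thesis .
qed

section \<open>Estimates for the chosen amplitude and assembly of the two halves\<close>

text \<open>The difference \<open>x\<^sup>2 / 2 - ln (cosh x)\<close> vanishes at 0 and has
  derivative \<open>x - tanh x\<close>, which is nonnegative because its own derivative is
  \<open>(tanh x)\<^sup>2\<close>.\<close>

lemma cosh_le_exp_square:
  assumes "0 \<le> (x::real)"
  shows "cosh x \<le> exp (x\<^sup>2 / 2)"
proof -
  have tanh_le: "tanh y \<le> y" if "0 \<le> y" for y :: real
  proof -
    have "0 - tanh 0 \<le> y - tanh y"
    proof (rule DERIV_nonneg_imp_nondecreasing[OF that])
      fix z :: real
      have "((\<lambda>z. z - tanh z) has_real_derivative 1 - (1 - tanh z ^ 2)) (at z)"
        by (auto intro!: derivative_eq_intros)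
      then show "\<exists>d. ((\<lambda>z. z - tanh z) has_real_derivative d) (at z) \<and> 0 \<le> d"
        by (intro exI[of _ "1 - (1 - tanh z ^ 2)"]) auto
    qed
    then show ?thesis by simp
  qed
  have "0\<^sup>2 / 2 - ln (cosh 0) \<le> x\<^sup>2 / 2 - ln (cosh x)"
  proof (rule DERIV_nonneg_imp_nondecreasing[OF assms])
    fix z :: real assume z: "0 \<le> z" "z \<le> x"
    have "((\<lambda>z. z\<^sup>2 / 2 - ln (cosh z)) has_real_derivative z - tanh z) (at z)"
      by (auto intro!: derivative_eq_intros simp: tanh_def cosh_real_pos)
    then show "\<exists>d. ((\<lambda>z. z\<^sup>2 / 2 - ln (cosh z)) has_real_derivative d) (at z) \<and> 0 \<le> d"
      using tanh_le[OF z(1)] by (intro exI[of _ "z - tanh z"]) auto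
  qed
  then have "ln (cosh x) \<le> x\<^sup>2 / 2" by simp
  then have "exp (ln (cosh x)) \<le> exp (x\<^sup>2 / 2)" by (rule iffD2[OF exp_le_cancel_iff])
  moreover have "exp (ln (cosh x)) = cosh x" by (simp add: cosh_real_pos)
  ultimately show ?thesis by (simp only:)
qed

text \<open>On a bounded range this makes Bob's error exponent proportional to the symbol energy. It
  rests on \<open>exp (- x) \<le> 1 / (1 + x)\<close>.\<close>

lemma half_one_plus_exp_le:
  fixes x X :: real
  assumes "0 \<le> x" "x \<le> X"
  shows "(1 + exp (- x)) / 2 \<le> exp (- (x / (2 * (1 + X))))"
proof -
  have "exp (- x) \<le> 1 / (1 + x)"
    using exp_ge_add_one_self[of x] assms by (simp add: exp_minus field_simps)
  also have "\<dots> = 1 - x / (1 + x)" using assms by (simp add: field_simps)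
  also have "\<dots> \<le> 1 - x / (1 + X)" using assms by (simp add: divide_left_mono)
  finally have "(1 + exp (- x)) / 2 \<le> 1 + - (x / (2 * (1 + X)))" using assms by (simp add: field_simps)
  also have "\<dots> \<le> exp (- (x / (2 * (1 + X))))" by (rule exp_ge_add_one_self)
  finally show ?thesis .
qed

lemma detection_error_bpsk:
  assumes \<sigma>: "\<sigma>b > 0" "\<sigma>w > 0" and n: "n \<ge> 1" and T: "T \<ge> 1" and P: "a\<^sup>2 \<le> P"
    and \<phi>: "hypothesis_test (n * T) \<phi>" and \<delta>: "\<delta> > 0"
  shows "1 \<le> false_alarm \<sigma>w (n * T) \<phi>
      + missed_detection \<sigma>b \<sigma>w n (n * T) (bpsk_scheme a n (n * T) M) (slot_location n T) \<phi>
      + (\<delta> + (cosh (a\<^sup>2 / \<sigma>w\<^sup>2) ^ n - 1) / real T / \<delta>)"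
proof -
  let ?Q = "awgn \<sigma>w (n * T)"
  let ?x = "(cosh (a\<^sup>2 / \<sigma>w\<^sup>2) ^ n - 1) / real T"
  have valid: "valid_scheme n (n * T) P (bpsk_scheme a n (n * T) M)" by (rule valid_bpsk_scheme[OF n P])
  have x: "?x \<ge> 0" by (simp add: cosh_real_ge_1)
  have "1 \<le> (\<integral>\<^sup>+y. ennreal (\<phi> y) \<partial>?Q) + (\<integral>\<^sup>+y. ennreal (mixture_ratio \<sigma>w a n T y) * ennreal (1 - \<phi> y) \<partial>?Q) + ennreal (\<delta> + ?x / \<delta>)"
  proof (rule sum_of_errors_ge[OF prob_space_awgn[OF \<sigma>(2)]])
    show "mixture_ratio \<sigma>w a n T \<in> borel_measurable ?Q" "\<phi> \<in> borel_measurable ?Q"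
      using measurable_mixture_ratio \<phi> by (simp_all add: measurable_cong_sets[OF sets_awgn refl] hypothesis_test_def)
    show "0 \<le> \<phi> y \<and> \<phi> y \<le> 1" if "y \<in> space ?Q" for y
      using that \<phi> by (simp add: hypothesis_test_def space_awgn)
    show "0 \<le> ?x" by (rule x)
  qed (intro mixture_ratio_nonneg nn_integral_mixture_ratio[OF \<sigma>(2) T] nn_integral_mixture_ratio_square[OF \<sigma>(2) T n] \<delta>)+
  also have "\<dots> = ennreal (false_alarm \<sigma>w (n * T) \<phi>
      + missed_detection \<sigma>b \<sigma>w n (n * T) (bpsk_scheme a n (n * T) M) (slot_location n T) \<phi>
      + (\<delta> + ?x / \<delta>))"
  proof -
    have "0 \<le> \<delta> + ?x / \<delta>" using divide_nonneg_pos[OF x \<delta>] \<delta> by linarith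
    with false_alarm_eq(2)[OF \<sigma>(2) \<phi>] missed_detection_eq(2)[OF valid \<sigma> \<phi>, of "slot_location n T"]
    show ?thesis
      by (simp only: false_alarm_eq(1)[OF \<sigma>(2) \<phi>] missed_detection_bpsk[OF \<sigma> n T P \<phi>] ennreal_plus add_nonneg_nonneg)
  qed
  finally show ?thesis by simp
qed

lemma covert_achievability:
  fixes \<sigma>b \<sigma>w P :: real
  assumes \<sigma>: "\<sigma>b > 0" "\<sigma>w > 0" and P: "P > 0"
    and T1: "\<forall>n\<ge>1. T n \<ge> 1" and T: "filterlim T at_top sequentially" and \<epsilon>: "\<epsilon> > 0"
  shows "\<exists>c>0. \<exists>S :: nat \<Rightarrow> (nat \<Rightarrow> nat \<Rightarrow> real) coding_scheme.
    (\<forall>n\<ge>1. valid_scheme n (n * T n) P (S n)) \<and>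
    (\<forall>\<^sub>F n in sequentially. real (msg_bits (S n)) \<ge> c * min (sqrt (real n * ln (real (T n)))) (real n)) \<and>
    (\<lambda>n. bob_error \<sigma>b \<sigma>w n (n * T n) (S n) (slot_location n (T n))) \<longlonglongrightarrow> 0 \<and>
    (\<forall>\<^sub>F n in sequentially. \<forall>\<phi>. hypothesis_test (n * T n) \<phi> \<longrightarrow>
       1 / 2 * (false_alarm \<sigma>w (n * T n) \<phi>
         + missed_detection \<sigma>b \<sigma>w n (n * T n) (S n) (slot_location n (T n)) \<phi>) > 1 / 2 - \<epsilon>)"
proof -
  define A where "A = (\<lambda>n. min (\<sigma>w\<^sup>2 * sqrt (ln (real (T n)) / real n)) P)"
  define a where "a = (\<lambda>n. sqrt (A n))"
  \<comment> \<open>The largest value of \<open>a\<^sup>2 / (2 * \<sigma>b\<^sup>2)\<close> under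
    the power cap.\<close>
  define X where "X = P / (2 * \<sigma>b\<^sup>2)"
  \<comment> \<open>Bob's error exponent per unit of codeword energy, as produced by the
    linearization on \<open>[0, X]\<close>.\<close>
  define \<eta> where "\<eta> = 1 / (4 * \<sigma>b\<^sup>2 * (1 + X))"
  \<comment> \<open>Half of the exponent pays for the \<open>2 ^ M\<close> competing messages and
    the other half drives the error to 0.\<close>
  define M where "M = (\<lambda>n. nat \<lceil>\<eta> / 2 * (real n * A n)\<rceil>)"
  define S where "S = (\<lambda>n. bpsk_scheme (a n) n (n * T n) (M n))"
  define c where "c = \<eta> / 2 * min (\<sigma>w\<^sup>2) P"
  have X: "X > 0" and \<eta>: "\<eta> > 0" and c: "c > 0"
    using \<sigma> P by (auto simp: X_def \<eta>_def c_def intro!: mult_pos_pos divide_pos_pos add_pos_pos)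
  have A0: "A n \<ge> 0" if "n \<ge> 1" for n
    using T1 that P by (auto simp: A_def intro!: mult_nonneg_nonneg divide_nonneg_nonneg)
  have a2: "(a n)\<^sup>2 = A n" if "n \<ge> 1" for n using A0[OF that] by (simp add: a_def)
  have aP: "(a n)\<^sup>2 \<le> P" if "n \<ge> 1" for n using a2[OF that] by (simp add: A_def)
  have nA: "real n * A n = min (\<sigma>w\<^sup>2 * root_nlog T n) (P * real n)" if "n \<ge> 1" for n
  proof -
    have "real n * sqrt (ln (real (T n)) / real n) = sqrt (real n * ln (real (T n)))"
      using that by (simp add: real_sqrt_divide real_sqrt_mult field_simps)
    then have "real n * (\<sigma>w\<^sup>2 * sqrt (ln (real (T n)) / real n)) = \<sigma>w\<^sup>2 * root_nlog T n"
      by (simp add: root_nlog_def mult.left_commute)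
    moreover have "real n * A n = min (real n * (\<sigma>w\<^sup>2 * sqrt (ln (real (T n)) / real n))) (real n * P)"
      unfolding A_def min_mult_distrib_left by simp
    ultimately show ?thesis by (simp only: mult.commute)
  qed
  have r0: "root_nlog T n \<ge> 0" if "n \<ge> 1" for n using T1 that by (simp add: root_nlog_def)
  have valid: "valid_scheme n (n * T n) P (S n)" if "n \<ge> 1" for n
    unfolding S_def using that aP by (intro valid_bpsk_scheme) auto
  have Mge: "real (M n) \<ge> \<eta> / 2 * (real n * A n)" for n
    unfolding M_def by (rule real_nat_ceiling_ge)
  have rate: "real (msg_bits (S n)) \<ge> c * min (sqrt (real n * ln (real (T n)))) (real n)" if n: "n \<ge> 1" for n
  proof -
    have "min (\<sigma>w\<^sup>2) P * min (root_nlog T n) (real n) \<le> min (\<sigma>w\<^sup>2 * root_nlog T n) (P * real n)"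
      using P r0[OF n] by (intro min.boundedI mult_mono) auto
    then have "c * min (root_nlog T n) (real n) \<le> \<eta> / 2 * (real n * A n)"
      unfolding c_def nA[OF n] mult.assoc using \<eta> by (intro mult_left_mono) auto
    with Mge[of n] show ?thesis by (simp add: S_def bpsk_scheme_def root_nlog_def)
  qed
  have nA_top: "filterlim (\<lambda>n. real n * A n) at_top sequentially"
  proof -
    have "filterlim (\<lambda>n. min (\<sigma>w\<^sup>2 * root_nlog T n) (P * real n)) at_top sequentially"
      unfolding filterlim_at_top
    proof
      fix Z :: real
      have "filterlim (\<lambda>n. \<sigma>w\<^sup>2 * root_nlog T n) at_top sequentially" "filterlim (\<lambda>n. P * real n) at_top sequentially"
        using \<sigma> P by (auto intro!: filterlim_tendsto_pos_mult_at_top[OF tendsto_const] filterlim_root_nlog T filterlim_real_sequentially)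
      then have "\<forall>\<^sub>F n in sequentially. Z \<le> \<sigma>w\<^sup>2 * root_nlog T n" "\<forall>\<^sub>F n in sequentially. Z \<le> P * real n"
        by (simp_all add: filterlim_at_top)
      then show "\<forall>\<^sub>F n in sequentially. Z \<le> min (\<sigma>w\<^sup>2 * root_nlog T n) (P * real n)"
        by eventually_elim simp
    qed
    moreover have "\<forall>\<^sub>F n in sequentially. min (\<sigma>w\<^sup>2 * root_nlog T n) (P * real n) \<le> real n * A n"
      using eventually_ge_at_top[of 1] by eventually_elim (simp add: nA)
    ultimately show ?thesis by (rule filterlim_at_top_mono)
  qed
  have bob: "bob_error \<sigma>b \<sigma>w n (n * T n) (S n) (slot_location n (T n)) \<le> exp 1 * exp (- (\<eta> / 2 * (real n * A n)))"
    if n: "n \<ge> 1" for n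
  proof -
    let ?q = "(1 + exp (- (a n)\<^sup>2 / (2 * \<sigma>b\<^sup>2))) / 2"
    have "bob_error \<sigma>b \<sigma>w n (n * T n) (S n) (slot_location n (T n)) \<le> 2 ^ M n * ?q ^ n"
      unfolding S_def using n T1 aP by (intro bob_error_bpsk_le[OF \<sigma>]) auto
    also have "\<dots> \<le> (exp 1 * exp (\<eta> / 2 * (real n * A n))) * exp (- \<eta> * A n) ^ n"
    proof (intro mult_mono power_mono)
      \<comment> \<open>The crude \<open>2 \<le> exp 1\<close> costs only a constant in the rate;
        the factor \<open>exp 1\<close> in the bound pays for the rounding in
        \<open>M\<close>.\<close>
      have "(2::real) ^ M n \<le> exp 1 ^ M n"
        using exp_ge_add_one_self[of 1] by (intro power_mono) auto
      also have "\<dots> = exp (real (M n))" by (simp add: exp_of_nat_mult[symmetric])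
      also have "real (M n) \<le> 1 + \<eta> / 2 * (real n * A n)"
      proof -
        have "0 \<le> \<eta> / 2 * (real n * A n)" using \<eta> A0[OF n] by simp
        then show ?thesis unfolding M_def by linarith
      qed
      finally show "(2::real) ^ M n \<le> exp 1 * exp (\<eta> / 2 * (real n * A n))" by (simp add: exp_add)
      have "A n / (2 * \<sigma>b\<^sup>2) \<le> X" using \<sigma> by (auto simp: X_def A_def intro!: divide_right_mono)
      from half_one_plus_exp_le[OF _ this]
      have "?q \<le> exp (- (A n / (2 * \<sigma>b\<^sup>2) / (2 * (1 + X))))"
        using A0[OF n] \<sigma> by (simp add: a2[OF n])
      also have "A n / (2 * \<sigma>b\<^sup>2) / (2 * (1 + X)) = \<eta> * A n"
        using X \<sigma> by (simp add: \<eta>_def field_simps)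
      finally show "?q \<le> exp (- \<eta> * A n)" by simp
    qed (auto intro: add_nonneg_nonneg)
    also have "\<dots> = exp 1 * exp (- (\<eta> / 2 * (real n * A n)))"
      by (simp add: exp_of_nat_mult[symmetric] mult_exp_exp algebra_simps)
    finally show ?thesis .
  qed
  have err0: "(\<lambda>n. bob_error \<sigma>b \<sigma>w n (n * T n) (S n) (slot_location n (T n))) \<longlonglongrightarrow> 0"
  proof (rule tendsto_sandwich[OF _ _ tendsto_const])
    show "\<forall>\<^sub>F n in sequentially. 0 \<le> bob_error \<sigma>b \<sigma>w n (n * T n) (S n) (slot_location n (T n))"
      by (simp add: bob_error_def)
    show "\<forall>\<^sub>F n in sequentially. bob_error \<sigma>b \<sigma>w n (n * T n) (S n) (slot_location n (T n))
        \<le> exp 1 * exp (- (\<eta> / 2 * (real n * A n)))"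
      using eventually_ge_at_top[of 1] by eventually_elim (rule bob)
    have "filterlim (\<lambda>n. \<eta> / 2 * (real n * A n)) at_top sequentially"
      using \<eta> by (intro filterlim_tendsto_pos_mult_at_top[OF tendsto_const _ nA_top]) simp
    then have "(\<lambda>n. exp 1 * exp (- (\<eta> / 2 * (real n * A n)))) \<longlonglongrightarrow> exp 1 * 0"
      by (intro tendsto_mult tendsto_const filterlim_compose[OF exp_at_bot] filterlim_compose[OF filterlim_uminus_at_bot_at_top])
    then show "(\<lambda>n. exp 1 * exp (- (\<eta> / 2 * (real n * A n)))) \<longlonglongrightarrow> 0" by simp
  qed
  have chi: "(cosh ((a n)\<^sup>2 / \<sigma>w\<^sup>2) ^ n - 1) / real (T n) \<le> exp (- (ln (real (T n)) / 2))" if n: "n \<ge> 1" for n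
  proof -
    let ?l = "ln (real (T n))"
    have Tp: "real (T n) > 0" using T1 n by (metis less_le_trans of_nat_0_less_iff zero_less_one)
    have l0: "?l \<ge> 0" using T1 n by simp
    \<comment> \<open>The factor \<open>\<sigma>w\<^sup>2\<close> in \<open>A\<close> makes the
      square of this argument at most \<open>ln T / n\<close>. The \<open>n\<close>-th power of the
      hyperbolic cosine is then at most \<open>exp (ln T / 2)\<close>, so a factor
      \<open>sqrt T\<close> of the dilution is left over.\<close>
    have "(a n)\<^sup>2 / \<sigma>w\<^sup>2 \<le> sqrt (?l / real n)"
      unfolding a2[OF n] using \<sigma> by (simp add: A_def divide_le_eq mult.commute)
    moreover have a0: "0 \<le> (a n)\<^sup>2 / \<sigma>w\<^sup>2" by simp
    ultimately have "((a n)\<^sup>2 / \<sigma>w\<^sup>2)\<^sup>2 \<le> (sqrt (?l / real n))\<^sup>2" by (intro power_mono)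
    then have sq: "((a n)\<^sup>2 / \<sigma>w\<^sup>2)\<^sup>2 \<le> ?l / real n" using l0 by simp
    have "cosh ((a n)\<^sup>2 / \<sigma>w\<^sup>2) \<le> exp (((a n)\<^sup>2 / \<sigma>w\<^sup>2)\<^sup>2 / 2)" by (rule cosh_le_exp_square[OF a0])
    also have "\<dots> \<le> exp (?l / real n / 2)" using sq by simp
    finally have "cosh ((a n)\<^sup>2 / \<sigma>w\<^sup>2) ^ n \<le> exp (?l / real n / 2) ^ n"
      by (intro power_mono) (auto simp: cosh_real_nonneg)
    also have "\<dots> = exp (?l / 2)" using n by (simp add: exp_of_nat_mult[symmetric])
    finally have "(cosh ((a n)\<^sup>2 / \<sigma>w\<^sup>2) ^ n - 1) / real (T n) \<le> exp (?l / 2) / real (T n)"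
      using Tp by (intro divide_right_mono) auto
    also have "\<dots> = exp (?l / 2) / exp ?l" using Tp by simp
    also have "\<dots> = exp (- (?l / 2))" unfolding exp_diff[symmetric] by simp
    finally show ?thesis .
  qed
  have detect: "\<forall>\<^sub>F n in sequentially. \<forall>\<phi>. hypothesis_test (n * T n) \<phi> \<longrightarrow>
       1 / 2 * (false_alarm \<sigma>w (n * T n) \<phi>
         + missed_detection \<sigma>b \<sigma>w n (n * T n) (S n) (slot_location n (T n)) \<phi>) > 1 / 2 - \<epsilon>"
  proof -
    have "filterlim (\<lambda>n. ln (real (T n)) / 2) at_top sequentially"
      using filterlim_tendsto_pos_mult_at_top[OF tendsto_const, of "1/2"
          "\<lambda>n. ln (real (T n))" sequentially]
        filterlim_compose[OF ln_at_top filterlim_compose[OF filterlim_real_sequentially T]] by simp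
    then have "(\<lambda>n. exp (- (ln (real (T n)) / 2))) \<longlonglongrightarrow> 0"
      by (intro filterlim_compose[OF exp_at_bot] filterlim_compose[OF filterlim_uminus_at_bot_at_top])
    \<comment> \<open>With \<open>\<delta> = \<epsilon>\<close> and divergence below
      \<open>\<epsilon>\<^sup>2\<close> the loss \<open>\<delta> + x / \<delta>\<close> is below
      \<open>2 * \<epsilon>\<close>, which equal priors halve.\<close>
    then have "\<forall>\<^sub>F n in sequentially. exp (- (ln (real (T n)) / 2)) < \<epsilon>\<^sup>2"
      using \<epsilon> by (intro order_tendstoD) auto
    with eventually_ge_at_top[of 1] show ?thesis
    proof eventually_elim
      case (elim n)
      show ?case
      proof (intro allI impI)
        fix \<phi> assume \<phi>: "hypothesis_test (n * T n) \<phi>"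
        let ?x = "(cosh ((a n)\<^sup>2 / \<sigma>w\<^sup>2) ^ n - 1) / real (T n)"
        have "?x < \<epsilon>\<^sup>2" using chi[OF elim(1)] elim(2) by simp
        then have "?x / \<epsilon> < \<epsilon>\<^sup>2 / \<epsilon>" by (rule divide_strict_right_mono[OF _ \<epsilon>])
        then have "?x / \<epsilon> < \<epsilon>" using \<epsilon> by (simp only: power2_eq_square) simp
        moreover have "1 \<le> false_alarm \<sigma>w (n * T n) \<phi>
          + missed_detection \<sigma>b \<sigma>w n (n * T n) (S n) (slot_location n (T n)) \<phi> + (\<epsilon> + ?x / \<epsilon>)"
          unfolding S_def using elim(1) T1 aP \<phi> \<epsilon> by (intro detection_error_bpsk[OF \<sigma>]) auto
        moreover have "1 / 2 * s > 1 / 2 - e" if "y < e" "1 \<le> s + (e + y)" for s y e :: real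
          using that by linarith
        ultimately show "1 / 2 * (false_alarm \<sigma>w (n * T n) \<phi>
         + missed_detection \<sigma>b \<sigma>w n (n * T n) (S n) (slot_location n (T n)) \<phi>) > 1 / 2 - \<epsilon>"
          by blast
      qed
    qed
  qed
  have rate': "\<forall>\<^sub>F n in sequentially. real (msg_bits (S n)) \<ge> c * min (sqrt (real n * ln (real (T n)))) (real n)"
    using eventually_ge_at_top[of 1] by eventually_elim (rule rate)
  show ?thesis using c valid rate' err0 detect by blast
qed

text \<open>Formulas cannot quantify over types, so the existential half names the key type of its
  witness, the codebooks, while the universal half keeps the key type \<open>'k\<close>
  arbitrary.\<close>

theorem mainTheorem1:
  fixes \<sigma>b \<sigma>w Pmax :: real and T :: "nat \<Rightarrow> nat"
  assumes "\<sigma>b > 0" and "\<sigma>w > 0" and "Pmax > 0"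
    and "\<forall>n\<ge>1. T n \<ge> 1"
    and "filterlim T at_top sequentially"
  shows
    "(\<forall>\<epsilon>>0. \<exists>c>0. \<exists>S :: nat \<Rightarrow> (nat \<Rightarrow> nat \<Rightarrow> real) coding_scheme.
        (\<forall>n\<ge>1. valid_scheme n (n * T n) Pmax (S n)) \<and>
        (\<forall>\<^sub>F n in sequentially.
           real (msg_bits (S n)) \<ge> c * min (sqrt (real n * ln (real (T n)))) (real n)) \<and>
        (\<lambda>n. bob_error \<sigma>b \<sigma>w n (n * T n) (S n) (slot_location n (T n))) \<longlonglongrightarrow> 0 \<and>
        (\<forall>\<^sub>F n in sequentially. \<forall>\<phi>. hypothesis_test (n * T n) \<phi> \<longrightarrow>
           1 / 2 * (false_alarm \<sigma>w (n * T n) \<phi>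
             + missed_detection \<sigma>b \<sigma>w n (n * T n) (S n) (slot_location n (T n)) \<phi>)
           > 1 / 2 - \<epsilon>))
     \<and>
     (\<forall>(S :: nat \<Rightarrow> 'k coding_scheme) (L :: nat \<Rightarrow> nat pmf).
        (\<forall>n\<ge>1. valid_scheme n (n * T n) Pmax (S n)) \<and>
        (\<forall>n\<ge>1. \<forall>l\<in>set_pmf (L n). 1 \<le> l \<and> l + n - 1 \<le> n * T n) \<and>
        filterlim (\<lambda>n. real (msg_bits (S n)) / sqrt (real n * ln (real (T n)))) at_top sequentially \<and>
        (\<lambda>n. bob_error \<sigma>b \<sigma>w n (n * T n) (S n) (L n)) \<longlonglongrightarrow> 0
        \<longrightarrow>
        (\<exists>\<phi> :: nat \<Rightarrow> (nat \<Rightarrow> real) \<Rightarrow> real.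
           (\<forall>n. hypothesis_test (n * T n) (\<phi> n)) \<and>
           (\<lambda>n. false_alarm \<sigma>w (n * T n) (\<phi> n)
             + missed_detection \<sigma>b \<sigma>w n (n * T n) (S n) (L n) (\<phi> n)) \<longlonglongrightarrow> 0))"
proof (intro conjI allI impI, goal_cases)
  case (1 \<epsilon>)
  then show ?case by (rule covert_achievability[OF assms])
next
  case (2 S L)
  then show ?case using assms by (intro covert_converse[where P = Pmax]) auto
qed

end
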